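(* Let $S=\mathbb Z[q,q^{-1}]$, let $n\ge 3$ and let $\alpha$ be a partition of $n$. For $1\le i\le n-2$ let $$St_i=-q^{-3}g_ig_{i+1}g_i+q^{-2}g_ig_{i+1}+q^{-2}g_{i+1}g_i-q^{-1}g_i-q^{-1}g_{i+1}+1$$ be the $i$-th Steinberg element, regarded as an element of $\mathcal E_n^\alpha(q)$, and define $\mathcal{PTL}^\alpha_n(q)=\mathcal E_n^\alpha(q)/\mathcal J_i$, where $\mathcal J_i$ is the two-sided ideal of $\mathcal E_n^\alpha(q)$ generated by $e_ie_{i+1}St_i$, for some $i$. Then $\mathcal{PTL}^\alpha_n(q)$ does not depend on the choice of $i$ and, moreover, $\mathcal{PTL}^\alpha_n(q)=\mathcal{ETL}^\alpha_{n,2}(q)$. Similar statements hold over any field $\mathcal K$ containing a nonzero element $q$.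
   Context: **The algebra.** $\mathfrak S_n$ acts on the right on $\mathbf n=\{1,\dots,n\}$, $s_i=(i,i+1)$. The $bt$-algebra $\mathcal E_n(q)$ is the associative unital $S$-algebra generated by $g_1,\dots,g_{n-1},e_1,\dots,e_{n-1}$ with relations: $g_ig_j=g_jg_i$ for $|i-j|>1$; $g_ie_i=e_ig_i$; $g_ig_jg_i=g_jg_ig_j$ for $|i-j|=1$; $e_ig_jg_i=g_jg_ie_j$ for $|i-j|=1$; $e_ie_jg_j=e_ig_je_i=g_je_ie_j$ for $|i-j|=1$; $e_ie_j=e_je_i$ for all $i,j$; $g_ie_j=e_jg_i$ for $|i-j|>1$; $e_i^2=e_i$; $g_i^2=1+(q-q^{-1})e_ig_i$. **Idempotents.** $\mathcal{SP}_n$ is the set of set partitions of $\mathbf n$, with $A\subseteq B$ if every block of $B$ is a union of blocks of $A$; $\mu$ is its Möbius function. $E_{i,i+1}=e_i$, $E_{ij}=g_iE_{i+1,j}g_i^{-1}$ for $j>i+1$; $E_A=\prod E_{ij}$ over pairs $i<j$ in a common block of $A$ (the factors commute); $\mathbb E_A=\sum_{B:A\subseteq B}\mu(A,B)E_B$. $A$ is of type $\alpha$ if its block sizes in decreasing order form $\alpha$; $\mathbb E_\alpha=\sum_{A\text{ of type }\alpha}\mathbb E_A$ is a central idempotent and $\mathcal E_n^\alpha(q)=\mathbb E_\alpha\mathcal E_n(q)$, an algebra with identity $\mathbb E_\alpha$; an element $a\in\mathcal E_n(q)$ is regarded as the element $\mathbb E_\alpha a$ of $\mathcal E_n^\alpha(q)$.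 Over a field $\mathcal K$ one uses $\mathcal E_n^\alpha(q)\otimes_S\mathcal K$. **The algebra $\mathcal{ETL}^\alpha_{n,N}(q)$.** Let $r$ be the length of $\alpha$ and $V$ the free $S$-module with basis $\{v_i^s\mid1\le i\le N,1\le s\le r\}$. Define operators on $V^{\otimes2}$ (acting on the right): $(v_i^s\otimes v_j^t)\mathbf E=v_i^s\otimes v_j^t$ if $s=t$ and $0$ if $s\ne t$; $(v_i^s\otimes v_j^t)\mathbf G=v_j^t\otimes v_i^s$ if $s\neq t$; $=q\,v_i^s\otimes v_j^t$ if $s=t,i=j$; $=v_j^t\otimes v_i^s$ if $s=t,i<j$; $=(q-q^{-1})v_i^s\otimes v_j^t+v_j^t\otimes v_i^s$ if $s=t,i>j$. Letting $e_i,g_i$ act as $\mathbf E,\mathbf G$ in the $i$-th and $(i+1)$-st factors makes $V^{\otimes n}$ a right $\mathcal E_n(q)$-module; $\mathbb E_\alpha V^{\otimes n}$ is the image of the action of $\mathbb E_\alpha$. Let $\mathcal I\subseteq\mathcal E_n^\alpha(q)$ be the annihilator of $\mathbb E_\alpha V^{\otimes n}$ and put $\mathcal{ETL}^\alpha_{n,N}(q)=\mathcal E_n^\alpha(q)/\mathcal I$. The equality $\mathcal{PTL}^\alpha_n(q)=\mathcal{ETL}^\alpha_{n,2}(q)$ is an equality of quotients of $\mathcal E_n^\alpha(q)$, i.e. $\mathcal J_i=\mathcal I$ for $N=2$. *)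

theory Defs
  imports
    "HOL-Library.Disjoint_Sets"
    "HOL-Library.Multiset"
    "HOL-Library.Poly_Mapping"
    "HOL-Algebra.QuotRing"
    "HOL-Algebra.Module"
begin

section \<open>Algebras: monoid algebras, quotients, base change\<close>

text \<open>Algebras are not assumed commutative; they are represented by the record type of
  \<^theory>\<open>HOL-Algebra.Module\<close> (a ring with a scalar multiplication), the scalars being all
  elements of a type of class \<^class>\<open>comm_ring_1\<close>.  Ideals are two-sided, as in
  \<^theory>\<open>HOL-Algebra.Ideal\<close>.\<close>

abbreviation scale :: "'r::comm_ring_1 \<Rightarrow> ('b \<Rightarrow>\<^sub>0 'r) \<Rightarrow> ('b \<Rightarrow>\<^sub>0 'r)"
  where "scale c v \<equiv> Poly_Mapping.map ((*) c) v"

definition monoid_algebra :: "('a, 'm) monoid_scheme \<Rightarrow> ('r::comm_ring_1, 'a \<Rightarrow>\<^sub>0 'r) module"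
  where "monoid_algebra G =
    \<lparr>carrier = {f. Poly_Mapping.keys f \<subseteq> carrier G},
     mult = (\<lambda>f g. \<Sum>x\<in>Poly_Mapping.keys f. \<Sum>y\<in>Poly_Mapping.keys g.
       Poly_Mapping.single (x \<otimes>\<^bsub>G\<^esub> y) (Poly_Mapping.lookup f x * Poly_Mapping.lookup g y)),
     one = Poly_Mapping.single \<one>\<^bsub>G\<^esub> 1,
     zero = 0,
     add = (+),
     smult = scale\<rparr>"

text \<open>The free algebra on a set of generators is the monoid algebra of the monoid of words.\<close>

definition free_algebra :: "'x set \<Rightarrow> ('r::comm_ring_1, 'x list \<Rightarrow>\<^sub>0 'r) module"
  where "free_algebra X = monoid_algebra \<lparr>carrier = lists X, mult = (@), one = []\<rparr>"

definition quot_algebra :: "('r, 'a, 'm) module_scheme \<Rightarrow> 'a set \<Rightarrow> ('r, 'a set) module"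
  where "quot_algebra A I =
    ring.extend (A Quot I) (module.fields (\<lambda>c X. \<Union>x\<in>X. I +>\<^bsub>A\<^esub> (c \<odot>\<^bsub>A\<^esub> x)))"

text \<open>The algebra \<open>e A\<close> with identity \<open>e\<close>, for a central idempotent \<open>e\<close> of \<open>A\<close>.\<close>

definition corner_algebra :: "('r, 'a) module \<Rightarrow> 'a \<Rightarrow> ('r, 'a) module"
  where "corner_algebra A e = A\<lparr>carrier := {e \<otimes>\<^bsub>A\<^esub> a | a. a \<in> carrier A}, one := e\<rparr>"

text \<open>For an algebra \<open>A\<close> over \<open>'s\<close> and a ring homomorphism \<open>\<phi>\<close> from \<open>'s\<close> to \<open>'k\<close>, the
  base change of \<open>A\<close> along \<open>\<phi>\<close> is the usual tensor product: the free abelian group on pairs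
  \<open>(a, x)\<close>, with multiplication \<open>(a, x) (b, y) = (a b, x y)\<close>, modulo the relations of
  biadditivity and \<open>(s a, x) = (a, \<phi> s x)\<close>.  The additive subgroup generated by these relations
  is already a two-sided ideal, because scalars are central in \<open>A\<close>.\<close>

definition pre_tensor ::
    "('s, 'a) module \<Rightarrow> ('k::comm_ring_1, ('a \<times> 'k) \<Rightarrow>\<^sub>0 int) module"
  where "pre_tensor A =
    (let Z = monoid_algebra (A \<times>\<times> \<lparr>carrier = UNIV, mult = (*), one = 1\<rparr>)
       :: (int, ('a \<times> 'k) \<Rightarrow>\<^sub>0 int) module
     in ring.extend (ring.truncate Z)
          (module.fields (\<lambda>x f. Poly_Mapping.single (\<one>\<^bsub>A\<^esub>, x) 1 \<otimes>\<^bsub>Z\<^esub> f)))"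

abbreviation pair_gen :: "'a \<Rightarrow> 'k \<Rightarrow> (('a \<times> 'k) \<Rightarrow>\<^sub>0 int)"
  where "pair_gen a x \<equiv> Poly_Mapping.single (a, x) 1"

definition tensor_relators ::
    "('s, 'a) module \<Rightarrow> ('s \<Rightarrow> 'k::comm_ring_1) \<Rightarrow> (('a \<times> 'k) \<Rightarrow>\<^sub>0 int) set"
  where "tensor_relators A \<phi> =
    {pair_gen (a \<oplus>\<^bsub>A\<^esub> b) x - pair_gen a x - pair_gen b x | a b x.
       a \<in> carrier A \<and> b \<in> carrier A} \<union>
    {pair_gen a (x + y) - pair_gen a x - pair_gen a y | a x y. a \<in> carrier A} \<union>
    {pair_gen (s \<odot>\<^bsub>A\<^esub> a) x - pair_gen a (\<phi> s * x) | s a x. a \<in> carrier A}"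

definition tensor_ideal ::
    "('s, 'a) module \<Rightarrow> ('s \<Rightarrow> 'k::comm_ring_1) \<Rightarrow> (('a \<times> 'k) \<Rightarrow>\<^sub>0 int) set"
  where "tensor_ideal A \<phi> =
    genideal (pre_tensor A :: ('k, ('a \<times> 'k) \<Rightarrow>\<^sub>0 int) module) (tensor_relators A \<phi>)"

definition base_change ::
    "('s, 'a) module \<Rightarrow> ('s \<Rightarrow> 'k::comm_ring_1) \<Rightarrow> ('k, (('a \<times> 'k) \<Rightarrow>\<^sub>0 int) set) module"
  where "base_change A \<phi> = quot_algebra (pre_tensor A) (tensor_ideal A \<phi>)"

definition pure_tensor ::
    "('s, 'a) module \<Rightarrow> ('s \<Rightarrow> 'k::comm_ring_1) \<Rightarrow> 'a \<Rightarrow> 'k \<Rightarrow> (('a \<times> 'k) \<Rightarrow>\<^sub>0 int) set"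
  where "pure_tensor A \<phi> a x =
    tensor_ideal A \<phi> +>\<^bsub>(pre_tensor A :: ('k, ('a \<times> 'k) \<Rightarrow>\<^sub>0 int) module)\<^esub> pair_gen a x"


section \<open>The ground ring\<close>

text \<open>The ring of integral Laurent polynomials in \<open>q\<close> is the group ring of the additive
  group of integers; \<open>q_pow k\<close> is the \<open>k\<close>-th power of \<open>q\<close>.\<close>

type_synonym laurent = "int \<Rightarrow>\<^sub>0 int"

definition q_pow :: "int \<Rightarrow> laurent"
  where "q_pow k = Poly_Mapping.single k 1"

definition laurent_eval :: "'k::field \<Rightarrow> laurent \<Rightarrow> 'k"
  where "laurent_eval x c =
    (\<Sum>k\<in>Poly_Mapping.keys c. of_int (Poly_Mapping.lookup c k) * x powi k)"


section \<open>The bt-algebra\<close>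

datatype bt_gen = G nat | E nat

type_synonym bt_free = "bt_gen list \<Rightarrow>\<^sub>0 laurent"
type_synonym bt = "bt_free set"

definition bt_gens :: "nat \<Rightarrow> bt_gen set"
  where "bt_gens n = G ` {1..<n} \<union> E ` {1..<n}"

definition word :: "bt_gen list \<Rightarrow> bt_free"
  where "word w = Poly_Mapping.single w 1"

abbreviation adjacent :: "nat \<Rightarrow> nat \<Rightarrow> bool"
  where "adjacent i j \<equiv> i = Suc j \<or> j = Suc i"

abbreviation distant :: "nat \<Rightarrow> nat \<Rightarrow> bool"
  where "distant i j \<equiv> i > Suc j \<or> j > Suc i"

inductive bt_rel :: "bt_free \<Rightarrow> bt_free \<Rightarrow> bool"
  where
    "distant i j \<Longrightarrow> bt_rel (word [G i, G j]) (word [G j, G i])"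
  | "bt_rel (word [G i, E i]) (word [E i, G i])"
  | "adjacent i j \<Longrightarrow> bt_rel (word [G i, G j, G i]) (word [G j, G i, G j])"
  | "adjacent i j \<Longrightarrow> bt_rel (word [E i, G j, G i]) (word [G j, G i, E j])"
  | "adjacent i j \<Longrightarrow> bt_rel (word [E i, E j, G j]) (word [E i, G j, E i])"
  | "adjacent i j \<Longrightarrow> bt_rel (word [E i, G j, E i]) (word [G j, E i, E j])"
  | "bt_rel (word [E i, E j]) (word [E j, E i])"
  | "distant i j \<Longrightarrow> bt_rel (word [G i, E j]) (word [E j, G i])"
  | "bt_rel (word [E i, E i]) (word [E i])"
  | "bt_rel (word [G i, G i]) (word [] + scale (q_pow 1 - q_pow (-1)) (word [E i, G i]))"

definition bt_ideal :: "nat \<Rightarrow> bt_free set"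
  where "bt_ideal n = genideal (free_algebra (bt_gens n) :: (laurent, bt_free) module)
    {l - r | l r. bt_rel l r \<and> l \<in> carrier (free_algebra (bt_gens n) :: (laurent, bt_free) module)
      \<and> r \<in> carrier (free_algebra (bt_gens n) :: (laurent, bt_free) module)}"

definition bt_algebra :: "nat \<Rightarrow> (laurent, bt) module"
  where "bt_algebra n = quot_algebra (free_algebra (bt_gens n)) (bt_ideal n)"

definition bt_g :: "nat \<Rightarrow> nat \<Rightarrow> bt"
  where "bt_g n i =
    bt_ideal n +>\<^bsub>(free_algebra (bt_gens n) :: (laurent, bt_free) module)\<^esub> word [G i]"

definition bt_e :: "nat \<Rightarrow> nat \<Rightarrow> bt"
  where "bt_e n i =
    bt_ideal n +>\<^bsub>(free_algebra (bt_gens n) :: (laurent, bt_free) module)\<^esub> word [E i]"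


section \<open>Set partitions and the idempotents\<close>

text \<open>The set partitions of \<open>{1..n}\<close> are ordered by \<open>refines {1..n}\<close>, for which the
  partition into singletons is the least element.\<close>

lemma refines_iff_unions_of_blocks:
  assumes "partition_on X A" "partition_on X B"
  shows "refines X A B \<longleftrightarrow> (\<forall>b\<in>B. \<exists>C\<subseteq>A. b = \<Union>C)"
proof
  assume r: "refines X A B"
  show "\<forall>b\<in>B. \<exists>C\<subseteq>A. b = \<Union>C"
  proof
    fix b assume "b \<in> B"
    then have "b = \<Union>{a \<in> A. a \<subseteq> b}"
      by (rule partition_onD1[OF refines_obtains_subset[OF r]])
    then show "\<exists>C\<subseteq>A. b = \<Union>C" by (intro exI[of _ "{a \<in> A. a \<subseteq> b}"]) simp
  qed
next
  assume u: "\<forall>b\<in>B. \<exists>C\<subseteq>A. b = \<Union>C"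
  have "\<exists>b\<in>B. a \<subseteq> b" if a: "a \<in> A" for a
  proof -
    obtain x where x: "x \<in> a" using assms(1) a by (metis partition_onD3 equals0I)
    then obtain b where b: "b \<in> B" "x \<in> b"
      using assms a unfolding partition_on_def by blast
    then obtain C where C: "C \<subseteq> A" "b = \<Union>C" using u by blast
    then obtain c where c: "c \<in> C" "x \<in> c" using b by blast
    have "c = a"
    proof (rule ccontr)
      assume "c \<noteq> a"
      then have "c \<inter> a = {}"
        using disjointD[OF partition_onD2[OF assms(1)]] a c(1) C(1) by blast
      then show False using c(2) x by blast
    qed
    then show ?thesis using b C c by blast
  qed
  then show "refines X A B" using assms by (simp add: refines_def)
qed

function moebius :: "nat \<Rightarrow> nat set set \<Rightarrow> nat set set \<Rightarrow> int"
  where "moebius n A B =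
    (if A = B then 1
     else if refines {1..n} A B then
       - (\<Sum>C\<in>{C. refines {1..n} A C \<and> refines {1..n} C B \<and> C \<noteq> B}. moebius n A C)
     else 0)"
  by pat_completeness auto
termination
proof (relation "measure (\<lambda>(n, A, B). card {D. refines {1..n} D B})", simp)
  fix n :: nat and A B C :: "nat set set"
  assume AB: "refines {1..n} A B"
    and C: "C \<in> {C. refines {1..n} A C \<and> refines {1..n} C B \<and> C \<noteq> B}"
  have "finite {D. refines {1..n} D B}"
    by (rule finite_subset[of _ "Pow (Pow {1..n})"])
      (auto simp: refines_def partition_on_def)
  moreover have "{D. refines {1..n} D C} \<subset> {D. refines {1..n} D B}"
  proof
    show "{D. refines {1..n} D C} \<subseteq> {D. refines {1..n} D B}"
      using C refines_trans by blast
    have "refines {1..n} B B" using AB refines_refl refines_def by metis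
    moreover have "\<not> refines {1..n} B C" using C refines_asym by blast
    ultimately show "{D. refines {1..n} D C} \<noteq> {D. refines {1..n} D B}" by blast
  qed
  ultimately show "((n, A, C), (n, A, B)) \<in> measure (\<lambda>(n, A, B). card {D. refines {1..n} D B})"
    by (simp add: psubset_card_mono)
qed

declare moebius.simps [simp del]

text \<open>\<open>bt_E n i j\<close> is only meant for \<open>1 \<le> i < j \<le> n\<close>.\<close>

function bt_E :: "nat \<Rightarrow> nat \<Rightarrow> nat \<Rightarrow> bt"
  where "bt_E n i j =
    (if j \<le> Suc i then bt_e n i
     else bt_g n i \<otimes>\<^bsub>bt_algebra n\<^esub> bt_E n (Suc i) j
       \<otimes>\<^bsub>bt_algebra n\<^esub> inv\<^bsub>bt_algebra n\<^esub> (bt_g n i))"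
  by pat_completeness auto
termination by (relation "measure (\<lambda>(n, i, j). j - i)") auto

declare bt_E.simps [simp del]

text \<open>The factors of \<open>bt_E_partition\<close> commute; they are multiplied in lexicographic order.\<close>

definition bt_E_partition :: "nat \<Rightarrow> nat set set \<Rightarrow> bt"
  where "bt_E_partition n A =
    foldr (\<lambda>(i, j) x. bt_E n i j \<otimes>\<^bsub>bt_algebra n\<^esub> x)
      [(i, j). i \<leftarrow> [1..<Suc n], j \<leftarrow> [Suc i..<Suc n], \<exists>X\<in>A. i \<in> X \<and> j \<in> X]
      \<one>\<^bsub>bt_algebra n\<^esub>"

definition bt_idem_partition :: "nat \<Rightarrow> nat set set \<Rightarrow> bt"
  where "bt_idem_partition n A =
    finsum (bt_algebra n)
      (\<lambda>B. add_pow (bt_algebra n) (moebius n A B) (bt_E_partition n B))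
      {B. refines {1..n} A B}"

definition integer_partition :: "nat \<Rightarrow> nat list \<Rightarrow> bool"
  where "integer_partition n \<alpha> \<longleftrightarrow> sorted_wrt (\<ge>) \<alpha> \<and> 0 \<notin> set \<alpha> \<and> sum_list \<alpha> = n"

definition has_type :: "nat set set \<Rightarrow> nat list \<Rightarrow> bool"
  where "has_type A \<alpha> \<longleftrightarrow> sorted_wrt (\<ge>) \<alpha> \<and> mset \<alpha> = image_mset card (mset_set A)"

definition bt_idem :: "nat \<Rightarrow> nat list \<Rightarrow> bt"
  where "bt_idem n \<alpha> =
    finsum (bt_algebra n) (bt_idem_partition n) {A. partition_on {1..n} A \<and> has_type A \<alpha>}"

definition bt_alpha :: "nat \<Rightarrow> nat list \<Rightarrow> (laurent, bt) module"
  where "bt_alpha n \<alpha> = corner_algebra (bt_algebra n) (bt_idem n \<alpha>)"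


section \<open>The partition Temperley--Lieb algebra\<close>

definition steinberg :: "nat \<Rightarrow> nat \<Rightarrow> bt"
  where "steinberg n i =
    (let B = bt_algebra n; g = bt_g n i; h = bt_g n (Suc i) in
      ((- q_pow (-3)) \<odot>\<^bsub>B\<^esub> (g \<otimes>\<^bsub>B\<^esub> h \<otimes>\<^bsub>B\<^esub> g))
      \<oplus>\<^bsub>B\<^esub> (q_pow (-2) \<odot>\<^bsub>B\<^esub> (g \<otimes>\<^bsub>B\<^esub> h))
      \<oplus>\<^bsub>B\<^esub> (q_pow (-2) \<odot>\<^bsub>B\<^esub> (h \<otimes>\<^bsub>B\<^esub> g))
      \<oplus>\<^bsub>B\<^esub> ((- q_pow (-1)) \<odot>\<^bsub>B\<^esub> g)
      \<oplus>\<^bsub>B\<^esub> ((- q_pow (-1)) \<odot>\<^bsub>B\<^esub> h)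
      \<oplus>\<^bsub>B\<^esub> \<one>\<^bsub>B\<^esub>)"

definition ptl_gen :: "nat \<Rightarrow> nat list \<Rightarrow> nat \<Rightarrow> bt"
  where "ptl_gen n \<alpha> i = bt_idem n \<alpha> \<otimes>\<^bsub>bt_algebra n\<^esub>
    (bt_e n i \<otimes>\<^bsub>bt_algebra n\<^esub> bt_e n (Suc i) \<otimes>\<^bsub>bt_algebra n\<^esub> steinberg n i)"

definition PTL :: "nat \<Rightarrow> nat list \<Rightarrow> nat \<Rightarrow> (laurent, bt set) module"
  where "PTL n \<alpha> i = quot_algebra (bt_alpha n \<alpha>) (genideal (bt_alpha n \<alpha>) {ptl_gen n \<alpha> i})"


section \<open>Tensor space\<close>

text \<open>For a free module \<open>V\<close> with basis indexed by the pairs \<open>(i, s)\<close> in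
  \<open>{1..N} \<times> {1..r}\<close>, the \<open>n\<close>-fold tensor power of \<open>V\<close> is the free module on the words of
  length \<open>n\<close> in these pairs.  Scalars of the algebra are mapped to those of the module by a
  ring homomorphism \<open>\<phi>\<close>.  List positions are counted from \<open>0\<close>, tensor factors from \<open>1\<close>.\<close>

type_synonym 'r tensors = "(nat \<times> nat) list \<Rightarrow>\<^sub>0 'r"

definition tensor_space :: "nat \<Rightarrow> nat \<Rightarrow> nat \<Rightarrow> 'r::comm_ring_1 tensors set"
  where "tensor_space n N r =
    {v. \<forall>w\<in>Poly_Mapping.keys v. length w = n \<and> set w \<subseteq> {1..N} \<times> {1..r}}"

fun act_basis :: "(laurent \<Rightarrow> 'r::comm_ring_1) \<Rightarrow> (nat \<times> nat) list \<Rightarrow> bt_gen \<Rightarrow> 'r tensors"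
  where
    "act_basis \<phi> w (E i) =
      (if snd (w ! (i - 1)) = snd (w ! i) then Poly_Mapping.single w 1 else 0)"
  | "act_basis \<phi> w (G i) =
      (let (a, s) = w ! (i - 1); (b, t) = w ! i;
           w' = w[i - 1 := (b, t), i := (a, s)]
       in if s \<noteq> t then Poly_Mapping.single w' 1
          else if a = b then Poly_Mapping.single w (\<phi> (q_pow 1))
          else if a < b then Poly_Mapping.single w' 1
          else Poly_Mapping.single w (\<phi> (q_pow 1 - q_pow (-1))) + Poly_Mapping.single w' 1)"

definition act_gen :: "(laurent \<Rightarrow> 'r::comm_ring_1) \<Rightarrow> 'r tensors \<Rightarrow> bt_gen \<Rightarrow> 'r tensors"
  where "act_gen \<phi> v x =
    (\<Sum>w\<in>Poly_Mapping.keys v. scale (Poly_Mapping.lookup v w) (act_basis \<phi> w x))"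

text \<open>A right action: the first letter of a word acts first.\<close>

definition act_word :: "(laurent \<Rightarrow> 'r::comm_ring_1) \<Rightarrow> 'r tensors \<Rightarrow> bt_gen list \<Rightarrow> 'r tensors"
  where "act_word \<phi> v xs = foldl (act_gen \<phi>) v xs"

definition act_free :: "(laurent \<Rightarrow> 'r::comm_ring_1) \<Rightarrow> 'r tensors \<Rightarrow> bt_free \<Rightarrow> 'r tensors"
  where "act_free \<phi> v f =
    (\<Sum>xs\<in>Poly_Mapping.keys f. scale (\<phi> (Poly_Mapping.lookup f xs)) (act_word \<phi> v xs))"

text \<open>Elements of the bt-algebra are cosets; on tensor space all representatives of a coset
  act in the same way.  The same remark applies to \<open>act_base_change\<close> below.\<close>

definition act_bt :: "(laurent \<Rightarrow> 'r::comm_ring_1) \<Rightarrow> 'r tensors \<Rightarrow> bt \<Rightarrow> 'r tensors"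
  where "act_bt \<phi> v a = the_elem (act_free \<phi> v ` a)"

definition alpha_space ::
    "(laurent \<Rightarrow> 'r::comm_ring_1) \<Rightarrow> nat \<Rightarrow> nat \<Rightarrow> nat list \<Rightarrow> 'r tensors set"
  where "alpha_space \<phi> n N \<alpha> =
    {act_bt \<phi> v (bt_idem n \<alpha>) | v. v \<in> tensor_space n N (length \<alpha>)}"

definition etl_ideal :: "nat \<Rightarrow> nat \<Rightarrow> nat list \<Rightarrow> bt set"
  where "etl_ideal n N \<alpha> =
    {a \<in> carrier (bt_alpha n \<alpha>). \<forall>v\<in>alpha_space (\<lambda>c. c) n N \<alpha>. act_bt (\<lambda>c. c) v a = 0}"

definition ETL :: "nat \<Rightarrow> nat \<Rightarrow> nat list \<Rightarrow> (laurent, bt set) module"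
  where "ETL n N \<alpha> = quot_algebra (bt_alpha n \<alpha>) (etl_ideal n N \<alpha>)"


section \<open>The same algebras over a field\<close>

text \<open>Here \<open>x\<close> is a nonzero element of the field, and the field is an algebra over the Laurent
  polynomials by means of \<open>laurent_eval x\<close>.\<close>

type_synonym 'k bt_over = "((bt \<times> 'k) \<Rightarrow>\<^sub>0 int) set"

definition bt_alpha_over :: "'k::field \<Rightarrow> nat \<Rightarrow> nat list \<Rightarrow> ('k, 'k bt_over) module"
  where "bt_alpha_over x n \<alpha> = base_change (bt_alpha n \<alpha>) (laurent_eval x)"

definition PTL_over :: "'k::field \<Rightarrow> nat \<Rightarrow> nat list \<Rightarrow> nat \<Rightarrow> ('k, 'k bt_over set) module"
  where "PTL_over x n \<alpha> i = quot_algebra (bt_alpha_over x n \<alpha>)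
    (genideal (bt_alpha_over x n \<alpha>)
      {pure_tensor (bt_alpha n \<alpha>) (laurent_eval x) (ptl_gen n \<alpha> i) 1})"

definition act_pre_tensor ::
    "(laurent \<Rightarrow> 'k::comm_ring_1) \<Rightarrow> 'k tensors \<Rightarrow> ((bt \<times> 'k) \<Rightarrow>\<^sub>0 int) \<Rightarrow> 'k tensors"
  where "act_pre_tensor \<phi> v f =
    (\<Sum>(a, y)\<in>Poly_Mapping.keys f.
      scale (of_int (Poly_Mapping.lookup f (a, y)) * y) (act_bt \<phi> v a))"

definition act_base_change ::
    "(laurent \<Rightarrow> 'k::comm_ring_1) \<Rightarrow> 'k tensors \<Rightarrow> 'k bt_over \<Rightarrow> 'k tensors"
  where "act_base_change \<phi> v t = the_elem (act_pre_tensor \<phi> v ` t)"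

definition etl_ideal_over :: "'k::field \<Rightarrow> nat \<Rightarrow> nat \<Rightarrow> nat list \<Rightarrow> 'k bt_over set"
  where "etl_ideal_over x n N \<alpha> =
    {t \<in> carrier (bt_alpha_over x n \<alpha>).
      \<forall>v\<in>alpha_space (laurent_eval x) n N \<alpha>. act_base_change (laurent_eval x) v t = 0}"

definition ETL_over :: "'k::field \<Rightarrow> nat \<Rightarrow> nat \<Rightarrow> nat list \<Rightarrow> ('k, 'k bt_over set) module"
  where "ETL_over x n N \<alpha> = quot_algebra (bt_alpha_over x n \<alpha>) (etl_ideal_over x n N \<alpha>)"

end

theory Submission
  imports Defs "HOL-Combinatorics.Permutations"
begin

text \<open>Write \<open>F B\<close> for the idempotent of a set partition \<open>B\<close> and \<open>T w\<close> for the product of the \<open>g i\<close>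
  along a reduced expression of a permutation \<open>w\<close>.  Expanding the product of all
  \<open>E i j + (1 - E i j)\<close> shows that the \<open>F B\<close> are orthogonal with sum \<open>1\<close>, and that they agree with
  the idempotents defined by Moebius inversion.  Hence the algebra is spanned by the \<open>F B T w\<close>.

  On \<open>F B\<close>, the generator \<open>g i\<close> acts like a Hecke generator if \<open>i\<close> and \<open>i + 1\<close> lie in the same block
  and like a transposition otherwise.  Therefore, modulo the ideal generated by the Steinberg
  element (the ideal does not depend on \<open>i\<close>, as \<open>g i g (i+1) g (i+2)\<close> conjugates one Steinberg
  element into the next), every \<open>F B T w\<close> such that \<open>w\<close> has a decreasing subsequence of length three
  inside a block of \<open>B\<close> can be straightened; the other \<open>F B T w\<close> still span.

  These remaining elements act linearly independently on tensor space for \<open>N = 2\<close>, over every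
  commutative ring: the action is unitriangular with respect to the number of inversions inside
  the blocks, tested on the word that has the smaller letter exactly at the positions where an
  inversion inside a block starts.  So the ideal is the whole annihilator, both over the Laurent
  polynomials and after base change.\<close>

section \<open>Linear extension to finitely supported functions\<close>

text \<open>An annihilating element is an element of the ideal plus a combination of the remaining
  \<open>F B T w\<close>, and independence on tensor space makes the combination vanish. The
  obstacle is the field case: kernels do not commute with tensor products, so the annihilator after
  base change is not determined by the one over the Laurent polynomials. Spanning does survive
  tensoring, and independence is proved for coefficients in any commutative ring; the argument is
  therefore run again after base change.

  Two letters suffice for the following reason. If no three positions of a block carry decreasing
  values, then the positions of the block that start an inversion carry increasing values, and so do
  the others; a word in two letters records this splitting. Conversely, the Steinberg element is the
  q-antisymmetrizer of three strands, which vanishes where each colour has only two letters. Its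
  leading coefficient -q^{-3} is a unit, so straightening works over the Laurent
  polynomials.\<close>

definition lin_ext :: "('a \<Rightarrow> 'c::zero \<Rightarrow> 'd::comm_monoid_add) \<Rightarrow> ('a \<Rightarrow>\<^sub>0 'c) \<Rightarrow> 'd"
  where "lin_ext H f = (\<Sum>k\<in>Poly_Mapping.keys f. H k (Poly_Mapping.lookup f k))"

lemma lin_ext_superset:
  assumes "finite X" "Poly_Mapping.keys f \<subseteq> X" "\<And>k. H k 0 = 0"
  shows "lin_ext H f = (\<Sum>k\<in>X. H k (Poly_Mapping.lookup f k))"
  unfolding lin_ext_def
  by (rule sum.mono_neutral_left) (use assms in \<open>auto simp: in_keys_iff\<close>)

lemma lin_ext_zero [simp]: "lin_ext H 0 = 0"
  by (simp add: lin_ext_def)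

lemma lin_ext_single:
  assumes "\<And>k. H k 0 = 0"
  shows "lin_ext H (Poly_Mapping.single k c) = H k c"
  by (subst lin_ext_superset[of "{k}"]) (use assms in auto)

lemma lin_ext_add:
  fixes f g :: "'a \<Rightarrow>\<^sub>0 'c::comm_monoid_add"
  assumes "\<And>k. H k 0 = 0" "\<And>k a b. H k (a + b) = H k a + H k b"
  shows "lin_ext H (f + g) = lin_ext H f + lin_ext H g"
proof -
  let ?X = "Poly_Mapping.keys f \<union> Poly_Mapping.keys g"
  have "Poly_Mapping.keys (f + g) \<subseteq> ?X" by (rule keys_add)
  then show ?thesis
    by (simp add: lin_ext_superset[of ?X] assms lookup_add sum.distrib)
qed

lemma lin_ext_plus:
  "lin_ext (\<lambda>k c. H k c + K k c) f = lin_ext H f + lin_ext K f"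
  by (simp add: lin_ext_def sum.distrib)

text \<open>Carriers of monoid algebras are support conditions, so the bound \<open>K\<close>
  travels through the induction. Multilinear identities are thereby reduced to monomials, one
  argument at a time.\<close>

lemma poly_mapping_single_induct [consumes 1, case_names zero single add]:
  assumes "Poly_Mapping.keys f \<subseteq> K"
    and "P 0"
    and "\<And>k c. k \<in> K \<Longrightarrow> P (Poly_Mapping.single k c)"
    and "\<And>f g. P f \<Longrightarrow> P g \<Longrightarrow> Poly_Mapping.keys f \<subseteq> K \<Longrightarrow> Poly_Mapping.keys g \<subseteq> K
      \<Longrightarrow> P (f + g)"
  shows "P (f :: 'a \<Rightarrow>\<^sub>0 'c::comm_monoid_add)"
proof -
  define g where "g X = (\<Sum>k\<in>X. Poly_Mapping.single k (Poly_Mapping.lookup f k))" for X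
  have "P (g X) \<and> Poly_Mapping.keys (g X) \<subseteq> K" if "finite X" "X \<subseteq> K" for X
    using that
  proof (induction X rule: finite_induct)
    case empty
    then show ?case by (simp add: g_def assms(2))
  next
    case (insert k X)
    have "g (insert k X) = Poly_Mapping.single k (Poly_Mapping.lookup f k) + g X"
      using insert by (simp add: g_def)
    moreover have "Poly_Mapping.keys (Poly_Mapping.single k (Poly_Mapping.lookup f k)) \<subseteq> K"
      using insert by simp
    moreover have "Poly_Mapping.keys (Poly_Mapping.single k (Poly_Mapping.lookup f k) + g X) \<subseteq> K"
      using insert calculation(2) keys_add by fast
    ultimately show ?case using insert assms(3,4) by auto
  qed
  moreover have "g (Poly_Mapping.keys f) = f"
  proof (rule poly_mapping_eqI)
    fix k
    show "Poly_Mapping.lookup (g (Poly_Mapping.keys f)) k = Poly_Mapping.lookup f k"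
      by (cases "k \<in> Poly_Mapping.keys f")
        (auto simp: g_def lookup_sum lookup_single when_def in_keys_iff)
  qed
  ultimately show ?thesis using assms(1) by (metis finite_keys)
qed

lemma lookup_scale [simp]: "Poly_Mapping.lookup (scale c f) k = c * Poly_Mapping.lookup f k"
  by (simp add: Poly_Mapping.map.rep_eq when_def)

lemma scale_simps [simp]:
  "scale c (f + g) = scale c f + scale c g" "scale (c + d) f = scale c f + scale d f"
  "scale c (scale d f) = scale (c * d) f" "scale 1 f = f" "scale 0 f = 0" "scale c 0 = 0"
  "scale c (Poly_Mapping.single k d) = Poly_Mapping.single k (c * d)"
  by (auto intro!: poly_mapping_eqI simp: lookup_add algebra_simps lookup_single when_def)

lemma scale_sum: "scale c (sum f I) = (\<Sum>i\<in>I. scale c (f i))"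
  by (induction I rule: infinite_finite_induct) simp_all

lemma keys_scale: "Poly_Mapping.keys (scale c f) \<subseteq> Poly_Mapping.keys f"
  by (auto simp: in_keys_iff)

text \<open>\<open>T\<close> stands for what scaling by \<open>c\<close> does to the values. Keeping
  it general covers semilinear extensions, where \<open>c\<close> acts through a ring
  homomorphism.\<close>

lemma lin_ext_scale:
  assumes "\<And>k. H k 0 = 0" "\<And>k d. H k (c * d) = T (H k d)" "T 0 = 0"
    "\<And>u v. T (u + v) = T u + T v"
  shows "lin_ext H (scale c f) = T (lin_ext H f)"
proof -
  have "T (sum h I) = (\<Sum>i\<in>I. T (h i))" for h and I :: "'a set"
    by (induction I rule: infinite_finite_induct) (simp_all add: assms)
  then show ?thesis
    by (subst lin_ext_superset[OF finite_keys keys_scale]) (simp_all add: assms lin_ext_def)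
qed

lemma sum_keys_subset:
  assumes "\<And>i. i \<in> I \<Longrightarrow> Poly_Mapping.keys (f i) \<subseteq> K"
  shows "Poly_Mapping.keys (sum f I) \<subseteq> K"
  using assms by (auto simp: in_keys_iff lookup_sum subset_iff) (metis (no_types, lifting) sum.neutral)

section \<open>Algebras with central scalars\<close>

locale salg = ring A for A :: "('r::comm_ring_1, 'a) module" (structure) +
  assumes smult_closed [simp, intro]: "x \<in> carrier A \<Longrightarrow> c \<odot> x \<in> carrier A"
    and smult_l_distr: "x \<in> carrier A \<Longrightarrow> (c + d) \<odot> x = c \<odot> x \<oplus> d \<odot> x"
    and smult_r_distr: "x \<in> carrier A \<Longrightarrow> y \<in> carrier A \<Longrightarrow> c \<odot> (x \<oplus> y) = c \<odot> x \<oplus> c \<odot> y"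
    and smult_smult: "x \<in> carrier A \<Longrightarrow> c \<odot> (d \<odot> x) = (c * d) \<odot> x"
    and smult_one [simp]: "x \<in> carrier A \<Longrightarrow> 1 \<odot> x = x"
    and smult_mult_l: "x \<in> carrier A \<Longrightarrow> y \<in> carrier A \<Longrightarrow> (c \<odot> x) \<otimes> y = c \<odot> (x \<otimes> y)"
    and smult_mult_r: "x \<in> carrier A \<Longrightarrow> y \<in> carrier A \<Longrightarrow> x \<otimes> (c \<odot> y) = c \<odot> (x \<otimes> y)"
begin

lemma smult_zero_l [simp]: "x \<in> carrier A \<Longrightarrow> 0 \<odot> x = \<zero>"
  using smult_l_distr[of x 0 0] by (metis add.l_cancel_one add_0 smult_closed)

lemma smult_zero_r [simp]: "c \<odot> \<zero> = \<zero>"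
  by (metis smult_smult smult_zero_l zero_closed mult_zero_right)

lemma smult_uminus: "x \<in> carrier A \<Longrightarrow> (- c) \<odot> x = \<ominus> (c \<odot> x)"
  by (metis add.right_inverse minus_equality smult_closed smult_l_distr smult_zero_l add.commute)

lemma smult_minus: "x \<in> carrier A \<Longrightarrow> c \<odot> (\<ominus> x) = \<ominus> (c \<odot> x)"
  by (metis a_inv_closed l_neg minus_equality smult_closed smult_r_distr smult_zero_r)

lemma smult_as_mult: "x \<in> carrier A \<Longrightarrow> c \<odot> x = (c \<odot> \<one>) \<otimes> x"
  by (simp add: smult_mult_l)

text \<open>A scalar multiple is a product with the same multiple of the unit, so two-sided ideals
  absorb scalars.\<close>

lemma ideal_smult: "ideal I A \<Longrightarrow> x \<in> I \<Longrightarrow> c \<odot> x \<in> I"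
  by (metis (no_types, opaque_lifting) additive_subgroup.a_Hcarr ideal.I_l_closed ideal.axioms(1) one_closed smult_as_mult smult_closed)

lemma ideal_add: "ideal I A \<Longrightarrow> x \<in> I \<Longrightarrow> y \<in> I \<Longrightarrow> x \<oplus> y \<in> I"
  by (metis additive_subgroup.a_closed ideal.axioms(1))

lemma ideal_zero: "ideal I A \<Longrightarrow> \<zero> \<in> I"
  by (metis additive_subgroup.zero_closed ideal.axioms(1))

lemma ideal_carrier: "ideal I A \<Longrightarrow> x \<in> I \<Longrightarrow> x \<in> carrier A"
  by (metis additive_subgroup.a_Hcarr ideal.axioms(1))

text \<open>An inductive span turns stability under multiplication into an induction on its
  construction. Coefficients are recovered only at the end, by \<open>lspan_finite\<close>.\<close>

inductive_set lspan :: "'a set \<Rightarrow> 'a set" for X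
  where
    lspan_zero: "\<zero> \<in> lspan X"
  | lspan_base: "x \<in> X \<Longrightarrow> x \<in> lspan X"
  | lspan_add: "x \<in> lspan X \<Longrightarrow> y \<in> lspan X \<Longrightarrow> x \<oplus> y \<in> lspan X"
  | lspan_smult: "x \<in> lspan X \<Longrightarrow> c \<odot> x \<in> lspan X"

lemma lspan_carrier: "X \<subseteq> carrier A \<Longrightarrow> lspan X \<subseteq> carrier A"
proof
  fix x assume "X \<subseteq> carrier A" "x \<in> lspan X"
  from this(2,1) show "x \<in> carrier A" by induction auto
qed

lemma lspan_mono: "x \<in> lspan X \<Longrightarrow> X \<subseteq> lspan Y \<Longrightarrow> x \<in> lspan Y"
  by (induction rule: lspan.induct) (auto intro: lspan.intros)

lemma lspan_mult_l:
  assumes "x \<in> lspan X" "X \<subseteq> carrier A" "a \<in> carrier A" "\<And>y. y \<in> X \<Longrightarrow> a \<otimes> y \<in> lspan Y"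
  shows "a \<otimes> x \<in> lspan Y"
  using assms(1)
proof induction
  case (lspan_add x y)
  then have "x \<in> carrier A" "y \<in> carrier A" using lspan_carrier assms by auto
  then show ?case using lspan_add assms by (simp add: r_distr lspan.intros)
next
  case (lspan_smult x c)
  then have "x \<in> carrier A" using lspan_carrier assms by auto
  then show ?case using lspan_smult assms by (simp add: smult_mult_r lspan.intros)
qed (use assms in \<open>auto intro: lspan.intros\<close>)

text \<open>The elements of the displayed form are closed under the rules that generate the span,
  because \<open>I\<close> absorbs sums and scalars. This brings a spanning statement into the shape
  to which independence applies.\<close>

lemma lspan_finite:
  assumes J: "finite J" "b ` J \<subseteq> carrier A" and x: "x \<in> lspan (I \<union> b ` J)" and I: "ideal I A"
  shows "\<exists>c. \<exists>y\<in>I. x = y \<oplus> (\<Oplus>j\<in>J. c j \<odot> b j)"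
proof -
  define s where "s c K = (\<Oplus>j\<in>K. c j \<odot> b j)" for c K
  have bc: "\<And>j. j \<in> J \<Longrightarrow> b j \<in> carrier A" using J by auto
  have s_closed: "s c K \<in> carrier A" if "K \<subseteq> J" for c K
    unfolding s_def using that bc by (intro finsum_closed) auto
  have s_zero: "s (\<lambda>_. 0) J = \<zero>"
    unfolding s_def using bc by (intro add.finprod_one_eqI) simp
  have s_single: "s (\<lambda>k. if k = j then 1 else 0) J = b j" if j: "j \<in> J" for j
  proof -
    have "s (\<lambda>k. if k = j then 1 else 0) J = (\<Oplus>k\<in>J. if j = k then b k else \<zero>)"
      unfolding s_def using bc by (intro add.finprod_cong') auto
    also have "\<dots> = b j" using J(1) j bc by (intro add.finprod_singleton) auto
    finally show ?thesis .
  qed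
  have s_add: "s (\<lambda>j. c j + d j) J = s c J \<oplus> s d J" for c d
  proof -
    have "s (\<lambda>j. c j + d j) J = (\<Oplus>j\<in>J. c j \<odot> b j \<oplus> d j \<odot> b j)"
      unfolding s_def using bc by (intro add.finprod_cong') (auto simp: smult_l_distr)
    also have "\<dots> = s c J \<oplus> s d J"
      unfolding s_def using bc by (intro finsum_addf) auto
    finally show ?thesis .
  qed
  have s_smult: "d \<odot> s c K = s (\<lambda>j. d * c j) K" if "finite K" "K \<subseteq> J" for c d K
    using that
  proof (induction K rule: finite_induct)
    case (insert k K)
    have k: "b k \<in> carrier A" using insert bc by auto
    have ins: "s c (insert k K) = c k \<odot> b k \<oplus> s c K" for c
      unfolding s_def using insert bc by (intro finsum_insert) auto
    show ?case using insert k s_closed[of K c] by (simp add: ins smult_r_distr smult_smult)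
  qed (simp add: s_def)
  have "\<exists>c. \<exists>y\<in>I. x = y \<oplus> s c J" using x
  proof induction
    case lspan_zero
    then show ?case using s_zero ideal_zero[OF I] by (intro exI[of _ "\<lambda>_. 0"] bexI[of _ "\<zero>"]) auto
  next
    case (lspan_base x)
    then consider "x \<in> I" | j where "j \<in> J" "x = b j" by blast
    then show ?case
    proof cases
      case 1
      then show ?thesis using s_zero ideal_carrier[OF I]
        by (intro exI[of _ "\<lambda>_. 0"] bexI[of _ x]) auto
    next
      case 2
      then show ?thesis using s_single[of j] bc[of j] ideal_zero[OF I]
        by (intro exI[of _ "\<lambda>k. if k = j then 1 else 0"] bexI[of _ "\<zero>"]) auto
    qed
  next
    case (lspan_add x y)
    then obtain c y1 d y2 where y: "y1 \<in> I" "x = y1 \<oplus> s c J" "y2 \<in> I" "y = y2 \<oplus> s d J" by blast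
    have cl: "y1 \<in> carrier A" "y2 \<in> carrier A" using y ideal_carrier[OF I] by auto
    have "x \<oplus> y = (y1 \<oplus> y2) \<oplus> s (\<lambda>j. c j + d j) J"
      using y cl s_closed[of J] by (simp add: a_ac s_add)
    then show ?case using ideal_add[OF I y(1,3)] by blast
  next
    case (lspan_smult x d)
    then obtain c y where y: "y \<in> I" "x = y \<oplus> s c J" by blast
    have cl: "y \<in> carrier A" using y ideal_carrier[OF I] by auto
    have "d \<odot> x = d \<odot> y \<oplus> s (\<lambda>j. d * c j) J"
      using y cl s_closed[of J] J(1) by (simp add: smult_r_distr s_smult)
    then show ?case using ideal_smult[OF I y(1)] by blast
  qed
  then show ?thesis by (simp add: s_def)
qed

end

section \<open>Monoid algebras\<close>

lemma monoid_algebra_simps: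
  "carrier (monoid_algebra M) = {f. Poly_Mapping.keys f \<subseteq> carrier M}"
  "\<one>\<^bsub>monoid_algebra M\<^esub> = Poly_Mapping.single \<one>\<^bsub>M\<^esub> 1"
  "\<zero>\<^bsub>monoid_algebra M\<^esub> = 0" "f \<oplus>\<^bsub>monoid_algebra M\<^esub> g = f + g"
  "c \<odot>\<^bsub>monoid_algebra M\<^esub> f = scale c f"
  by (simp_all add: monoid_algebra_def)

lemma monoid_algebra_mult:
  "f \<otimes>\<^bsub>monoid_algebra M\<^esub> g =
    lin_ext (\<lambda>x c. lin_ext (\<lambda>y d. Poly_Mapping.single (x \<otimes>\<^bsub>M\<^esub> y) (c * d)) g) f"
  by (simp add: monoid_algebra_def lin_ext_def)

lemma monoid_algebra_mult_single:
  "Poly_Mapping.single x c \<otimes>\<^bsub>monoid_algebra M\<^esub> Poly_Mapping.single y d =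
    Poly_Mapping.single (x \<otimes>\<^bsub>M\<^esub> y) (c * d)"
  by (simp add: monoid_algebra_mult lin_ext_single)

lemma monoid_algebra_distr:
  "(f + g) \<otimes>\<^bsub>monoid_algebra M\<^esub> h = f \<otimes>\<^bsub>monoid_algebra M\<^esub> h + g \<otimes>\<^bsub>monoid_algebra M\<^esub> h"
  "h \<otimes>\<^bsub>monoid_algebra M\<^esub> (f + g) = h \<otimes>\<^bsub>monoid_algebra M\<^esub> f + h \<otimes>\<^bsub>monoid_algebra M\<^esub> g"
  "0 \<otimes>\<^bsub>monoid_algebra M\<^esub> h = 0" "h \<otimes>\<^bsub>monoid_algebra M\<^esub> 0 = 0"
proof -
  have "lin_ext (\<lambda>y d. Poly_Mapping.single (x \<otimes>\<^bsub>M\<^esub> y) ((a + b) * d)) h =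
    lin_ext (\<lambda>y d. Poly_Mapping.single (x \<otimes>\<^bsub>M\<^esub> y) (a * d)) h +
    lin_ext (\<lambda>y d. Poly_Mapping.single (x \<otimes>\<^bsub>M\<^esub> y) (b * d)) h" for x a b
    by (simp add: lin_ext_plus[symmetric] distrib_right single_add)
  then show "(f + g) \<otimes>\<^bsub>monoid_algebra M\<^esub> h = f \<otimes>\<^bsub>monoid_algebra M\<^esub> h + g \<otimes>\<^bsub>monoid_algebra M\<^esub> h"
    unfolding monoid_algebra_mult by (subst lin_ext_add) (simp_all add: lin_ext_def)
  have "lin_ext (\<lambda>y d. Poly_Mapping.single (x \<otimes>\<^bsub>M\<^esub> y) (c * d)) (f + g) =
    lin_ext (\<lambda>y d. Poly_Mapping.single (x \<otimes>\<^bsub>M\<^esub> y) (c * d)) f +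
    lin_ext (\<lambda>y d. Poly_Mapping.single (x \<otimes>\<^bsub>M\<^esub> y) (c * d)) g" for x c
    by (subst lin_ext_add) (simp_all add: distrib_left single_add)
  then show "h \<otimes>\<^bsub>monoid_algebra M\<^esub> (f + g) = h \<otimes>\<^bsub>monoid_algebra M\<^esub> f + h \<otimes>\<^bsub>monoid_algebra M\<^esub> g"
    unfolding monoid_algebra_mult by (simp add: lin_ext_plus[symmetric])
  show "0 \<otimes>\<^bsub>monoid_algebra M\<^esub> h = 0" "h \<otimes>\<^bsub>monoid_algebra M\<^esub> 0 = 0"
    by (simp_all add: monoid_algebra_mult) (simp add: lin_ext_def)
qed

lemma monoid_algebra_assoc:
  assumes "monoid M" "Poly_Mapping.keys f \<subseteq> carrier M" "Poly_Mapping.keys g \<subseteq> carrier M"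
    "Poly_Mapping.keys h \<subseteq> carrier M"
  shows "(f \<otimes>\<^bsub>monoid_algebra M\<^esub> g) \<otimes>\<^bsub>monoid_algebra M\<^esub> h =
    f \<otimes>\<^bsub>monoid_algebra M\<^esub> (g \<otimes>\<^bsub>monoid_algebra M\<^esub> h)"
  using assms(2)
proof (induction f rule: poly_mapping_single_induct)
  case x: (single x c)
  show ?case using assms(3)
  proof (induction g rule: poly_mapping_single_induct)
    case y: (single y d)
    show ?case using assms(4)
    proof (induction h rule: poly_mapping_single_induct)
      case (single z e)
      then show ?case using x y assms(1)
        by (simp add: monoid_algebra_mult_single monoid.m_assoc mult.assoc)
    qed (simp_all add: monoid_algebra_distr)
  qed (simp_all add: monoid_algebra_distr)
qed (simp_all add: monoid_algebra_distr)

lemma monoid_algebra_scale: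
  "scale c f \<otimes>\<^bsub>monoid_algebra M\<^esub> g = scale c (f \<otimes>\<^bsub>monoid_algebra M\<^esub> g)"
  "f \<otimes>\<^bsub>monoid_algebra M\<^esub> scale c g = scale c (f \<otimes>\<^bsub>monoid_algebra M\<^esub> g)"
proof -
  have "Poly_Mapping.keys f \<subseteq> UNIV" by simp
  then show "scale c f \<otimes>\<^bsub>monoid_algebra M\<^esub> g = scale c (f \<otimes>\<^bsub>monoid_algebra M\<^esub> g)"
  proof (induction f rule: poly_mapping_single_induct)
    case (single x d)
    have "Poly_Mapping.keys g \<subseteq> UNIV" by simp
    then show ?case
      by (induction g rule: poly_mapping_single_induct)
        (simp_all add: monoid_algebra_mult_single monoid_algebra_distr mult.assoc)
  qed (simp_all add: monoid_algebra_distr)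
  have "Poly_Mapping.keys f \<subseteq> UNIV" by simp
  then show "f \<otimes>\<^bsub>monoid_algebra M\<^esub> scale c g = scale c (f \<otimes>\<^bsub>monoid_algebra M\<^esub> g)"
  proof (induction f rule: poly_mapping_single_induct)
    case (single x d)
    have "Poly_Mapping.keys g \<subseteq> UNIV" by simp
    then show ?case
      by (induction g rule: poly_mapping_single_induct)
        (simp_all add: monoid_algebra_mult_single monoid_algebra_distr mult.left_commute)
  qed (simp_all add: monoid_algebra_distr)
qed

lemma monoid_algebra_closed:
  assumes "monoid M" "Poly_Mapping.keys f \<subseteq> carrier M" "Poly_Mapping.keys g \<subseteq> carrier M"
  shows "Poly_Mapping.keys (f \<otimes>\<^bsub>monoid_algebra M\<^esub> g) \<subseteq> carrier M"
  unfolding monoid_algebra_mult lin_ext_def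
  using assms by (intro sum_keys_subset) (auto split: if_splits intro!: monoid.m_closed)

lemma monoid_algebra_one:
  assumes "monoid M" "Poly_Mapping.keys f \<subseteq> carrier M"
  shows "Poly_Mapping.single \<one>\<^bsub>M\<^esub> 1 \<otimes>\<^bsub>monoid_algebra M\<^esub> f = f"
    "f \<otimes>\<^bsub>monoid_algebra M\<^esub> Poly_Mapping.single \<one>\<^bsub>M\<^esub> 1 = f"
proof -
  show "Poly_Mapping.single \<one>\<^bsub>M\<^esub> 1 \<otimes>\<^bsub>monoid_algebra M\<^esub> f = f" using assms(2)
    by (induction f rule: poly_mapping_single_induct)
      (simp_all add: monoid_algebra_mult_single monoid_algebra_distr assms monoid.l_one)
  show "f \<otimes>\<^bsub>monoid_algebra M\<^esub> Poly_Mapping.single \<one>\<^bsub>M\<^esub> 1 = f" using assms(2)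
    by (induction f rule: poly_mapping_single_induct)
      (simp_all add: monoid_algebra_mult_single monoid_algebra_distr assms monoid.r_one)
qed

lemma salg_monoid_algebra:
  assumes M: "monoid M"
  shows "salg (monoid_algebra M :: ('r::comm_ring_1, 'a \<Rightarrow>\<^sub>0 'r) module)"
proof -
  let ?A = "monoid_algebra M :: ('r, 'a \<Rightarrow>\<^sub>0 'r) module"
  have "abelian_group ?A"
  proof (rule abelian_groupI)
    fix x assume "x \<in> carrier ?A"
    then show "\<exists>y\<in>carrier ?A. y \<oplus>\<^bsub>?A\<^esub> x = \<zero>\<^bsub>?A\<^esub>"
      by (intro bexI[of _ "- x"]) (auto simp: monoid_algebra_simps in_keys_iff subset_iff)
  qed (use keys_add in \<open>fastforce simp: monoid_algebra_simps add_ac\<close>)+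
  moreover have "monoid ?A"
    by (rule monoidI)
      (use M in \<open>auto simp: monoid_algebra_simps monoid_algebra_assoc monoid_algebra_one monoid.one_closed
        intro: monoid_algebra_closed[THEN subsetD]\<close>)
  ultimately have "ring ?A"
    by (rule ringI) (auto simp: monoid_algebra_simps monoid_algebra_distr)
  then show ?thesis
    by (rule salg.intro, unfold_locales)
      (auto simp: monoid_algebra_simps monoid_algebra_scale dest: keys_scale[THEN subsetD])
qed

lemma monoid_words: "monoid \<lparr>carrier = lists X, mult = (@), one = []\<rparr>"
  by (rule monoidI) auto

lemma salg_free_algebra: "salg (free_algebra X :: ('r::comm_ring_1, _) module)"
  unfolding free_algebra_def by (rule salg_monoid_algebra[OF monoid_words])

lemma free_algebra_simps:
  "carrier (free_algebra X) = {f. Poly_Mapping.keys f \<subseteq> lists X}"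
  "\<one>\<^bsub>free_algebra X\<^esub> = Poly_Mapping.single [] 1"
  "\<zero>\<^bsub>free_algebra X\<^esub> = 0" "f \<oplus>\<^bsub>free_algebra X\<^esub> g = f + g"
  "c \<odot>\<^bsub>free_algebra X\<^esub> f = scale c f"
  by (simp_all add: free_algebra_def monoid_algebra_simps)

lemma free_algebra_mult_single:
  "Poly_Mapping.single x c \<otimes>\<^bsub>free_algebra X\<^esub> Poly_Mapping.single y d =
    Poly_Mapping.single (x @ y) (c * d)"
  by (simp add: free_algebra_def monoid_algebra_mult_single)

lemma free_algebra_distr:
  "(f + g) \<otimes>\<^bsub>free_algebra X\<^esub> h = f \<otimes>\<^bsub>free_algebra X\<^esub> h + g \<otimes>\<^bsub>free_algebra X\<^esub> h"
  "h \<otimes>\<^bsub>free_algebra X\<^esub> (f + g) = h \<otimes>\<^bsub>free_algebra X\<^esub> f + h \<otimes>\<^bsub>free_algebra X\<^esub> g"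
  "0 \<otimes>\<^bsub>free_algebra X\<^esub> h = 0" "h \<otimes>\<^bsub>free_algebra X\<^esub> 0 = 0"
  by (simp_all add: free_algebra_def monoid_algebra_distr)

section \<open>Quotients and corners\<close>

lemma quot_algebra_simps:
  "carrier (quot_algebra A I) = carrier (A Quot I)"
  "mult (quot_algebra A I) = mult (A Quot I)"
  "one (quot_algebra A I) = one (A Quot I)"
  "zero (quot_algebra A I) = zero (A Quot I)"
  "add (quot_algebra A I) = add (A Quot I)"
  "smult (quot_algebra A I) c X = (\<Union>x\<in>X. I +>\<^bsub>A\<^esub> (c \<odot>\<^bsub>A\<^esub> x))"
  by (simp_all add: quot_algebra_def ring.defs module.defs)

lemma quot_algebra_ring:
  assumes "ideal I A"
  shows "ring (quot_algebra A I)"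
proof -
  interpret ideal I A by fact
  interpret Q: ring "A Quot I" by (rule quotient_is_ring)
  show ?thesis
  proof (rule ringI)
    show "abelian_group (quot_algebra A I)"
    proof (rule abelian_groupI)
      fix x assume "x \<in> carrier (quot_algebra A I)"
      then show "\<exists>y\<in>carrier (quot_algebra A I). y \<oplus>\<^bsub>quot_algebra A I\<^esub> x = \<zero>\<^bsub>quot_algebra A I\<^esub>"
        using Q.l_neg Q.a_inv_closed by (auto simp: quot_algebra_simps)
    qed (simp_all add: quot_algebra_simps Q.a_ac)
    show "monoid (quot_algebra A I)"
      by (rule monoidI) (auto simp: quot_algebra_simps Q.m_assoc)
  qed (auto simp: quot_algebra_simps Q.l_distr Q.r_distr)
qed

lemma quot_algebra_coset:
  assumes "ideal I A"
  shows "X \<in> carrier (quot_algebra A I) \<longleftrightarrow> (\<exists>x\<in>carrier A. X = I +>\<^bsub>A\<^esub> x)"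
    "x \<in> carrier A \<Longrightarrow> y \<in> carrier A \<Longrightarrow>
      (I +>\<^bsub>A\<^esub> x) \<otimes>\<^bsub>quot_algebra A I\<^esub> (I +>\<^bsub>A\<^esub> y) = I +>\<^bsub>A\<^esub> (x \<otimes>\<^bsub>A\<^esub> y)"
    "x \<in> carrier A \<Longrightarrow> y \<in> carrier A \<Longrightarrow>
      (I +>\<^bsub>A\<^esub> x) \<oplus>\<^bsub>quot_algebra A I\<^esub> (I +>\<^bsub>A\<^esub> y) = I +>\<^bsub>A\<^esub> (x \<oplus>\<^bsub>A\<^esub> y)"
    "\<one>\<^bsub>quot_algebra A I\<^esub> = I +>\<^bsub>A\<^esub> \<one>\<^bsub>A\<^esub>"
    "\<zero>\<^bsub>quot_algebra A I\<^esub> = I +>\<^bsub>A\<^esub> \<zero>\<^bsub>A\<^esub>"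
proof -
  interpret ideal I A by fact
  have h: "((+>\<^bsub>A\<^esub>) I) \<in> ring_hom A (A Quot I)" by (rule rcos_ring_hom)
  show "X \<in> carrier (quot_algebra A I) \<longleftrightarrow> (\<exists>x\<in>carrier A. X = I +>\<^bsub>A\<^esub> x)"
    by (auto simp: quot_algebra_simps FactRing_simps)
  show "x \<in> carrier A \<Longrightarrow> y \<in> carrier A \<Longrightarrow>
      (I +>\<^bsub>A\<^esub> x) \<otimes>\<^bsub>quot_algebra A I\<^esub> (I +>\<^bsub>A\<^esub> y) = I +>\<^bsub>A\<^esub> (x \<otimes>\<^bsub>A\<^esub> y)"
    using ring_hom_mult[OF h] by (simp add: quot_algebra_simps)
  show "x \<in> carrier A \<Longrightarrow> y \<in> carrier A \<Longrightarrow>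
      (I +>\<^bsub>A\<^esub> x) \<oplus>\<^bsub>quot_algebra A I\<^esub> (I +>\<^bsub>A\<^esub> y) = I +>\<^bsub>A\<^esub> (x \<oplus>\<^bsub>A\<^esub> y)"
    using ring_hom_add[OF h] by (simp add: quot_algebra_simps)
  show "\<one>\<^bsub>quot_algebra A I\<^esub> = I +>\<^bsub>A\<^esub> \<one>\<^bsub>A\<^esub>"
    using ring_hom_one[OF h] by (simp add: quot_algebra_simps)
  show "\<zero>\<^bsub>quot_algebra A I\<^esub> = I +>\<^bsub>A\<^esub> \<zero>\<^bsub>A\<^esub>"
    using additive_subgroup.a_subset[OF additive_subgroup_axioms]
    by (simp add: quot_algebra_simps FactRing_def a_coset_add_zero)
qed

lemma ideal_coset_eq:
  assumes "ideal I A" "x \<in> carrier A" "y \<in> carrier A"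
  shows "I +>\<^bsub>A\<^esub> x = I +>\<^bsub>A\<^esub> y \<longleftrightarrow> x \<ominus>\<^bsub>A\<^esub> y \<in> I"
proof -
  interpret ideal I A by fact
  show ?thesis using assms quotient_eq_iff_same_a_r_cos[OF assms] by simp
qed

lemma ideal_coset_mem_iff:
  assumes "ideal I A" "x \<in> carrier A"
  shows "y \<in> I +>\<^bsub>A\<^esub> x \<longleftrightarrow> y \<in> carrier A \<and> y \<ominus>\<^bsub>A\<^esub> x \<in> I"
proof -
  interpret ideal I A by fact
  show ?thesis
    using assms a_elemrcos_carrier a_rcos_module_minus[OF ring_axioms] by metis
qed

lemma salg_quot_algebra:
  fixes A (structure)
  assumes A: "salg A" and I: "ideal I A"
  shows "salg (quot_algebra A I)"
    and "x \<in> carrier A \<Longrightarrow> c \<odot>\<^bsub>quot_algebra A I\<^esub> (I +>\<^bsub>A\<^esub> x) = I +>\<^bsub>A\<^esub> (c \<odot>\<^bsub>A\<^esub> x)"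
proof -
  interpret salg A by fact
  interpret ideal I A by fact
  have sm: "c \<odot>\<^bsub>quot_algebra A I\<^esub> (I +>\<^bsub>A\<^esub> x) = I +>\<^bsub>A\<^esub> (c \<odot>\<^bsub>A\<^esub> x)" if x: "x \<in> carrier A" for c x
  proof -
    \<comment> \<open>Every representative of the coset yields the same scaled coset, so the union
      in the definition of the quotient collapses to a single coset.\<close>
    have "I +> c \<odot> y = I +> c \<odot> x" if y: "y \<in> I +> x" for y
    proof -
      have yc: "y \<in> carrier A" and "y \<ominus> x \<in> I" using y x ideal_coset_mem_iff[OF I] by auto
      then have "c \<odot> (y \<ominus> x) \<in> I" using ideal_smult[OF I] by blast
      then show ?thesis using ideal_coset_eq[OF I, of "c \<odot> y" "c \<odot> x"] x yc
        by (simp add: a_minus_def smult_r_distr smult_minus)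
    qed
    moreover have "I +> x \<noteq> {}" using a_rcos_self[OF x] by blast
    ultimately show ?thesis unfolding quot_algebra_simps by (intro SUP_eq_const)
  qed
  then show "x \<in> carrier A \<Longrightarrow> c \<odot>\<^bsub>quot_algebra A I\<^esub> (I +>\<^bsub>A\<^esub> x) = I +>\<^bsub>A\<^esub> (c \<odot>\<^bsub>A\<^esub> x)" .
  interpret Q: ring "quot_algebra A I" by (rule quot_algebra_ring[OF I])
  have cl: "I +> x \<in> carrier (quot_algebra A I)" if "x \<in> carrier A" for x
    using that quot_algebra_coset(1)[OF I] by blast
  have ex: "\<exists>x\<in>carrier A. X = I +> x" if "X \<in> carrier (quot_algebra A I)" for X
    using that quot_algebra_coset(1)[OF I] by blast
  note simps = sm cl quot_algebra_coset(2,3)[OF I] smult_l_distr smult_r_distr smult_smult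
    smult_mult_l smult_mult_r
  show "salg (quot_algebra A I)"
    by (unfold_locales; (drule ex)+; elim bexE; simp add: simps)
qed

text \<open>Closure of \<open>V\<close> under the right action gives absorption from the left, and
  \<open>f 0 a = 0\<close> gives absorption from the right. The axioms stay abstract because four
  actions are treated this way: of the free algebra, of the corner, of the formal tensors and of the
  base change.\<close>

lemma ideal_annihilator:
  fixes f :: "'v::ab_group_add \<Rightarrow> 'a \<Rightarrow> 'v"
  assumes "ring R"
    and add: "\<And>v a b. v \<in> V \<Longrightarrow> a \<in> carrier R \<Longrightarrow> b \<in> carrier R \<Longrightarrow> f v (a \<oplus>\<^bsub>R\<^esub> b) = f v a + f v b"
    and mult: "\<And>v a b. v \<in> V \<Longrightarrow> a \<in> carrier R \<Longrightarrow> b \<in> carrier R \<Longrightarrow> f v (a \<otimes>\<^bsub>R\<^esub> b) = f (f v a) b"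
    and closed: "\<And>v a. v \<in> V \<Longrightarrow> a \<in> carrier R \<Longrightarrow> f v a \<in> V"
    and zero: "\<And>a. a \<in> carrier R \<Longrightarrow> f 0 a = 0"
  shows "ideal {a \<in> carrier R. \<forall>v\<in>V. f v a = 0} R"
proof -
  interpret R: ring R by fact
  have z: "f v \<zero>\<^bsub>R\<^esub> = 0" if "v \<in> V" for v
    using add[OF that R.zero_closed R.zero_closed] by simp
  show ?thesis
  proof (rule idealI)
    show "subgroup {a \<in> carrier R. \<forall>v\<in>V. f v a = 0} (add_monoid R)"
    proof (rule group.subgroupI)
      show "group (add_monoid R)" by (rule R.a_group)
      have "\<zero>\<^bsub>R\<^esub> \<in> {a \<in> carrier R. \<forall>v\<in>V. f v a = 0}" using z by simp
      then show "{a \<in> carrier R. \<forall>v\<in>V. f v a = 0} \<noteq> {}" by blast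
      fix a assume a: "a \<in> {a \<in> carrier R. \<forall>v\<in>V. f v a = 0}"
      have "f v (\<ominus>\<^bsub>R\<^esub> a) = 0" if "v \<in> V" for v
        using add[OF that, of a "\<ominus>\<^bsub>R\<^esub> a"] a that z[OF that] by (simp add: R.r_neg)
      then show "inv\<^bsub>add_monoid R\<^esub> a \<in> {a \<in> carrier R. \<forall>v\<in>V. f v a = 0}"
        using a by (simp add: a_inv_def[symmetric])
    qed (auto simp: add)
  qed (use assms in auto)
qed

lemma corner_algebra_simps:
  "carrier (corner_algebra A e) = {e \<otimes>\<^bsub>A\<^esub> a | a. a \<in> carrier A}"
  "mult (corner_algebra A e) = mult A" "one (corner_algebra A e) = e"
  "zero (corner_algebra A e) = zero A" "add (corner_algebra A e) = add A"
  "smult (corner_algebra A e) = smult A"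
  by (simp_all add: corner_algebra_def)

locale central_idempotent = salg +
  fixes z :: 'a
  assumes z_closed [simp]: "z \<in> carrier A" and z_idem: "z \<otimes> z = z"
    and z_central: "x \<in> carrier A \<Longrightarrow> x \<otimes> z = z \<otimes> x"
begin

abbreviation "C \<equiv> corner_algebra A z"

lemma corner_iff: "x \<in> carrier C \<longleftrightarrow> x \<in> carrier A \<and> z \<otimes> x = x"
  by (auto simp: corner_algebra_simps m_assoc[symmetric] z_idem) metis

lemma salg_corner: "salg C"
proof -
  have "abelian_group C"
  proof (rule abelian_groupI)
    fix x assume "x \<in> carrier C"
    then show "\<exists>y\<in>carrier C. y \<oplus>\<^bsub>C\<^esub> x = \<zero>\<^bsub>C\<^esub>"
      by (intro bexI[of _ "\<ominus> x"])
        (simp_all add: corner_iff, simp_all add: corner_algebra_simps l_neg r_minus)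
  qed (simp_all add: corner_iff, simp_all add: corner_algebra_simps r_distr a_ac)
  moreover have "monoid C"
  proof (rule monoidI)
    fix x y assume "x \<in> carrier C" "y \<in> carrier C"
    then show "x \<otimes>\<^bsub>C\<^esub> y \<in> carrier C"
      by (simp add: corner_iff) (simp add: corner_algebra_simps m_assoc[symmetric])
  next
    fix x assume "x \<in> carrier C"
    then show "x \<otimes>\<^bsub>C\<^esub> \<one>\<^bsub>C\<^esub> = x"
      by (simp add: corner_iff) (simp add: corner_algebra_simps z_central)
  qed (simp_all add: corner_iff, simp_all add: corner_algebra_simps z_idem m_assoc)
  ultimately have "ring C"
    by (rule ringI) (simp_all add: corner_iff, simp_all add: corner_algebra_simps l_distr r_distr)
  then show ?thesis
    by (rule salg.intro, unfold_locales)
      (simp_all add: corner_iff, simp_all add: corner_algebra_simps smult_l_distr smult_r_distr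
        smult_smult smult_mult_l smult_mult_r)
qed

text \<open>For \<open>a\<close> in the corner, x a = x (z a) = (z x) a, so multiplying by x amounts
  to multiplying by an element of the corner. Straightening takes place in \<open>A\<close> whereas
  the ideals of the theorem live in the corner; this is the bridge.\<close>

lemma ideal_corner:
  assumes J: "ideal J C"
  shows "ideal J A" "J \<subseteq> carrier C"
proof -
  interpret C: salg C by (rule salg_corner)
  interpret J: ideal J C by fact
  show sub: "J \<subseteq> carrier C" by (rule J.a_subset)
  have cz: "\<And>x. x \<in> carrier A \<Longrightarrow> z \<otimes> x \<in> carrier C" by (auto simp: corner_algebra_simps)
  show "ideal J A"
  proof (rule idealI)
    show "ring A" ..
    have minus: "\<ominus> x \<in> J" if "x \<in> J" for x
    proof -
      have x: "x \<in> carrier A" "x \<in> carrier C" using that sub corner_iff by auto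
      have "\<ominus>\<^bsub>C\<^esub> x \<in> J" using that J.a_inv_closed by blast
      moreover have "\<ominus>\<^bsub>C\<^esub> x = \<ominus> x"
        by (metis C.a_inv_closed C.l_neg corner_iff corner_algebra_simps(4,5) minus_equality x)
      ultimately show ?thesis by simp
    qed
    show "subgroup J (add_monoid A)"
    proof (rule group.subgroupI)
      show "group (add_monoid A)" by (rule a_group)
      show "J \<noteq> {}" using J.zero_closed by blast
    qed (use sub corner_iff minus J.a_closed in
        \<open>auto simp: a_inv_def[symmetric] corner_algebra_simps(5)\<close>)
    fix a x assume a: "a \<in> J" and x: "x \<in> carrier A"
    have ac: "a \<in> carrier A" "z \<otimes> a = a" using a sub corner_iff by auto
    have "x \<otimes> a = (z \<otimes> x) \<otimes>\<^bsub>C\<^esub> a"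
      using ac x by (metis corner_algebra_simps(2) m_assoc z_central z_closed)
    then show "x \<otimes> a \<in> J" using J.I_l_closed[OF a cz[OF x]] by simp
    have "a \<otimes> x = a \<otimes>\<^bsub>C\<^esub> (z \<otimes> x)"
      using ac x by (metis corner_algebra_simps(2) m_assoc z_central z_closed)
    then show "a \<otimes> x \<in> J" using J.I_r_closed[OF a cz[OF x]] by simp
  qed
qed

end

section \<open>Adjacent transpositions and inversions\<close>

abbreviation sw :: "nat \<Rightarrow> nat \<Rightarrow> nat"
  where "sw i \<equiv> transpose i (Suc i)"

text \<open>The predicate is left open because several statistics are counted this way: inversions
  of a permutation, those inside blocks, and those between letters of equal colour.
  \<open>ninv_swap\<close> then serves all of them.\<close>

definition ninv :: "nat \<Rightarrow> (nat \<Rightarrow> nat \<Rightarrow> bool) \<Rightarrow> nat"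
  where "ninv n P = card {(a, b). 1 \<le> a \<and> a < b \<and> b \<le> n \<and> P a b}"

lemma ninv_cong:
  assumes "\<And>a b. 1 \<le> a \<Longrightarrow> a < b \<Longrightarrow> b \<le> n \<Longrightarrow> P a b = Q a b"
  shows "ninv n P = ninv n Q"
  unfolding ninv_def using assms by (intro arg_cong[of _ _ card]) auto

text \<open>The transposition permutes the pairs other than \<open>(i, Suc i)\<close>, so only that
  pair changes its contribution. Corrections stand on both sides to avoid subtraction of natural
  numbers.\<close>

lemma ninv_swap:
  assumes i: "1 \<le> i" "i < n"
  shows "ninv n (\<lambda>a b. P (sw i a) (sw i b)) + of_bool (P i (Suc i)) =
    ninv n P + of_bool (P (Suc i) i)"
proof -
  define D where "D = {(a, b). 1 \<le> a \<and> a < b \<and> b \<le> n} - {(i, Suc i)}"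
  have D: "p \<in> D \<longleftrightarrow> 1 \<le> fst p \<and> fst p < snd p \<and> snd p \<le> n \<and> \<not> (fst p = i \<and> snd p = Suc i)" for p
    by (cases p) (simp add: D_def)
  have fin: "finite D"
    by (rule finite_subset[of _ "{1..n} \<times> {1..n}"]) (auto simp: D_def)
  define h where "h = (\<lambda>(a, b). (sw i a, sw i b))"
  have hD: "h p \<in> D" if "p \<in> D" for p
  proof -
    obtain a b where p: "p = (a, b)" by (cases p)
    consider "a = i" | "a = Suc i" | "b = i" | "b = Suc i" "a \<noteq> i" |
      "a \<noteq> i" "a \<noteq> Suc i" "b \<noteq> i" "b \<noteq> Suc i" by metis
    then show ?thesis
      using that i unfolding D h_def p by cases (simp_all add: transpose_def)
  qed
  have hh: "h (h p) = p" for p by (cases p) (simp add: h_def)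
  have split: "ninv n Q = card {p \<in> D. Q (fst p) (snd p)} + of_bool (Q i (Suc i))" for Q
  proof -
    let ?S = "{p \<in> D. Q (fst p) (snd p)}"
    show ?thesis
    proof (cases "Q i (Suc i)")
      case True
      then have 1: "{(a, b). 1 \<le> a \<and> a < b \<and> b \<le> n \<and> Q a b} = insert (i, Suc i) ?S"
        using i unfolding D_def by auto
      have 2: "card (insert (i, Suc i) ?S) = Suc (card ?S)"
        by (intro card_insert_disjoint finite_subset[OF _ fin]) (auto simp: D)
      show ?thesis unfolding ninv_def 1 2 using True by (simp only: of_bool_eq Suc_eq_plus1)
    next
      case False
      then have 1: "{(a, b). 1 \<le> a \<and> a < b \<and> b \<le> n \<and> Q a b} = ?S"
        unfolding D_def by auto
      show ?thesis unfolding ninv_def 1 using False by (simp only: of_bool_eq add_0_right)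
    qed
  qed
  have "bij_betw h {p \<in> D. P (sw i (fst p)) (sw i (snd p))} {p \<in> D. P (fst p) (snd p)}"
  proof (rule bij_betw_byWitness[of _ h])
    have hf: "fst (h p) = sw i (fst p)" "snd (h p) = sw i (snd p)" for p
      by (simp_all add: h_def case_prod_unfold)
    show "h ` {p \<in> D. P (sw i (fst p)) (sw i (snd p))} \<subseteq> {p \<in> D. P (fst p) (snd p)}"
      by (auto simp only: hf hD mem_Collect_eq)
    show "h ` {p \<in> D. P (fst p) (snd p)} \<subseteq> {p \<in> D. P (sw i (fst p)) (sw i (snd p))}"
      by (auto simp only: hf hD mem_Collect_eq transpose_involutory)
  qed (intro ballI hh)+
  then have "card {p \<in> D. P (sw i (fst p)) (sw i (snd p))} = card {p \<in> D. P (fst p) (snd p)}"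
    by (rule bij_betw_same_card)
  then show ?thesis by (simp add: split)
qed

lemma sw_permutes: "1 \<le> i \<Longrightarrow> i < n \<Longrightarrow> sw i permutes {1..n}"
  by (rule permutes_swap_id) auto

lemma comp_sw_permutes:
  "w permutes {1..n} \<Longrightarrow> 1 \<le> i \<Longrightarrow> i < n \<Longrightarrow> w \<circ> sw i permutes {1..n}"
  by (intro permutes_compose sw_permutes)

lemma comp_sw_sw [simp]: "w \<circ> sw i \<circ> sw i = w"
  by (auto simp: fun_eq_iff)

lemma sw_braid: "w \<circ> sw i \<circ> sw (Suc i) \<circ> sw i = w \<circ> sw (Suc i) \<circ> sw i \<circ> sw (Suc i)"
proof
  fix x
  consider "x = i" | "x = Suc i" | "x = Suc (Suc i)" | "x \<noteq> i" "x \<noteq> Suc i" "x \<noteq> Suc (Suc i)" by metis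
  then show "(w \<circ> sw i \<circ> sw (Suc i) \<circ> sw i) x = (w \<circ> sw (Suc i) \<circ> sw i \<circ> sw (Suc i)) x"
    by cases (simp_all add: transpose_def)
qed

lemma sw_commute: "distant i j \<Longrightarrow> w \<circ> sw i \<circ> sw j = w \<circ> sw j \<circ> sw i"
proof
  fix x assume "distant i j"
  then show "(w \<circ> sw i \<circ> sw j) x = (w \<circ> sw j \<circ> sw i) x"
    by (cases "x = i"; cases "x = Suc i"; cases "x = j"; cases "x = Suc j") (auto simp: transpose_def)
qed

lemma permutes_neq: "w permutes S \<Longrightarrow> a \<noteq> b \<Longrightarrow> w a \<noteq> w b"
  by (metis permutes_inj injD)

lemma permutes_ascending_id:
  assumes w: "w permutes {1..n}" and asc: "\<And>i. 1 \<le> i \<Longrightarrow> i < n \<Longrightarrow> w i < w (Suc i)"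
  shows "w = id"
proof -
  have "a \<le> w a" if "1 \<le> a" "a \<le> n" for a
    using that
  proof (induction a rule: nat_induct_at_least)
    case base
    then show ?case using permutes_in_image[OF w, of 1] by auto
  next
    case (Suc a)
    then show ?case using asc[of a] by simp
  qed
  then show ?thesis
    using w by (intro permutes_natset_ge[of _ "{1..n}"]) auto
qed

abbreviation inversions :: "nat \<Rightarrow> (nat \<Rightarrow> nat) \<Rightarrow> nat"
  where "inversions n w \<equiv> ninv n (\<lambda>a b. w b < w a)"

lemma inversions_comp_sw:
  assumes "1 \<le> i" "i < n" "w i < w (Suc i)"
  shows "inversions n (w \<circ> sw i) = Suc (inversions n w)"
  using ninv_swap[OF assms(1,2), of "\<lambda>a b. w b < w a"] assms(3) by (simp add: comp_def)

text \<open>A permutation other than the identity has a descent, and undoing it lowers the number of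
  inversions. Each step of the induction therefore prolongs a reduced expression.\<close>

lemma permutes_adjacent_induct [consumes 1, case_names id swap]:
  assumes "w permutes {1..n}" "P id"
    and "\<And>w i. w permutes {1..n} \<Longrightarrow> 1 \<le> i \<Longrightarrow> i < n \<Longrightarrow> w i < w (Suc i) \<Longrightarrow> P w \<Longrightarrow> P (w \<circ> sw i)"
  shows "P w"
  using assms(1)
proof (induction "inversions n w" arbitrary: w rule: less_induct)
  case less
  show ?case
  proof (cases "\<exists>i\<ge>1. i < n \<and> \<not> w i < w (Suc i)")
    case True
    then obtain i where i: "1 \<le> i" "i < n" "\<not> w i < w (Suc i)" by auto
    then have "w (Suc i) < w i" using permutes_neq[OF less.prems, of i "Suc i"] by linarith
    then have asc: "(w \<circ> sw i) i < (w \<circ> sw i) (Suc i)" by simp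
    then have "inversions n w = Suc (inversions n (w \<circ> sw i))"
      using inversions_comp_sw[OF i(1,2) asc] by simp
    then have "P (w \<circ> sw i)" using less(1)[OF _ comp_sw_permutes[OF less.prems i(1,2)]] by simp
    then have "P (w \<circ> sw i \<circ> sw i)"
      using assms(3) asc i comp_sw_permutes[OF less.prems i(1,2)] by blast
    then show ?thesis by simp
  next
    case False
    then show ?thesis using permutes_ascending_id[OF less.prems] assms(2) by auto
  qed
qed

text \<open>Serves to carry statements about the positions 1, 2, 3, ... over to arbitrary distinct
  positions.\<close>

lemma permutes_extend_list:
  assumes "distinct xs" "set xs \<subseteq> {1..n}"
  shows "\<exists>w. w permutes {1..n} \<and> (\<forall>k<length xs. w (Suc k) = xs ! k)"
  using assms
proof (induction xs rule: rev_induct)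
  case Nil
  then show ?case using permutes_id by fastforce
next
  case (snoc x xs)
  then obtain w where w: "w permutes {1..n}" "\<forall>k<length xs. w (Suc k) = xs ! k" by auto
  have "card (set (xs @ [x])) \<le> card {1..n}" using snoc.prems by (intro card_mono) auto
  then have len: "Suc (length xs) \<le> n" using snoc.prems distinct_card by fastforce
  \<comment> \<open>A transposition of values corrects the value at the new position. The earlier
    values stay, since they differ from both values exchanged.\<close>
  define v where "v = transpose (w (Suc (length xs))) x \<circ> w"
  have wn: "w (Suc (length xs)) \<in> {1..n}" using len permutes_in_image[OF w(1)] by auto
  have "v permutes {1..n}"
    unfolding v_def using w(1) wn snoc.prems by (intro permutes_compose permutes_swap_id) auto
  moreover have "v (Suc k) = (xs @ [x]) ! k" if "k < length (xs @ [x])" for k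
  proof (cases "k = length xs")
    case True
    then show ?thesis by (simp add: v_def)
  next
    case False
    then have k: "k < length xs" using that by simp
    then have "w (Suc k) \<noteq> x" using w snoc.prems by (metis distinct_append disjoint_iff list.set_intros(1) nth_mem)
    moreover have "w (Suc k) \<noteq> w (Suc (length xs))" using permutes_neq[OF w(1)] False by auto
    ultimately show ?thesis using k w by (simp add: v_def nth_append)
  qed
  ultimately show ?case by blast
qed

section \<open>Set partitions\<close>

definition same :: "nat set set \<Rightarrow> nat \<Rightarrow> nat \<Rightarrow> bool"
  where "same A i j \<longleftrightarrow> (\<exists>X\<in>A. i \<in> X \<and> j \<in> X)"

definition swp :: "nat \<Rightarrow> nat set set \<Rightarrow> nat set set"
  where "swp i A = (`) (sw i) ` A"

abbreviation set_partitions :: "nat \<Rightarrow> nat set set set"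
  where "set_partitions n \<equiv> {A. partition_on {1..n} A}"

lemma finite_set_partitions: "finite (set_partitions n)"
  by (rule finitely_many_partition_on) simp

lemma same_sym: "same A i j \<longleftrightarrow> same A j i"
  by (auto simp: same_def)

lemma same_trans:
  assumes "partition_on S A" "same A i j" "same A j k"
  shows "same A i k"
proof -
  obtain X Y where X: "X \<in> A" "i \<in> X" "j \<in> X" and Y: "Y \<in> A" "j \<in> Y" "k \<in> Y"
    using assms(2,3) by (auto simp: same_def)
  have "X = Y" using disjointD[OF partition_onD2[OF assms(1)] X(1) Y(1)] X(3) Y(2) by auto
  then show ?thesis using X Y by (auto simp: same_def)
qed

lemma same_refl: "partition_on S A \<Longrightarrow> i \<in> S \<Longrightarrow> same A i i"
  by (auto simp: same_def partition_on_def)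

lemma same_in: "partition_on S A \<Longrightarrow> same A i j \<Longrightarrow> i \<in> S \<and> j \<in> S"
  by (auto simp: same_def partition_on_def)

lemma partition_block_eq:
  assumes "partition_on S A" "X \<in> A" "i \<in> X"
  shows "X = {j. same A i j}"
proof -
  have "j \<in> X" if ij: "same A i j" for j
  proof -
    obtain Y where Y: "Y \<in> A" "i \<in> Y" "j \<in> Y" using ij by (auto simp: same_def)
    then have "X = Y" using disjointD[OF partition_onD2[OF assms(1)] assms(2) Y(1)] assms by blast
    then show ?thesis using Y by simp
  qed
  then show ?thesis using assms by (auto simp: same_def)
qed

lemma partition_eq_blocks:
  assumes "partition_on S A"
  shows "A = (\<lambda>i. {j. same A i j}) ` S"
proof (rule Set.set_eqI, rule iffI)
  fix X assume X: "X \<in> A"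
  then obtain i where i: "i \<in> X" using assms by (metis partition_onD3 ex_in_conv)
  then have "i \<in> S" using X assms by (auto simp: partition_on_def)
  then show "X \<in> (\<lambda>i. {j. same A i j}) ` S" using partition_block_eq[OF assms X i] by blast
next
  fix X assume "X \<in> (\<lambda>i. {j. same A i j}) ` S"
  then obtain i where i: "i \<in> S" "X = {j. same A i j}" by blast
  then obtain Y where Y: "Y \<in> A" "i \<in> Y" using assms by (auto simp: partition_on_def)
  then show "X \<in> A" using partition_block_eq[OF assms Y] i by simp
qed

lemma refines_iff_same:
  assumes "partition_on S A" "partition_on S B"
  shows "refines S A B \<longleftrightarrow> (\<forall>i j. same A i j \<longrightarrow> same B i j)"
proof
  assume "refines S A B"
  then show "\<forall>i j. same A i j \<longrightarrow> same B i j"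
    unfolding refines_def same_def by (meson subsetD)
next
  assume h: "\<forall>i j. same A i j \<longrightarrow> same B i j"
  have "\<exists>Y\<in>B. X \<subseteq> Y" if X: "X \<in> A" for X
  proof -
    obtain i where i: "i \<in> X" using assms X by (metis partition_onD3 ex_in_conv)
    then obtain Y where Y: "Y \<in> B" "i \<in> Y" using assms X by (auto simp: partition_on_def)
    have "X \<subseteq> Y"
      using partition_block_eq[OF assms(1) X i] partition_block_eq[OF assms(2) Y] h by auto
    then show ?thesis using Y by blast
  qed
  then show "refines S A B" using assms by (simp add: refines_def)
qed

text \<open>Products over pairs run over \<open>i < j\<close> only; reflexivity and symmetry supply
  the other pairs.\<close>

lemma same_le_iff:
  "(\<forall>i j. same A i j \<longrightarrow> same B i j) \<longleftrightarrow>
    (\<forall>i j. 1 \<le> i \<longrightarrow> i < j \<longrightarrow> j \<le> n \<longrightarrow> same A i j \<longrightarrow> same B i j)"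
  if "partition_on {1..n} A" "partition_on {1..n} B"
proof -
  have "same B i j"
    if h: "\<forall>i j. 1 \<le> i \<longrightarrow> i < j \<longrightarrow> j \<le> n \<longrightarrow> same A i j \<longrightarrow> same B i j" and s: "same A i j" for i j
  proof -
    have ij: "i \<in> {1..n}" "j \<in> {1..n}" using same_in[OF \<open>partition_on {1..n} A\<close> s] by auto
    consider "i = j" | "i < j" | "j < i" by linarith
    then show ?thesis
      using h s ij same_sym same_refl[OF \<open>partition_on {1..n} B\<close>] by cases auto
  qed
  then show ?thesis by blast
qed

lemma partition_eqI:
  assumes "partition_on {1..n} A" "partition_on {1..n} B"
    "\<And>i j. 1 \<le> i \<Longrightarrow> i < j \<Longrightarrow> j \<le> n \<Longrightarrow> same A i j = same B i j"
  shows "A = B"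
proof -
  have "same A i j = same B i j" for i j
    using same_le_iff[OF assms(1,2)] same_le_iff[OF assms(2,1)] assms(3) by blast
  then have "(\<lambda>i. {j. same A i j}) ` {1..n} = (\<lambda>i. {j. same B i j}) ` {1..n}" by simp
  then show ?thesis
    using partition_eq_blocks[OF assms(1), symmetric] partition_eq_blocks[OF assms(2), symmetric] by simp
qed

lemma ex_partition:
  assumes "\<And>i j. T i j \<Longrightarrow> i \<in> S \<and> j \<in> S" "\<And>i. i \<in> S \<Longrightarrow> T i i" "\<And>i j. T i j \<Longrightarrow> T j i"
    "\<And>i j k. T i j \<Longrightarrow> T j k \<Longrightarrow> T i k"
  shows "\<exists>A. partition_on S A \<and> (\<forall>i j. same A i j \<longleftrightarrow> T i j)"
proof -
  define R where "R = {(i, j). T i j}"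
  have eq: "equiv S R"
    unfolding R_def using assms by (intro equivI refl_onI symI transI) blast+
  have "partition_on S (S // R)" by (rule partition_on_quotient[OF eq])
  moreover have "same (S // R) i j \<longleftrightarrow> T i j" for i j
  proof
    assume "same (S // R) i j"
    then obtain a where "T a i" "T a j" by (auto simp: same_def quotient_def R_def)
    then show "T i j" using assms(3,4) by blast
  next
    assume ij: "T i j"
    then have "R `` {i} \<in> S // R" "i \<in> R `` {i}" "j \<in> R `` {i}"
      using assms(1,2) by (auto simp: quotient_def R_def)
    then show "same (S // R) i j" unfolding same_def by blast
  qed
  ultimately show ?thesis by blast
qed

lemma swp_swp [simp]: "swp i (swp i A) = A"
  by (simp add: swp_def image_comp)

lemma same_swp: "same (swp i A) a b \<longleftrightarrow> same A (sw i a) (sw i b)"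
  by (simp add: same_def swp_def in_transpose_image_iff)

lemma partition_swp:
  assumes "partition_on {1..n} A" "1 \<le> i" "i < n"
  shows "partition_on {1..n} (swp i A)"
proof -
  have "{} \<notin> swp i A" using partition_onD3[OF assms(1)] by (auto simp: swp_def)
  then have "partition_on (sw i ` {1..n}) (swp i A)"
    using partition_on_inj_image[OF assms(1), of "sw i"] by (simp add: swp_def)
  then show ?thesis using permutes_image[OF sw_permutes[OF assms(2,3)]] by simp
qed

lemma swp_same:
  assumes "partition_on {1..n} A" "1 \<le> i" "i < n" "same A i (Suc i)"
  shows "swp i A = A"
proof (rule partition_eqI[OF partition_swp[OF assms(1-3)] assms(1)])
  fix a b
  show "same (swp i A) a b = same A a b"
  proof -
    have "same A (sw i c) d = same A c d" for c d
      using assms(4) same_sym[of A i "Suc i"] same_trans[OF assms(1), of "Suc i" i d]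
        same_trans[OF assms(1), of i "Suc i" d] by (auto simp: transpose_def)
    from this[of a "sw i b"] this[of b a] show ?thesis
      unfolding same_swp by (simp add: same_sym[of A a])
  qed
qed

text \<open>Renaming the elements keeps the block sizes. This is why the sum of the idempotents of
  one type will commute with the generators.\<close>

lemma has_type_swp: "has_type (swp i A) \<alpha> \<longleftrightarrow> has_type A \<alpha>"
proof -
  have "inj ((`) (sw i))" by (rule injI) (simp add: inj_image_eq_iff)
  then have "image_mset card (mset_set (swp i A)) = image_mset (card \<circ> (`) (sw i)) (mset_set A)"
    unfolding swp_def by (subst image_mset_mset_set[symmetric]) (simp_all add: inj_on_subset[OF _ subset_UNIV] multiset.map_comp)
  also have "\<dots> = image_mset card (mset_set A)"
    by (rule image_mset_cong) (simp add: card_image)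
  finally show ?thesis by (simp add: has_type_def)
qed

text \<open>Plays the role of the length function.\<close>

definition blinv :: "nat \<Rightarrow> nat set set \<Rightarrow> (nat \<Rightarrow> nat) \<Rightarrow> nat"
  where "blinv n A w = ninv n (\<lambda>a b. same A a b \<and> w b < w a)"

text \<open>The two positions are exchanged in the partition and in the permutation alike, which
  only renames pairs, and the pair \<open>(i, Suc i)\<close> is counted on neither side.\<close>

lemma blinv_swp:
  assumes "1 \<le> i" "i < n" "\<not> same A i (Suc i)"
  shows "blinv n (swp i A) (w \<circ> sw i) = blinv n A w"
proof -
  have "\<not> same A (Suc i) i" using assms(3) same_sym[of A i "Suc i"] by blast
  then show ?thesis
    using ninv_swap[OF assms(1,2), of "\<lambda>a b. same A a b \<and> w b < w a"] assms(3)
    by (simp add: blinv_def same_swp comp_def)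
qed

lemma blinv_comp_sw:
  assumes "partition_on {1..n} A" "1 \<le> i" "i < n" "same A i (Suc i)" "w i < w (Suc i)"
  shows "blinv n A (w \<circ> sw i) = Suc (blinv n A w)"
proof -
  have "same A (sw i a) (sw i b) = same A a b" for a b
    using swp_same[OF assms(1-4)] same_swp by metis
  then show ?thesis
    using ninv_swap[OF assms(2,3), of "\<lambda>a b. same A a b \<and> w b < w a"] assms(4,5) same_sym[of A i "Suc i"]
    by (simp add: blinv_def comp_def)
qed

lemma blinv_comp_sw_le:
  assumes "partition_on {1..n} A" "1 \<le> i" "i < n" "same A i (Suc i)" "w permutes {1..n}"
  shows "blinv n A (w \<circ> sw i) \<le> Suc (blinv n A w)"
proof (cases "w i < w (Suc i)")
  case True
  then show ?thesis using blinv_comp_sw[OF assms(1-4)] by simp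
next
  case False
  then have "(w \<circ> sw i) i < (w \<circ> sw i) (Suc i)"
    using permutes_neq[OF assms(5), of i "Suc i"] by simp
  from blinv_comp_sw[OF assms(1-4), of "w \<circ> sw i", OF this] show ?thesis by simp
qed

section \<open>Products over lists\<close>

context ring
begin

text \<open>Written as \<open>foldr\<close> to agree literally with \<open>bt_E_partition\<close>,
  whose order of factors is fixed.\<close>

definition lprod :: "('p \<Rightarrow> 'a) \<Rightarrow> 'p list \<Rightarrow> 'a"
  where "lprod f xs = foldr (\<lambda>p x. f p \<otimes> x) xs \<one>"

lemma lprod_simps [simp]: "lprod f [] = \<one>" "lprod f (p # xs) = f p \<otimes> lprod f xs"
  by (simp_all add: lprod_def)

lemma lprod_closed [simp]: "(\<And>p. p \<in> set xs \<Longrightarrow> f p \<in> carrier R) \<Longrightarrow> lprod f xs \<in> carrier R"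
  by (induction xs) auto

lemma lprod_commute:
  assumes "a \<in> carrier R" "\<And>p. p \<in> set xs \<Longrightarrow> f p \<in> carrier R"
    "\<And>p. p \<in> set xs \<Longrightarrow> a \<otimes> f p = f p \<otimes> a"
  shows "a \<otimes> lprod f xs = lprod f xs \<otimes> a"
  using assms(2,3)
proof (induction xs)
  case (Cons p xs)
  then have f: "f p \<in> carrier R" "lprod f xs \<in> carrier R" "a \<otimes> f p = f p \<otimes> a"
    "a \<otimes> lprod f xs = lprod f xs \<otimes> a" by auto
  have "a \<otimes> (f p \<otimes> lprod f xs) = f p \<otimes> (a \<otimes> lprod f xs)"
    using f(1-3) assms(1) by (simp add: m_assoc[symmetric])
  then show ?case using f assms(1) by (simp add: m_assoc)
qed (use assms(1) in simp)

text \<open>Since \<open>a\<close> commutes with every factor it can be moved next to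
  \<open>f p\<close>, which decides the product.\<close>

lemma lprod_absorb:
  assumes a: "a \<in> carrier R" and f: "\<And>q. q \<in> set xs \<Longrightarrow> f q \<in> carrier R"
    and comm: "\<And>q. q \<in> set xs \<Longrightarrow> a \<otimes> f q = f q \<otimes> a" and p: "p \<in> set xs"
  shows "a \<otimes> f p = f p \<Longrightarrow> a \<otimes> lprod f xs = lprod f xs"
    and "a \<otimes> f p = \<zero> \<Longrightarrow> a \<otimes> lprod f xs = \<zero>"
proof -
  have *: "(a \<otimes> f p = f p \<longrightarrow> a \<otimes> lprod f xs = lprod f xs) \<and> (a \<otimes> f p = \<zero> \<longrightarrow> a \<otimes> lprod f xs = \<zero>)"
    using f comm p
  proof (induction xs)
    case (Cons r xs)
    then have r: "f r \<in> carrier R" "lprod f xs \<in> carrier R" "a \<otimes> f r = f r \<otimes> a" by auto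
    show ?case
    proof (cases "p \<in> set xs")
      case True
      then have IH: "(a \<otimes> f p = f p \<longrightarrow> a \<otimes> lprod f xs = lprod f xs) \<and> (a \<otimes> f p = \<zero> \<longrightarrow> a \<otimes> lprod f xs = \<zero>)"
        using Cons by auto
      have "a \<otimes> (f r \<otimes> lprod f xs) = f r \<otimes> (a \<otimes> lprod f xs)"
        using r a by (simp add: m_assoc[symmetric])
      then show ?thesis using IH r by auto
    next
      case False
      then have "p = r" using Cons by auto
      then show ?thesis using r a by (auto simp: m_assoc[symmetric])
    qed
  qed simp
  then show "a \<otimes> f p = f p \<Longrightarrow> a \<otimes> lprod f xs = lprod f xs"
    and "a \<otimes> f p = \<zero> \<Longrightarrow> a \<otimes> lprod f xs = \<zero>" by auto
qed

lemma lprod_act_l: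
  assumes "\<And>p. p \<in> set xs \<Longrightarrow> f p \<in> carrier R" "y \<in> carrier R"
    "\<And>p. p \<in> set xs \<Longrightarrow> f p \<otimes> y = (if Q p then y else \<zero>)"
  shows "lprod f xs \<otimes> y = (if \<forall>p\<in>set xs. Q p then y else \<zero>)"
  using assms by (induction xs) (auto simp: m_assoc)

lemma lprod_act_r:
  assumes "\<And>p. p \<in> set xs \<Longrightarrow> f p \<in> carrier R" "y \<in> carrier R"
    "\<And>p. p \<in> set xs \<Longrightarrow> y \<otimes> f p = (if Q p then y else \<zero>)"
  shows "y \<otimes> lprod f xs = (if \<forall>p\<in>set xs. Q p then y else \<zero>)"
  using assms by (induction xs) (auto simp: m_assoc[symmetric])

lemma finsum_add_pow_int:
  assumes "finite S" "x \<in> carrier R"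
  shows "(\<Oplus>s\<in>S. add_pow R (m s :: int) x) = add_pow R (\<Sum>s\<in>S. m s) x"
  using assms(1)
proof (induction S rule: finite_induct)
  case empty
  then show ?case using assms(2) by (simp add: add_pow_int_ge)
next
  case (insert s S)
  then show ?case using assms(2)
    by (subst finsum_insert) (auto simp: add.int_pow_mult)
qed

lemma unit_r_cancel:
  assumes "x \<otimes> u = y \<otimes> u" "u \<in> Units R" "x \<in> carrier R" "y \<in> carrier R"
  shows "x = y"
proof -
  have u: "u \<in> carrier R" "inv u \<in> carrier R" "u \<otimes> inv u = \<one>" using assms(2) by auto
  have "(x \<otimes> u) \<otimes> inv u = (y \<otimes> u) \<otimes> inv u" using assms(1) by simp
  then show ?thesis using u assms(3,4) by (simp add: m_assoc)
qed

lemma unit_l_cancel: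
  assumes "u \<otimes> x = u \<otimes> y" "u \<in> Units R" "x \<in> carrier R" "y \<in> carrier R"
  shows "x = y"
  using assms by simp

text \<open>Conjugation by \<open>u\<close> fixes \<open>a\<close> and carries \<open>x\<close>,
  \<open>x'\<close> to \<open>y\<close>, \<open>y'\<close>, so it transports the relation. As
  \<open>Eij\<close> is defined by conjugation, this is the induction step for most of its
  commutation rules.\<close>

lemma conjugate_intertwine:
  assumes u: "u \<in> Units R" and cl: "a \<in> carrier R" "x \<in> carrier R" "x' \<in> carrier R"
    "y \<in> carrier R" "y' \<in> carrier R"
    and au: "a \<otimes> u = u \<otimes> a" and ax: "a \<otimes> x = x' \<otimes> a"
    and y: "y \<otimes> u = u \<otimes> x" and y': "y' \<otimes> u = u \<otimes> x'"
  shows "a \<otimes> y = y' \<otimes> a"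
proof -
  have uc: "u \<in> carrier R" using u by (rule Units_closed)
  have "(a \<otimes> y) \<otimes> u = a \<otimes> (y \<otimes> u)" using cl uc by (simp add: m_assoc)
  also have "\<dots> = (a \<otimes> u) \<otimes> x" unfolding y using cl uc by (simp add: m_assoc)
  also have "\<dots> = u \<otimes> (a \<otimes> x)" unfolding au using cl uc by (simp add: m_assoc)
  also have "\<dots> = (u \<otimes> x') \<otimes> a" unfolding ax using cl uc by (simp add: m_assoc)
  also have "\<dots> = y' \<otimes> (u \<otimes> a)" unfolding y'[symmetric] using cl uc by (simp add: m_assoc)
  also have "\<dots> = (y' \<otimes> a) \<otimes> u" unfolding au[symmetric] using cl uc by (simp add: m_assoc)
  finally show ?thesis using u cl by - (erule unit_r_cancel, auto)
qed

end

section \<open>The relations of the bt-algebra\<close>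

text \<open>Collects what the algebraic part uses: the presentation, the recursion for E_{ij}, and
  in \<open>bt_induct\<close> the fact that every element is built from words by multiplying by
  generators on the left. The algebraic arguments then proceed without cosets of the free
  algebra.\<close>

locale bt = salg A for A :: "(laurent, 'a) module" (structure) +
  fixes n :: nat and g e :: "nat \<Rightarrow> 'a" and Eij :: "nat \<Rightarrow> nat \<Rightarrow> 'a"
  assumes g_closed [simp]: "1 \<le> i \<Longrightarrow> i < n \<Longrightarrow> g i \<in> carrier A"
    and e_closed [simp]: "1 \<le> i \<Longrightarrow> i < n \<Longrightarrow> e i \<in> carrier A"
    and gg_distant: "1 \<le> i \<Longrightarrow> i < n \<Longrightarrow> 1 \<le> j \<Longrightarrow> j < n \<Longrightarrow> distant i j \<Longrightarrow> g i \<otimes> g j = g j \<otimes> g i"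
    and ge: "1 \<le> i \<Longrightarrow> i < n \<Longrightarrow> g i \<otimes> e i = e i \<otimes> g i"
    and braid: "1 \<le> i \<Longrightarrow> i < n \<Longrightarrow> 1 \<le> j \<Longrightarrow> j < n \<Longrightarrow> adjacent i j
      \<Longrightarrow> g i \<otimes> g j \<otimes> g i = g j \<otimes> g i \<otimes> g j"
    and egg: "1 \<le> i \<Longrightarrow> i < n \<Longrightarrow> 1 \<le> j \<Longrightarrow> j < n \<Longrightarrow> adjacent i j
      \<Longrightarrow> e i \<otimes> g j \<otimes> g i = g j \<otimes> g i \<otimes> e j"
    and eeg: "1 \<le> i \<Longrightarrow> i < n \<Longrightarrow> 1 \<le> j \<Longrightarrow> j < n \<Longrightarrow> adjacent i j
      \<Longrightarrow> e i \<otimes> e j \<otimes> g j = e i \<otimes> g j \<otimes> e i"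
    and ege: "1 \<le> i \<Longrightarrow> i < n \<Longrightarrow> 1 \<le> j \<Longrightarrow> j < n \<Longrightarrow> adjacent i j
      \<Longrightarrow> e i \<otimes> g j \<otimes> e i = g j \<otimes> e i \<otimes> e j"
    and ee: "1 \<le> i \<Longrightarrow> i < n \<Longrightarrow> 1 \<le> j \<Longrightarrow> j < n \<Longrightarrow> e i \<otimes> e j = e j \<otimes> e i"
    and ge_distant: "1 \<le> i \<Longrightarrow> i < n \<Longrightarrow> 1 \<le> j \<Longrightarrow> j < n \<Longrightarrow> distant i j \<Longrightarrow> g i \<otimes> e j = e j \<otimes> g i"
    and e_idem: "1 \<le> i \<Longrightarrow> i < n \<Longrightarrow> e i \<otimes> e i = e i"
    and g_square: "1 \<le> i \<Longrightarrow> i < n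
      \<Longrightarrow> g i \<otimes> g i = \<one> \<oplus> ((q_pow 1 - q_pow (-1)) \<odot> (e i \<otimes> g i))"
    and Eij_Suc: "1 \<le> i \<Longrightarrow> i < n \<Longrightarrow> Eij i (Suc i) = e i"
    and Eij_rec: "1 \<le> i \<Longrightarrow> Suc i < j \<Longrightarrow> j \<le> n \<Longrightarrow> Eij i j = g i \<otimes> Eij (Suc i) j \<otimes> inv (g i)"
    and bt_induct: "\<And>P x. x \<in> carrier A \<Longrightarrow> P \<one>
      \<Longrightarrow> (\<And>x y. x \<in> carrier A \<Longrightarrow> y \<in> carrier A \<Longrightarrow> P x \<Longrightarrow> P y \<Longrightarrow> P (x \<oplus> y))
      \<Longrightarrow> (\<And>x c. x \<in> carrier A \<Longrightarrow> P x \<Longrightarrow> P (c \<odot> x))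
      \<Longrightarrow> (\<And>x i. x \<in> carrier A \<Longrightarrow> 1 \<le> i \<Longrightarrow> i < n \<Longrightarrow> P x \<Longrightarrow> P (g i \<otimes> x))
      \<Longrightarrow> (\<And>x i. x \<in> carrier A \<Longrightarrow> 1 \<le> i \<Longrightarrow> i < n \<Longrightarrow> P x \<Longrightarrow> P (e i \<otimes> x)) \<Longrightarrow> P x"
begin

lemma g_Units [simp]:
  assumes i: "1 \<le> i" "i < n"
  shows "g i \<in> Units A"
proof -
  let ?t = "q_pow 1 - q_pow (-1)"
  \<comment> \<open>The inverse is read off from the quadratic relation, which says g (g - (q -
    q^{-1}) e) = 1, together with the commutation of g and e.\<close>
  let ?h = "g i \<oplus> ((- ?t) \<odot> e i)"
  note cl = g_closed[OF i] e_closed[OF i]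
  have "g i \<otimes> ?h = (\<one> \<oplus> ?t \<odot> (e i \<otimes> g i)) \<oplus> (- ?t) \<odot> (e i \<otimes> g i)"
    using cl g_square[OF i] ge[OF i] by (simp add: r_distr smult_mult_r)
  also have "\<dots> = \<one>" using cl by (simp add: a_assoc smult_l_distr[symmetric])
  finally have 1: "g i \<otimes> ?h = \<one>" .
  have "?h \<otimes> g i = (\<one> \<oplus> ?t \<odot> (e i \<otimes> g i)) \<oplus> (- ?t) \<odot> (e i \<otimes> g i)"
    using cl g_square[OF i] by (simp add: l_distr smult_mult_l)
  also have "\<dots> = \<one>" using cl by (simp add: a_assoc smult_l_distr[symmetric])
  finally have "?h \<otimes> g i = \<one>" .
  then show ?thesis using 1 cl by (auto simp: Units_def)
qed

section \<open>Conjugation of the elements E_{ij} by the generators\<close>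

lemma Eij_closed [simp]: "1 \<le> i \<Longrightarrow> i < j \<Longrightarrow> j \<le> n \<Longrightarrow> Eij i j \<in> carrier A"
proof (induction "j - i" arbitrary: i rule: less_induct)
  case less
  show ?case
  proof (cases "j = Suc i")
    case True
    then show ?thesis using less.prems by (simp add: Eij_Suc)
  next
    case False
    then have j: "Suc i < j" using less.prems by simp
    have "j - Suc i < j - i" using less.prems by simp
    then have X: "Eij (Suc i) j \<in> carrier A" using less.hyps less.prems j by simp
    have "g i \<in> Units A" "g i \<in> carrier A" using less.prems by simp_all
    then show ?thesis unfolding Eij_rec[OF less.prems(1) j less.prems(3)] using X by simp
  qed
qed

lemma Eij_g:
  assumes "1 \<le> i" "Suc i < j" "j \<le> n"
  shows "Eij i j \<otimes> g i = g i \<otimes> Eij (Suc i) j"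
proof -
  have "g i \<in> Units A" "g i \<in> carrier A" "Eij (Suc i) j \<in> carrier A" using assms by auto
  then show ?thesis using Eij_rec[OF assms] by (simp add: m_assoc)
qed

lemma Eij_far:
  "1 \<le> i \<Longrightarrow> i < j \<Longrightarrow> j \<le> n \<Longrightarrow> 1 \<le> k \<Longrightarrow> k < n \<Longrightarrow> Suc k < i \<or> j < k
    \<Longrightarrow> g k \<otimes> Eij i j = Eij i j \<otimes> g k"
proof (induction "j - i" arbitrary: i rule: less_induct)
  case less
  show ?case
  proof (cases "j = Suc i")
    case True
    then show ?thesis using less.prems by (auto simp: Eij_Suc intro!: ge_distant)
  next
    case False
    then have j: "Suc i < j" using less by auto
    let ?X = "Eij (Suc i) j"
    have IH: "g k \<otimes> ?X = ?X \<otimes> g k" using less.hyps[of "Suc i"] less.prems j by auto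
    have gk: "g k \<otimes> g i = g i \<otimes> g k" using less.prems by (intro gg_distant) auto
    have cl: "g k \<in> carrier A" "g i \<in> carrier A" "?X \<in> carrier A" "Eij i j \<in> carrier A" "g i \<in> Units A"
      using less.prems j by auto
    have Eg: "Eij i j \<otimes> g i = g i \<otimes> ?X" by (rule Eij_g) (use less.prems j in auto)
    show ?thesis by (rule conjugate_intertwine[OF cl(5,1,3,3,4,4) gk IH Eg Eg])
  qed
qed

text \<open>The critical case is \<open>k = Suc i\<close>. Conjugation by the product of
  \<open>g i\<close> and \<open>g k\<close> carries \<open>g i\<close> to \<open>g k\<close>, by the
  braid relation, and \<open>Eij (Suc k) j\<close> to \<open>Eij i j\<close>; the two originals
  commute because their indices are far apart.\<close>

lemma Eij_inner:
  "1 \<le> i \<Longrightarrow> i < k \<Longrightarrow> Suc k < j \<Longrightarrow> j \<le> n \<Longrightarrow> g k \<otimes> Eij i j = Eij i j \<otimes> g k"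
proof (induction "j - i" arbitrary: i rule: less_induct)
  case less
  let ?X = "Eij (Suc i) j"
  have cl: "g k \<in> carrier A" "g i \<in> carrier A" "?X \<in> carrier A" "Eij i j \<in> carrier A" "g i \<in> Units A"
    "g k \<in> Units A"
    using less.prems by auto
  have Eg: "Eij i j \<otimes> g i = g i \<otimes> ?X" by (rule Eij_g) (use less.prems in auto)
  show ?case
  proof (cases "k = Suc i")
    case True
    let ?Y = "Eij (Suc k) j"
    have Y: "?Y \<in> carrier A" using less.prems by auto
    have Eg2: "?X \<otimes> g k = g k \<otimes> ?Y" unfolding True by (rule Eij_g) (use less.prems True in auto)
    have gY: "g i \<otimes> ?Y = ?Y \<otimes> g i" using less.prems True by (intro Eij_far) auto
    have br: "g k \<otimes> (g i \<otimes> g k) = g i \<otimes> (g k \<otimes> g i)"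
      using braid[of k i] less.prems True cl by (simp add: m_assoc)
    have "Eij i j \<otimes> (g i \<otimes> g k) = (Eij i j \<otimes> g i) \<otimes> g k" using cl by (simp add: m_assoc)
    also have "\<dots> = g i \<otimes> (?X \<otimes> g k)" unfolding Eg using cl by (simp add: m_assoc)
    also have "\<dots> = (g i \<otimes> g k) \<otimes> ?Y" unfolding Eg2 using cl Y by (simp add: m_assoc)
    finally have Eu: "Eij i j \<otimes> (g i \<otimes> g k) = (g i \<otimes> g k) \<otimes> ?Y" .
    have gi: "g i \<otimes> g k \<in> carrier A" "g i \<otimes> g k \<in> Units A" using cl by auto
    have "(g k \<otimes> Eij i j) \<otimes> (g i \<otimes> g k) = (g k \<otimes> (g i \<otimes> g k)) \<otimes> ?Y"
      using cl Y Eu gi by (simp add: m_assoc)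
    also have "\<dots> = (g i \<otimes> g k) \<otimes> (g i \<otimes> ?Y)" unfolding br using cl Y by (simp add: m_assoc)
    also have "\<dots> = ((g i \<otimes> g k) \<otimes> ?Y) \<otimes> g i" unfolding gY using cl Y by (simp add: m_assoc)
    also have "\<dots> = Eij i j \<otimes> (g i \<otimes> (g k \<otimes> g i))" unfolding Eu[symmetric] using cl Y by (simp add: m_assoc)
    also have "\<dots> = (Eij i j \<otimes> g k) \<otimes> (g i \<otimes> g k)" unfolding br[symmetric] using cl Y by (simp add: m_assoc)
    finally show ?thesis using cl gi by - (erule unit_r_cancel, auto)
  next
    case False
    have IH: "g k \<otimes> ?X = ?X \<otimes> g k" using less.hyps[of "Suc i"] less.prems False by auto
    have gk: "g k \<otimes> g i = g i \<otimes> g k" using less.prems False by (intro gg_distant) auto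
    show ?thesis by (rule conjugate_intertwine[OF cl(5,1,3,3,4,4) gk IH Eg Eg])
  qed
qed

text \<open>Chaining \<open>eeg\<close> and \<open>ege\<close> for \<open>(i, j)\<close> gives the
  second commutation, chaining them for \<open>(j, i)\<close> the first.\<close>

lemma ee_g:
  assumes "1 \<le> i" "i < n" "1 \<le> j" "j < n" "adjacent i j"
  shows "e i \<otimes> e j \<otimes> g i = g i \<otimes> (e i \<otimes> e j)" "e i \<otimes> e j \<otimes> g j = g j \<otimes> (e i \<otimes> e j)"
proof -
  have cl: "g i \<in> carrier A" "e i \<in> carrier A" "g j \<in> carrier A" "e j \<in> carrier A" using assms by auto
  have sym: "adjacent j i" using assms by auto
  have "e i \<otimes> e j \<otimes> g i = e j \<otimes> e i \<otimes> g i" using ee assms by simp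
  also have "\<dots> = g i \<otimes> e j \<otimes> e i" using eeg[of j i] ege[of j i] assms sym by simp
  also have "\<dots> = g i \<otimes> (e i \<otimes> e j)" using ee[of i j] assms cl by (simp add: m_assoc)
  finally show "e i \<otimes> e j \<otimes> g i = g i \<otimes> (e i \<otimes> e j)" .
  show "e i \<otimes> e j \<otimes> g j = g j \<otimes> (e i \<otimes> e j)"
    using eeg[of i j] ege[of i j] assms sym cl by (simp add: m_assoc)
qed

lemma g_square_commute:
  assumes i: "1 \<le> i" "i < n" and x: "x \<in> carrier A" "(e i \<otimes> g i) \<otimes> x = x \<otimes> (e i \<otimes> g i)"
  shows "(g i \<otimes> g i) \<otimes> x = x \<otimes> (g i \<otimes> g i)"
  using g_square[OF i] g_closed[OF i] e_closed[OF i] x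
  by (simp add: l_distr r_distr smult_mult_l smult_mult_r)

text \<open>By the quadratic relation only the product of \<open>e i\<close> and \<open>g i\<close>
  has to commute with \<open>e (Suc i)\<close>. The aim is that conjugation by \<open>g i\<close>
  and by its inverse agree on the E_{ij}, so that the generators permute them through
  involutions.\<close>

lemma g_square_e:
  assumes "1 \<le> i" "Suc i < n"
  shows "(g i \<otimes> g i) \<otimes> e (Suc i) = e (Suc i) \<otimes> (g i \<otimes> g i)"
proof (rule g_square_commute)
  have cl: "g i \<in> carrier A" "e i \<in> carrier A" "e (Suc i) \<in> carrier A" using assms by auto
  have "e i \<otimes> g i \<otimes> e (Suc i) = g i \<otimes> (e i \<otimes> e (Suc i))"
    using ge[of i] assms cl by (simp add: m_assoc[symmetric])
  also have "\<dots> = e i \<otimes> e (Suc i) \<otimes> g i" using ee_g(1)[of i "Suc i"] assms by simp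
  also have "\<dots> = e (Suc i) \<otimes> (e i \<otimes> g i)" using ee[of i "Suc i"] assms cl by (simp add: m_assoc)
  finally show "e i \<otimes> g i \<otimes> e (Suc i) = e (Suc i) \<otimes> (e i \<otimes> g i)" .
qed (use assms in auto)

lemma Eij_right_up:
  "1 \<le> i \<Longrightarrow> i < j \<Longrightarrow> j < n \<Longrightarrow> g j \<otimes> Eij i j = Eij i (Suc j) \<otimes> g j"
proof (induction "j - i" arbitrary: i rule: less_induct)
  case less
  have cl: "g j \<in> carrier A" "g i \<in> carrier A" "Eij i j \<in> carrier A" "Eij i (Suc j) \<in> carrier A"
    "Eij (Suc i) (Suc j) \<in> carrier A" "g i \<in> Units A" "g j \<in> Units A"
    using less.prems by auto
  have Eg: "Eij i (Suc j) \<otimes> g i = g i \<otimes> Eij (Suc i) (Suc j)" by (rule Eij_g) (use less.prems in auto)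
  show ?case
  proof (cases "j = Suc i")
    case True
    have cle: "e i \<in> carrier A" "e j \<in> carrier A" using less.prems by auto
    have X: "Eij (Suc i) (Suc j) = e j" "Eij i j = e i" using True less.prems Eij_Suc by auto
    \<comment> \<open>Here the defining conjugation has to be reversed, which is possible because
      the square of \<open>g i\<close> commutes with \<open>e j\<close>. Afterwards
      \<open>egg\<close> gives the claim up to the factor \<open>g i\<close>, which cancels.\<close>
    have gE: "g i \<otimes> Eij i (Suc j) = e j \<otimes> g i"
    proof (rule unit_r_cancel)
      have "g i \<otimes> Eij i (Suc j) \<otimes> g i = g i \<otimes> g i \<otimes> e j" using Eg X cl cle by (simp add: m_assoc)
      also have "\<dots> = e j \<otimes> g i \<otimes> g i"
        using g_square_e[of i] less.prems True cl cle by (simp add: m_assoc)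
      finally show "g i \<otimes> Eij i (Suc j) \<otimes> g i = e j \<otimes> g i \<otimes> g i" .
    qed (use cl cle in auto)
    have "g i \<otimes> (g j \<otimes> e i) = e j \<otimes> g i \<otimes> g j"
      using egg[of j i] less.prems True cl cle by (simp add: m_assoc)
    also have "\<dots> = g i \<otimes> (Eij i (Suc j) \<otimes> g j)" unfolding gE[symmetric] using cl by (simp add: m_assoc)
    finally show ?thesis unfolding X(2) using cl cle by - (erule unit_l_cancel, auto)
  next
    case False
    let ?X = "Eij (Suc i) j" and ?X' = "Eij (Suc i) (Suc j)"
    have clX: "?X \<in> carrier A" using less.prems False by auto
    have IH: "g j \<otimes> ?X = ?X' \<otimes> g j" using less.hyps[of "Suc i"] less.prems False by auto
    have Eg2: "Eij i j \<otimes> g i = g i \<otimes> ?X" by (rule Eij_g) (use less.prems False in auto)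
    have gk: "g j \<otimes> g i = g i \<otimes> g j" using less.prems False by (intro gg_distant) auto
    show ?thesis by (rule conjugate_intertwine[OF cl(6,1) clX cl(5,3,4) gk IH Eg2 Eg])
  qed
qed

lemma Eij_right_down:
  "1 \<le> i \<Longrightarrow> i < j \<Longrightarrow> j < n \<Longrightarrow> g j \<otimes> Eij i (Suc j) = Eij i j \<otimes> g j"
proof (induction "j - i" arbitrary: i rule: less_induct)
  case less
  have cl: "g j \<in> carrier A" "g i \<in> carrier A" "Eij i j \<in> carrier A" "Eij i (Suc j) \<in> carrier A"
    "Eij (Suc i) (Suc j) \<in> carrier A" "g i \<in> Units A" "g j \<in> Units A"
    using less.prems by auto
  have Eg: "Eij i (Suc j) \<otimes> g i = g i \<otimes> Eij (Suc i) (Suc j)" by (rule Eij_g) (use less.prems in auto)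
  show ?case
  proof (cases "j = Suc i")
    case True
    have cle: "e i \<in> carrier A" "e j \<in> carrier A" using less.prems by auto
    have X: "Eij (Suc i) (Suc j) = e j" "Eij i j = e i" using True less.prems Eij_Suc by auto
    have "g j \<otimes> Eij i (Suc j) \<otimes> g i = e i \<otimes> g j \<otimes> g i"
      using egg[of i j] less.prems True Eg X cl cle by (simp add: m_assoc)
    then show ?thesis unfolding X(2) using cl cle by - (erule unit_r_cancel, auto)
  next
    case False
    let ?X = "Eij (Suc i) j" and ?X' = "Eij (Suc i) (Suc j)"
    have clX: "?X \<in> carrier A" using less.prems False by auto
    have IH: "g j \<otimes> ?X' = ?X \<otimes> g j" using less.hyps[of "Suc i"] less.prems False by auto
    have Eg2: "Eij i j \<otimes> g i = g i \<otimes> ?X" by (rule Eij_g) (use less.prems False in auto)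
    have gk: "g j \<otimes> g i = g i \<otimes> g j" using less.prems False by (intro gg_distant) auto
    show ?thesis by (rule conjugate_intertwine[OF cl(6,1,5) clX cl(4,3) gk IH Eg Eg2])
  qed
qed

text \<open>Induction on the right end: \<open>g j\<close> moves it from \<open>j\<close> to
  \<open>Suc j\<close> and commutes with \<open>g i\<close>. The start is
  \<open>g_square_e\<close>.\<close>

lemma g_square_Eij:
  "1 \<le> i \<Longrightarrow> Suc i < j \<Longrightarrow> j \<le> n \<Longrightarrow> (g i \<otimes> g i) \<otimes> Eij (Suc i) j = Eij (Suc i) j \<otimes> (g i \<otimes> g i)"
proof (induction j rule: nat_induct)
  case (Suc j)
  show ?case
  proof (cases "j = Suc i")
    case True
    then show ?thesis using g_square_e[of i] Suc.prems by (simp add: Eij_Suc)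
  next
    case False
    let ?X = "Eij (Suc i) j" and ?X' = "Eij (Suc i) (Suc j)"
    have cl: "g i \<in> carrier A" "g j \<in> carrier A" "g j \<in> Units A" "?X \<in> carrier A" "?X' \<in> carrier A"
      using Suc.prems False by auto
    have IH: "(g i \<otimes> g i) \<otimes> ?X = ?X \<otimes> (g i \<otimes> g i)" using Suc False by auto
    have gX: "g j \<otimes> ?X = ?X' \<otimes> g j" using Suc.prems False by (intro Eij_right_up) auto
    have gk: "g j \<otimes> g i = g i \<otimes> g j" using Suc.prems False by (intro gg_distant) auto
    have "(g i \<otimes> g i) \<otimes> g j = g i \<otimes> (g j \<otimes> g i)" using gk cl by (simp add: m_assoc)
    also have "\<dots> = (g i \<otimes> g j) \<otimes> g i" using cl by (simp only: m_assoc)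
    also have "\<dots> = g j \<otimes> (g i \<otimes> g i)" unfolding gk[symmetric] using cl by (simp only: m_assoc)
    finally have gk2: "(g i \<otimes> g i) \<otimes> g j = g j \<otimes> (g i \<otimes> g i)" .
    show ?thesis
      by (rule conjugate_intertwine[OF cl(3) _ cl(4,4,5,5) gk2 IH gX[symmetric] gX[symmetric]]) (use cl in simp)
  qed
qed simp

lemma Eij_left_up:
  assumes "1 \<le> i" "Suc i < j" "j \<le> n"
  shows "g i \<otimes> Eij i j = Eij (Suc i) j \<otimes> g i"
proof (rule unit_r_cancel)
  have cl: "g i \<in> carrier A" "Eij (Suc i) j \<in> carrier A" "Eij i j \<in> carrier A" using assms by auto
  have "g i \<otimes> Eij i j \<otimes> g i = (g i \<otimes> g i) \<otimes> Eij (Suc i) j"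
    using Eij_g[OF assms] cl by (simp add: m_assoc)
  also have "\<dots> = Eij (Suc i) j \<otimes> g i \<otimes> g i"
    using g_square_Eij[OF assms] cl by (simp add: m_assoc)
  finally show "g i \<otimes> Eij i j \<otimes> g i = Eij (Suc i) j \<otimes> g i \<otimes> g i" .
qed (use assms in auto)

section \<open>Permutations acting on the indices of the E_{ij}\<close>

definition Eset :: "nat \<Rightarrow> nat \<Rightarrow> 'a"
  where "Eset i j = Eij (min i j) (max i j)"

lemma Eset_sym: "Eset i j = Eset j i"
  by (simp add: Eset_def min.commute max.commute)

lemma Eset_less: "i < j \<Longrightarrow> Eset i j = Eij i j"
  by (simp add: Eset_def)

lemma Eset_closed [simp]: "i \<in> {1..n} \<Longrightarrow> j \<in> {1..n} \<Longrightarrow> i \<noteq> j \<Longrightarrow> Eset i j \<in> carrier A"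
  unfolding Eset_def by (intro Eij_closed) (auto simp: min_def max_def)

text \<open>The preceding rules cover each position of \<open>k\<close> and \<open>Suc k\<close>
  relative to \<open>i < j\<close>, and the symmetry of \<open>Eset\<close> gives the case
  \<open>j < i\<close>.\<close>

lemma g_Eset:
  assumes "1 \<le> k" "k < n" "i \<in> {1..n}" "j \<in> {1..n}" "i \<noteq> j"
  shows "g k \<otimes> Eset i j = Eset (sw k i) (sw k j) \<otimes> g k"
proof -
  have main: "g k \<otimes> Eset i j = Eset (sw k i) (sw k j) \<otimes> g k"
    if ij: "1 \<le> i" "i < j" "j \<le> n" for i j
  proof -
    consider "Suc k < i" | "Suc k = i" | "k = i" "j = Suc i" | "k = i" "Suc i < j" | "i < k" "Suc k < j"
      | "i < k" "j = Suc k" | "k = j" | "j < k"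
      using ij by linarith
    then show ?thesis
    proof cases
      case 1
      then show ?thesis using ij assms(1,2) Eij_far[of i j k] by (simp add: Eset_less)
    next
      case 2
      then show ?thesis using ij assms(1,2) Eij_g[of k j] by (auto simp: Eset_less)
    next
      case 3
      then show ?thesis using ij assms(1,2) ge[of i] by (simp add: Eset_less Eset_sym[of "Suc i"] Eij_Suc)
    next
      case 4
      then show ?thesis using ij assms(1,2) Eij_left_up[of i j] by (simp add: Eset_less)
    next
      case 5
      then show ?thesis using ij assms(1,2) Eij_inner[of i k j] by (simp add: Eset_less)
    next
      case 6
      then show ?thesis using ij assms(1,2) Eij_right_down[of i k] by (simp add: Eset_less)
    next
      case 7
      then show ?thesis using ij assms(1,2) Eij_right_up[of i k] by (simp add: Eset_less)
    next
      case 8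
      then show ?thesis using ij assms(1,2) Eij_far[of i j k] by (simp add: Eset_less)
    qed
  qed
  show ?thesis
  proof (cases "i < j")
    case True
    then show ?thesis using main[of i j] assms by auto
  next
    case False
    then show ?thesis using main[of j i] assms Eset_sym by (metis atLeastAtMost_iff linorder_neqE_nat)
  qed
qed

text \<open>A product of generators along an expression of \<open>w\<close> does it. Together with
  \<open>permutes_extend_list\<close> this transports relations from the indices 1, 2, 3, ..., where
  the presentation applies, to arbitrary distinct indices.\<close>

lemma permutation_intertwiner:
  assumes "w permutes {1..n}"
  shows "\<exists>u\<in>Units A. \<forall>i\<in>{1..n}. \<forall>j\<in>{1..n}. i \<noteq> j \<longrightarrow> u \<otimes> Eset i j = Eset (w i) (w j) \<otimes> u"
  using assms
proof (induction rule: permutes_adjacent_induct)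
  case id
  then show ?case by (intro bexI[of _ \<one>]) auto
next
  case (swap w k)
  then obtain u where u: "u \<in> Units A"
    "\<And>i j. i \<in> {1..n} \<Longrightarrow> j \<in> {1..n} \<Longrightarrow> i \<noteq> j \<Longrightarrow> u \<otimes> Eset i j = Eset (w i) (w j) \<otimes> u" by blast
  have uc: "u \<in> carrier A" "g k \<in> carrier A" using u swap by auto
  have "(u \<otimes> g k) \<otimes> Eset i j = Eset ((w \<circ> sw k) i) ((w \<circ> sw k) j) \<otimes> (u \<otimes> g k)"
    if ij: "i \<in> {1..n}" "j \<in> {1..n}" "i \<noteq> j" for i j
  proof -
    have s: "sw k i \<in> {1..n}" "sw k j \<in> {1..n}" "sw k i \<noteq> sw k j"
      using ij permutes_neq[OF sw_permutes[OF swap(2,3)] ij(3)]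
      by (simp_all only: permutes_in_image[OF sw_permutes[OF swap(2,3)]] simp_thms)
    have ws: "w (sw k i) \<in> {1..n}" "w (sw k j) \<in> {1..n}" "w (sw k i) \<noteq> w (sw k j)"
      using s permutes_in_image[OF swap(1)] permutes_neq[OF swap(1)] by blast+
    have E: "Eset i j \<in> carrier A" "Eset (sw k i) (sw k j) \<in> carrier A"
      "Eset (w (sw k i)) (w (sw k j)) \<in> carrier A"
      using ij s ws by auto
    have "(u \<otimes> g k) \<otimes> Eset i j = u \<otimes> (Eset (sw k i) (sw k j) \<otimes> g k)"
      using g_Eset[OF swap(2,3) ij] uc E by (simp add: m_assoc)
    also have "\<dots> = Eset (w (sw k i)) (w (sw k j)) \<otimes> (u \<otimes> g k)"
      using u(2)[OF s] uc E by (simp add: m_assoc[symmetric])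
    finally show ?thesis by simp
  qed
  moreover have "u \<otimes> g k \<in> Units A" using u swap by auto
  ultimately show ?case by blast
qed

lemma intertwine_mult:
  assumes "u \<in> carrier A" "x \<in> carrier A" "y \<in> carrier A" "x' \<in> carrier A" "y' \<in> carrier A"
    "u \<otimes> x = x' \<otimes> u" "u \<otimes> y = y' \<otimes> u"
  shows "u \<otimes> (x \<otimes> y) = (x' \<otimes> y') \<otimes> u"
proof -
  have "u \<otimes> (x \<otimes> y) = (u \<otimes> x) \<otimes> y" using assms(1-5) by (simp add: m_assoc)
  also have "\<dots> = x' \<otimes> (u \<otimes> y)" unfolding assms(6) using assms(1-5) by (simp add: m_assoc)
  also have "\<dots> = (x' \<otimes> y') \<otimes> u" unfolding assms(7) using assms(1-5) by (simp add: m_assoc)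
  finally show ?thesis .
qed

lemma Eset_idem:
  assumes ij: "i \<in> {1..n}" "j \<in> {1..n}" "i \<noteq> j"
  shows "Eset i j \<otimes> Eset i j = Eset i j"
proof -
  have n: "2 \<le> n" using ij by auto
  have "distinct [i, j]" "set [i, j] \<subseteq> {1..n}" using ij by auto
  from permutes_extend_list[OF this] obtain w where w0: "w permutes {1..n}"
    "\<forall>m<length [i, j]. w (Suc m) = [i, j] ! m" by blast
  have w: "w 1 = i" "w 2 = j"
    using w0(2)[rule_format, of 0] w0(2)[rule_format, of 1] by (simp_all add: numeral_2_eq_2)
  obtain u where u0: "u \<in> Units A"
    "\<forall>i\<in>{1..n}. \<forall>j\<in>{1..n}. i \<noteq> j \<longrightarrow> u \<otimes> Eset i j = Eset (w i) (w j) \<otimes> u"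
    using permutation_intertwiner[OF w0(1)] by blast
  have u: "u \<in> Units A" "u \<otimes> Eset 1 2 = Eset i j \<otimes> u"
    using u0(1) u0(2)[rule_format, of 1 2] w n by simp_all
  have cl: "u \<in> carrier A" "Eset 1 2 \<in> carrier A" "Eset i j \<in> carrier A"
    using u n ij by auto
  have "Eset 1 2 \<otimes> Eset 1 2 = Eset 1 2"
    using n Eij_Suc[of 1] e_idem[of 1] by (simp add: Eset_def numeral_2_eq_2)
  then have "(Eset i j \<otimes> Eset i j) \<otimes> u = Eset i j \<otimes> u"
    using intertwine_mult[OF cl(1,2,2,3,3) u(2,2)] u(2) by simp
  then show ?thesis using u cl by - (erule unit_r_cancel, auto)
qed

text \<open>Transported from 1, 2, 3. There E_{13} is \<open>e 2\<close> conjugated by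
  \<open>g 1\<close>, and \<open>g 1\<close> commutes with the product of \<open>e 1\<close> and
  \<open>e 2\<close>, which absorbs \<open>e 2\<close>. The second relation will make belonging to
  one block transitive.\<close>

lemma Eset_triple:
  assumes ijk: "i \<in> {1..n}" "j \<in> {1..n}" "k \<in> {1..n}" "i \<noteq> j" "j \<noteq> k" "i \<noteq> k"
  shows "Eset i j \<otimes> Eset j k = Eset j k \<otimes> Eset i j"
    and "Eset i j \<otimes> Eset j k \<otimes> Eset i k = Eset i j \<otimes> Eset j k"
proof -
  have "card {i, j, k} \<le> card {1..n}" using ijk by (intro card_mono) auto
  then have n: "3 \<le> n" using ijk by auto
  have "distinct [i, j, k]" "set [i, j, k] \<subseteq> {1..n}" using ijk by auto
  from permutes_extend_list[OF this] obtain w where w0: "w permutes {1..n}"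
    "\<forall>m<length [i, j, k]. w (Suc m) = [i, j, k] ! m" by blast
  have w: "w 1 = i" "w 2 = j" "w 3 = k"
    using w0(2)[rule_format, of 0] w0(2)[rule_format, of 1] w0(2)[rule_format, of 2]
    by (simp_all add: numeral_2_eq_2 numeral_3_eq_3)
  obtain u where u: "u \<in> Units A"
    "\<forall>i\<in>{1..n}. \<forall>j\<in>{1..n}. i \<noteq> j \<longrightarrow> u \<otimes> Eset i j = Eset (w i) (w j) \<otimes> u"
    using permutation_intertwiner[OF w0(1)] by blast
  have uE: "u \<otimes> Eset 1 2 = Eset i j \<otimes> u" "u \<otimes> Eset 2 3 = Eset j k \<otimes> u" "u \<otimes> Eset 1 3 = Eset i k \<otimes> u"
    using u(2)[rule_format, of 1 2] u(2)[rule_format, of 2 3] u(2)[rule_format, of 1 3] w n by simp_all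
  have cl: "u \<in> carrier A" "Eset 1 2 \<in> carrier A" "Eset 2 3 \<in> carrier A" "Eset 1 3 \<in> carrier A"
    "Eset i j \<in> carrier A" "Eset j k \<in> carrier A" "Eset i k \<in> carrier A"
    using u(1) n ijk by auto
  have E: "Eset 1 2 = e 1" "Eset 2 3 = e 2" "Eset 1 3 = Eij 1 3"
    using n Eij_Suc[of 1] Eij_Suc[of 2] by (simp_all add: Eset_def numeral_2_eq_2 numeral_3_eq_3)
  have eg: "e 1 \<in> carrier A" "e 2 \<in> carrier A" "g 1 \<in> carrier A" "g 1 \<in> Units A" "Eij 1 3 \<in> carrier A"
    using n by auto
  have 12: "e 1 \<otimes> e 2 = e 2 \<otimes> e 1" using n by (intro ee) auto
  have E13: "Eij 1 3 \<otimes> g 1 = g 1 \<otimes> e 2"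
    using Eij_g[of 1 3] Eij_Suc[of 2] n by (simp add: numeral_2_eq_2 numeral_3_eq_3)
  have c1: "e 1 \<otimes> e 2 \<otimes> g 1 = g 1 \<otimes> (e 1 \<otimes> e 2)" using ee_g(1)[of 1 2] n by simp
  have "e 1 \<otimes> e 2 \<otimes> Eij 1 3 \<otimes> g 1 = e 1 \<otimes> e 2 \<otimes> (g 1 \<otimes> e 2)"
    using E13 eg by (simp add: m_assoc)
  also have "\<dots> = g 1 \<otimes> (e 1 \<otimes> e 2) \<otimes> e 2" unfolding c1[symmetric] using eg by (simp add: m_assoc)
  also have "\<dots> = g 1 \<otimes> (e 1 \<otimes> e 2)" using e_idem[of 2] n eg by (simp add: m_assoc)
  also have "\<dots> = e 1 \<otimes> e 2 \<otimes> g 1" by (rule c1[symmetric])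
  finally have 123: "e 1 \<otimes> e 2 \<otimes> Eij 1 3 = e 1 \<otimes> e 2"
    using eg by - (erule unit_r_cancel, auto)
  have p12: "u \<otimes> (e 1 \<otimes> e 2) = (Eset i j \<otimes> Eset j k) \<otimes> u"
    using intertwine_mult[OF cl(1,2,3,5,6) uE(1,2)] unfolding E .
  have p21: "u \<otimes> (e 2 \<otimes> e 1) = (Eset j k \<otimes> Eset i j) \<otimes> u"
    using intertwine_mult[OF cl(1,3,2,6,5) uE(2,1)] unfolding E .
  show "Eset i j \<otimes> Eset j k = Eset j k \<otimes> Eset i j"
    by (rule unit_r_cancel[OF _ u(1)]) (use p12 p21 12 cl in simp_all)
  have p3: "u \<otimes> (e 1 \<otimes> e 2 \<otimes> Eij 1 3) = (Eset i j \<otimes> Eset j k \<otimes> Eset i k) \<otimes> u"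
    using intertwine_mult[of u "e 1 \<otimes> e 2" "Eij 1 3" "Eset i j \<otimes> Eset j k" "Eset i k"] p12 uE(3) cl eg
    unfolding E by auto
  show "Eset i j \<otimes> Eset j k \<otimes> Eset i k = Eset i j \<otimes> Eset j k"
    by (rule unit_r_cancel[OF _ u(1)]) (use p12 p3 123 cl in simp_all)
qed

lemma Eset_disjoint:
  assumes ijkl: "i \<in> {1..n}" "j \<in> {1..n}" "k \<in> {1..n}" "l \<in> {1..n}" "distinct [i, j, k, l]"
  shows "Eset i j \<otimes> Eset k l = Eset k l \<otimes> Eset i j"
proof -
  have "card {i, j, k, l} \<le> card {1..n}" using ijkl by (intro card_mono) auto
  then have n: "4 \<le> n" using ijkl by auto
  have "distinct [i, j, k, l]" "set [i, j, k, l] \<subseteq> {1..n}" using ijkl by auto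
  from permutes_extend_list[OF this] obtain w where w0: "w permutes {1..n}"
    "\<forall>m<length [i, j, k, l]. w (Suc m) = [i, j, k, l] ! m" by blast
  have w: "w 1 = i" "w 2 = j" "w 3 = k" "w 4 = l"
    using w0(2)[rule_format, of 0] w0(2)[rule_format, of 1] w0(2)[rule_format, of 2]
      w0(2)[rule_format, of 3] by (simp_all add: eval_nat_numeral)
  obtain u where u: "u \<in> Units A"
    "\<forall>i\<in>{1..n}. \<forall>j\<in>{1..n}. i \<noteq> j \<longrightarrow> u \<otimes> Eset i j = Eset (w i) (w j) \<otimes> u"
    using permutation_intertwiner[OF w0(1)] by blast
  have uE: "u \<otimes> Eset 1 2 = Eset i j \<otimes> u" "u \<otimes> Eset 3 4 = Eset k l \<otimes> u"
    using u(2)[rule_format, of 1 2] u(2)[rule_format, of 3 4] w n by simp_all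
  have cl: "u \<in> carrier A" "Eset 1 2 \<in> carrier A" "Eset 3 4 \<in> carrier A"
    "Eset i j \<in> carrier A" "Eset k l \<in> carrier A"
    using u(1) n ijkl by auto
  have E: "Eset 1 2 = e 1" "Eset 3 4 = e 3"
    using n Eij_Suc[of 1] Eij_Suc[of 3] by (simp_all add: Eset_def numeral_2_eq_2)
  have 13: "e 1 \<otimes> e 3 = e 3 \<otimes> e 1" using n by (intro ee) auto
  have "u \<otimes> (e 1 \<otimes> e 3) = (Eset i j \<otimes> Eset k l) \<otimes> u"
    using intertwine_mult[OF cl(1,2,3,4,5) uE(1,2)] unfolding E .
  moreover
  have "u \<otimes> (e 3 \<otimes> e 1) = (Eset k l \<otimes> Eset i j) \<otimes> u"
    using intertwine_mult[OF cl(1,3,2,5,4) uE(2,1)] unfolding E .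
  ultimately have "(Eset i j \<otimes> Eset k l) \<otimes> u = (Eset k l \<otimes> Eset i j) \<otimes> u" using 13 by simp
  then show ?thesis by (rule unit_r_cancel[OF _ u(1)]) (use cl in simp_all)
qed

lemma Eset_commute:
  assumes "i \<in> {1..n}" "j \<in> {1..n}" "k \<in> {1..n}" "l \<in> {1..n}" "i \<noteq> j" "k \<noteq> l"
  shows "Eset i j \<otimes> Eset k l = Eset k l \<otimes> Eset i j"
proof -
  consider "{i, j} = {k, l}" | "i = k" "j \<noteq> l" | "i = l" "j \<noteq> k" | "j = k" "i \<noteq> l" | "j = l" "i \<noteq> k"
    | "distinct [i, j, k, l]"
    using assms(5,6) by auto
  then show ?thesis
  proof cases
    case 1
    then show ?thesis using Eset_sym by (auto simp: doubleton_eq_iff)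
  next
    case 2
    then show ?thesis using Eset_triple(1)[of j i l] assms Eset_sym[of i j] by auto
  next
    case 3
    then show ?thesis using Eset_triple(1)[of j i k] assms Eset_sym[of i j] Eset_sym[of k l] by auto
  next
    case 4
    then show ?thesis using Eset_triple(1)[of i j l] assms by auto
  next
    case 5
    then show ?thesis using Eset_triple(1)[of i j k] assms Eset_sym[of k l] by auto
  next
    case 6
    then show ?thesis using Eset_disjoint assms by auto
  qed
qed

end

section \<open>The idempotents attached to set partitions\<close>

text \<open>The list comprehension of \<open>bt_E_partition\<close> with the test left open, so that
  products over all pairs and over the pairs inside blocks share one form.\<close>

definition ipairs :: "nat \<Rightarrow> (nat \<Rightarrow> nat \<Rightarrow> bool) \<Rightarrow> (nat \<times> nat) list"
  where "ipairs n Q = [(i, j). i \<leftarrow> [1..<Suc n], j \<leftarrow> [Suc i..<Suc n], Q i j]"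

lemma set_ipairs: "set (ipairs n Q) = {(i, j). 1 \<le> i \<and> i < j \<and> j \<le> n \<and> Q i j}"
  by (auto simp: ipairs_def)

text \<open>For \<open>A\<close> strictly below \<open>C\<close> this is the recursion of
  \<open>moebius\<close> rearranged; otherwise the interval is empty or a single point.\<close>

lemma moebius_sum:
  assumes A: "partition_on {1..n} A"
  shows "(\<Sum>B\<in>{B. refines {1..n} A B \<and> refines {1..n} B C}. moebius n A B) = (if A = C then 1 else 0)"
proof (cases "refines {1..n} A C")
  case False
  then have empty: "{B. refines {1..n} A B \<and> refines {1..n} B C} = {}" using refines_trans by blast
  have "A \<noteq> C" using False refines_refl[OF A] by blast
  then show ?thesis unfolding empty by simp
next
  case True
  show ?thesis
  proof (cases "A = C")
    case eq: True
    have "{B. refines {1..n} A B \<and> refines {1..n} B C} = {C}"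
      using refines_asym refines_refl[OF A] unfolding eq by blast
    then show ?thesis by (simp add: eq moebius.simps)
  next
    case False
    let ?S = "{B. refines {1..n} A B \<and> refines {1..n} B C \<and> B \<noteq> C}"
    have "partition_on {1..n} C" using True unfolding refines_def by blast
    then have "refines {1..n} C C" by (rule refines_refl)
    then have ins: "{B. refines {1..n} A B \<and> refines {1..n} B C} = insert C ?S" using True by blast
    have fin: "finite ?S"
      by (rule finite_subset[OF _ finite_set_partitions[of n]]) (auto simp: refines_def)
    have m: "moebius n A C = - (\<Sum>B\<in>?S. moebius n A B)"
      by (subst moebius.simps) (use True False in simp)
    have "(\<Sum>B\<in>insert C ?S. moebius n A B) = moebius n A C + (\<Sum>B\<in>?S. moebius n A B)"
      by (rule sum.insert[OF fin]) simp
    then show ?thesis unfolding ins m using False by simp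
  qed
qed

context bt
begin

lemmas bt_generation_induct = bt_induct[consumes 1, case_names one add smult gen_g gen_e]

abbreviation SP :: "nat set set set"
  where "SP \<equiv> set_partitions n"

definition F :: "nat set set \<Rightarrow> 'a"
  where "F B = lprod (\<lambda>(i, j). if same B i j then Eij i j else \<one> \<ominus> Eij i j) (ipairs n (\<lambda>_ _. True))"

text \<open>A weight space of the commuting E_{ij} under left multiplication, the weight being
  recorded by a partition. \<open>right_type\<close> is its counterpart under right
  multiplication.\<close>

definition left_type :: "nat set set \<Rightarrow> 'a \<Rightarrow> bool"
  where "left_type B y \<longleftrightarrow> y \<in> carrier A \<and>
    (\<forall>i\<in>{1..n}. \<forall>j\<in>{1..n}. i \<noteq> j \<longrightarrow> Eset i j \<otimes> y = (if same B i j then y else \<zero>))"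

definition right_type :: "nat set set \<Rightarrow> 'a \<Rightarrow> bool"
  where "right_type B y \<longleftrightarrow> y \<in> carrier A \<and>
    (\<forall>i\<in>{1..n}. \<forall>j\<in>{1..n}. i \<noteq> j \<longrightarrow> y \<otimes> Eset i j = (if same B i j then y else \<zero>))"

lemma F_factor_closed:
  "p \<in> set (ipairs n Q) \<Longrightarrow> (case p of (i, j) \<Rightarrow> if same B i j then Eij i j else \<one> \<ominus> Eij i j) \<in> carrier A"
  by (auto simp: set_ipairs)

lemma F_closed [simp]: "F B \<in> carrier A"
  unfolding F_def by (rule lprod_closed, rule F_factor_closed)

lemma Eset_commute_factor:
  assumes "i \<in> {1..n}" "j \<in> {1..n}" "i \<noteq> j" "p \<in> set (ipairs n Q)"
  shows "Eset i j \<otimes> (case p of (i, j) \<Rightarrow> if same B i j then Eij i j else \<one> \<ominus> Eij i j) =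
    (case p of (i, j) \<Rightarrow> if same B i j then Eij i j else \<one> \<ominus> Eij i j) \<otimes> Eset i j"
proof -
  obtain k l where p: "p = (k, l)" by (cases p)
  have kl: "1 \<le> k" "k < l" "l \<le> n" using assms(4) by (auto simp: set_ipairs p)
  then have E: "Eij k l \<in> carrier A" "Eset i j \<in> carrier A" "Eset i j \<otimes> Eij k l = Eij k l \<otimes> Eset i j"
    using assms(1-3) Eset_commute[of i j k l] by (auto simp: Eset_less)
  then show ?thesis by (simp add: p minus_eq l_distr r_distr l_minus r_minus)
qed

lemma Eset_F:
  assumes ij: "i \<in> {1..n}" "j \<in> {1..n}" "i \<noteq> j"
  shows "Eset i j \<otimes> F B = (if same B i j then F B else \<zero>)" "F B \<otimes> Eset i j = Eset i j \<otimes> F B"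
proof -
  show "F B \<otimes> Eset i j = Eset i j \<otimes> F B"
    unfolding F_def using ij
    by (intro lprod_commute[symmetric] F_factor_closed Eset_commute_factor Eset_closed) auto
  have main: "Eset i j \<otimes> F B = (if same B i j then F B else \<zero>)" if ij: "1 \<le> i" "i < j" "j \<le> n" for i j
  proof -
    let ?f = "\<lambda>(i, j). if same B i j then Eij i j else \<one> \<ominus> Eij i j"
    have i: "i \<in> {1..n}" "j \<in> {1..n}" "i \<noteq> j" using ij by auto
    have p: "(i, j) \<in> set (ipairs n (\<lambda>_ _. True))" using ij by (simp add: set_ipairs)
    note ab = lprod_absorb[OF Eset_closed[OF i] F_factor_closed Eset_commute_factor[OF i] p]
    have E: "Eij i j \<in> carrier A" "Eij i j \<otimes> Eij i j = Eij i j"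
      using ij Eset_idem[OF i] by (auto simp: Eset_less)
    show ?thesis
    proof (cases "same B i j")
      case True
      then have "Eset i j \<otimes> ?f (i, j) = ?f (i, j)" using E ij by (simp add: Eset_less)
      then show ?thesis unfolding F_def using ab(1) True by simp
    next
      case False
      then have "Eset i j \<otimes> ?f (i, j) = \<zero>"
        using E ij by (simp add: Eset_less minus_eq r_distr r_minus r_neg)
      then show ?thesis unfolding F_def using ab(2) False by simp
    qed
  qed
  show "Eset i j \<otimes> F B = (if same B i j then F B else \<zero>)"
  proof (cases "i < j")
    case True
    then show ?thesis using main[of i j] ij by simp
  next
    case False
    then show ?thesis using main[of j i] ij Eset_sym[of i j] same_sym[of B i j] by simp
  qed
qed

lemma left_type_F: "left_type B (F B)"
  by (simp add: left_type_def Eset_F(1))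

text \<open>On such an eigenvector each factor of \<open>F C\<close> is 1 or 0 according to whether
  \<open>B\<close> and \<open>C\<close> agree on the pair, and agreement on all pairs means
  \<open>B = C\<close>.\<close>

lemma F_act_l:
  assumes "left_type B y" "B \<in> SP" "C \<in> SP"
  shows "F C \<otimes> y = (if B = C then y else \<zero>)"
proof -
  have y: "y \<in> carrier A" using assms(1) by (simp add: left_type_def)
  have "F C \<otimes> y = (if \<forall>p\<in>set (ipairs n (\<lambda>_ _. True)). same B (fst p) (snd p) = same C (fst p) (snd p)
    then y else \<zero>)"
    unfolding F_def
  proof (rule lprod_act_l[OF F_factor_closed y])
    fix p assume p: "p \<in> set (ipairs n (\<lambda>_ _. True))"
    obtain i j where [simp]: "p = (i, j)" by (cases p)
    have ij: "i \<in> {1..n}" "j \<in> {1..n}" "i \<noteq> j" "i < j" using p by (auto simp: set_ipairs)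
    have "Eset i j \<otimes> y = (if same B i j then y else \<zero>)"
      using assms(1) ij(1-3) unfolding left_type_def by blast
    then have E: "Eij i j \<otimes> y = (if same B i j then y else \<zero>)" "Eij i j \<in> carrier A"
      using ij Eset_closed[OF ij(1-3)] by (simp_all add: Eset_less)
    show "(case p of (i, j) \<Rightarrow> if same C i j then Eij i j else \<one> \<ominus> Eij i j) \<otimes> y =
      (if same B (fst p) (snd p) = same C (fst p) (snd p) then y else \<zero>)"
      using E y by (auto simp: minus_eq l_distr l_minus r_neg)
  qed
  moreover have "(\<forall>p\<in>set (ipairs n (\<lambda>_ _. True)). same B (fst p) (snd p) = same C (fst p) (snd p)) \<longleftrightarrow> B = C"
    using partition_eqI[of n B C] assms(2,3) by (auto simp: set_ipairs)
  ultimately show ?thesis by simp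
qed

lemma F_act_r:
  assumes "right_type B y" "B \<in> SP" "C \<in> SP"
  shows "y \<otimes> F C = (if B = C then y else \<zero>)"
proof -
  have y: "y \<in> carrier A" using assms(1) by (simp add: right_type_def)
  have "y \<otimes> F C = (if \<forall>p\<in>set (ipairs n (\<lambda>_ _. True)). same B (fst p) (snd p) = same C (fst p) (snd p)
    then y else \<zero>)"
    unfolding F_def
  proof (rule lprod_act_r[OF F_factor_closed y])
    fix p assume p: "p \<in> set (ipairs n (\<lambda>_ _. True))"
    obtain i j where [simp]: "p = (i, j)" by (cases p)
    have ij: "i \<in> {1..n}" "j \<in> {1..n}" "i \<noteq> j" "i < j" using p by (auto simp: set_ipairs)
    have "y \<otimes> Eset i j = (if same B i j then y else \<zero>)"
      using assms(1) ij(1-3) unfolding right_type_def by blast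
    then have E: "y \<otimes> Eij i j = (if same B i j then y else \<zero>)" "Eij i j \<in> carrier A"
      using ij Eset_closed[OF ij(1-3)] by (simp_all add: Eset_less)
    show "y \<otimes> (case p of (i, j) \<Rightarrow> if same C i j then Eij i j else \<one> \<ominus> Eij i j) =
      (if same B (fst p) (snd p) = same C (fst p) (snd p) then y else \<zero>)"
      using E y by (auto simp: minus_eq r_distr r_minus r_neg)
  qed
  moreover have "(\<forall>p\<in>set (ipairs n (\<lambda>_ _. True)). same B (fst p) (snd p) = same C (fst p) (snd p)) \<longleftrightarrow> B = C"
    using partition_eqI[of n B C] assms(2,3) by (auto simp: set_ipairs)
  ultimately show ?thesis by simp
qed

lemma F_mult_F: "B \<in> SP \<Longrightarrow> C \<in> SP \<Longrightarrow> F C \<otimes> F B = (if B = C then F B else \<zero>)"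
  by (rule F_act_l[OF left_type_F])

text \<open>Splitting \<open>y = E y + (1 - E) y\<close> for one \<open>E\<close> after the other decomposes \<open>\<one>\<close> into elements on
  which every \<open>E\<close> acts as \<open>0\<close> or \<open>1\<close>; such an element is zero or one of the \<open>F B\<close>, because
  the pairs whose \<open>E\<close> fixes it form an equivalence relation.\<close>

lemma one_in_lspan_F: "\<one> \<in> lspan (F ` SP)"
proof -
  \<comment> \<open>The second clause records how the pieces meet each \<open>F B\<close>: a nonzero
    piece that turns out to have the weight \<open>B\<close> is then forced to be \<open>F B\<close>
    itself, with coefficient one.\<close>
  define Y where "Y xs = {y \<in> carrier A. (\<forall>(i, j)\<in>set xs. Eij i j \<otimes> y = y \<or> Eij i j \<otimes> y = \<zero>) \<and>
    (\<forall>B\<in>SP. F B \<otimes> y = y \<otimes> F B \<and> (y \<otimes> F B = F B \<or> y \<otimes> F B = \<zero>))}" for xs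
  have "\<one> \<in> lspan (Y xs)" if "set xs \<subseteq> set (ipairs n (\<lambda>_ _. True))" for xs
    using that
  proof (induction xs)
    case Nil
    then show ?case by (intro lspan_base) (simp add: Y_def)
  next
    case (Cons p xs)
    obtain i j where p: "p = (i, j)" by (cases p)
    have ij: "1 \<le> i" "i < j" "j \<le> n" "i \<in> {1..n}" "j \<in> {1..n}" "i \<noteq> j"
      using Cons.prems by (auto simp: set_ipairs p)
    let ?E = "Eij i j"
    have E: "?E \<in> carrier A" "?E \<otimes> ?E = ?E"
      using ij Eset_idem[of i j] by (auto simp: Eset_less)
    have EF: "?E \<otimes> F B = F B \<or> ?E \<otimes> F B = \<zero>" "F B \<otimes> ?E = ?E \<otimes> F B" for B
      using Eset_F[OF ij(4-6), of B] ij by (simp_all add: Eset_less)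
    have "Y xs \<subseteq> lspan (Y (p # xs))"
    proof
      fix y assume y: "y \<in> Y xs"
      then have yc: "y \<in> carrier A" by (simp add: Y_def)
      have Ec: "?E \<otimes> y \<in> carrier A" using E yc by simp
      have Eq: "Eij k l \<in> carrier A" "Eij k l \<otimes> (?E \<otimes> y) = ?E \<otimes> (Eij k l \<otimes> y)"
        if "(k, l) \<in> set xs" for k l
      proof -
        have kl: "1 \<le> k" "k < l" "l \<le> n" using that Cons.prems by (auto simp: set_ipairs)
        then show c: "Eij k l \<in> carrier A" by simp
        have "Eij k l \<otimes> ?E = ?E \<otimes> Eij k l"
          using Eset_commute[of k l i j] kl ij by (simp add: Eset_less)
        then show "Eij k l \<otimes> (?E \<otimes> y) = ?E \<otimes> (Eij k l \<otimes> y)"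
          using c E yc by (simp add: m_assoc[symmetric])
      qed
      have yF: "F B \<otimes> y = y \<otimes> F B" "y \<otimes> F B = F B \<or> y \<otimes> F B = \<zero>" if "B \<in> SP" for B
        using y that by (auto simp: Y_def)
      have FEy: "F B \<otimes> (?E \<otimes> y) = (?E \<otimes> y) \<otimes> F B" if "B \<in> SP" for B
      proof -
        have "F B \<otimes> (?E \<otimes> y) = ?E \<otimes> (F B \<otimes> y)"
          using EF(2) E yc by (simp add: m_assoc[symmetric])
        then show ?thesis using yF(1)[OF that] E yc by (simp add: m_assoc)
      qed
      have EyF: "(?E \<otimes> y) \<otimes> F B = ?E \<otimes> (y \<otimes> F B)" for B
        using E yc by (simp add: m_assoc)
      have 1: "?E \<otimes> y \<in> Y (p # xs)"
        unfolding Y_def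
      proof (intro CollectI conjI ballI)
        fix r assume r: "r \<in> set (p # xs)"
        obtain k l where rkl: "r = (k, l)" by (cases r)
        have "Eij k l \<otimes> (?E \<otimes> y) = ?E \<otimes> y \<or> Eij k l \<otimes> (?E \<otimes> y) = \<zero>"
        proof (cases "(k, l) \<in> set xs")
          case True
          then have "Eij k l \<otimes> y = y \<or> Eij k l \<otimes> y = \<zero>" using y by (auto simp: Y_def)
          then show ?thesis using Eq(2)[OF True] E(1) by auto
        next
          case False
          then have "k = i" "l = j" using r rkl p by auto
          then show ?thesis using E yc by (simp add: m_assoc[symmetric])
        qed
        then show "case r of (i', j') \<Rightarrow> Eij i' j' \<otimes> (?E \<otimes> y) = ?E \<otimes> y \<or> Eij i' j' \<otimes> (?E \<otimes> y) = \<zero>"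
          by (simp add: rkl)
      next
        fix B assume B: "B \<in> SP"
        show "F B \<otimes> (?E \<otimes> y) = (?E \<otimes> y) \<otimes> F B" by (rule FEy[OF B])
        show "(?E \<otimes> y) \<otimes> F B = F B \<or> (?E \<otimes> y) \<otimes> F B = \<zero>"
          using yF(2)[OF B] EF(1)[of B] E(1) by (auto simp: EyF)
      qed (rule Ec)
      have 2: "y \<ominus> ?E \<otimes> y \<in> Y (p # xs)"
        unfolding Y_def
      proof (intro CollectI conjI ballI)
        fix r assume r: "r \<in> set (p # xs)"
        obtain k l where rkl: "r = (k, l)" by (cases r)
        have "Eij k l \<otimes> (y \<ominus> ?E \<otimes> y) = y \<ominus> ?E \<otimes> y \<or> Eij k l \<otimes> (y \<ominus> ?E \<otimes> y) = \<zero>"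
        proof (cases "(k, l) \<in> set xs")
          case True
          then have "Eij k l \<otimes> y = y \<or> Eij k l \<otimes> y = \<zero>" using y by (auto simp: Y_def)
          then show ?thesis using Eq[OF True] E(1) yc Ec by (auto simp: minus_eq r_distr r_minus)
        next
          case False
          then have "k = i" "l = j" using r rkl p by auto
          moreover have "?E \<otimes> (?E \<otimes> y) = ?E \<otimes> y" using E yc by (simp add: m_assoc[symmetric])
          ultimately show ?thesis using E yc Ec by (simp add: minus_eq r_distr r_minus r_neg)
        qed
        then show "case r of (i', j') \<Rightarrow> Eij i' j' \<otimes> (y \<ominus> ?E \<otimes> y) = y \<ominus> ?E \<otimes> y \<or> Eij i' j' \<otimes> (y \<ominus> ?E \<otimes> y) = \<zero>"
          by (simp add: rkl)
      next
        fix B assume B: "B \<in> SP"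
        show "F B \<otimes> (y \<ominus> ?E \<otimes> y) = (y \<ominus> ?E \<otimes> y) \<otimes> F B"
          using FEy[OF B] yF(1)[OF B] yc Ec by (simp add: minus_eq r_distr l_distr r_minus l_minus)
        have "(y \<ominus> ?E \<otimes> y) \<otimes> F B = y \<otimes> F B \<ominus> ?E \<otimes> (y \<otimes> F B)"
          using yc Ec EyF[of B] by (simp add: minus_eq l_distr l_minus)
        then show "(y \<ominus> ?E \<otimes> y) \<otimes> F B = F B \<or> (y \<ominus> ?E \<otimes> y) \<otimes> F B = \<zero>"
          using yF(2)[OF B] EF(1)[of B] E(1) by (auto simp: minus_eq r_neg)
      qed (use yc Ec in simp)
      have "y = ?E \<otimes> y \<oplus> (y \<ominus> ?E \<otimes> y)" using yc Ec by (simp add: minus_eq a_lcomm[of "?E \<otimes> y" y] r_neg)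
      then show "y \<in> lspan (Y (p # xs))" using 1 2 lspan_add lspan_base by metis
    qed
    then show ?case using Cons lspan_mono by simp
  qed
  then have "\<one> \<in> lspan (Y (ipairs n (\<lambda>_ _. True)))" by simp
  moreover have "Y (ipairs n (\<lambda>_ _. True)) \<subseteq> lspan (F ` SP)"
  proof
    fix y assume y: "y \<in> Y (ipairs n (\<lambda>_ _. True))"
    then have yc: "y \<in> carrier A" by (simp add: Y_def)
    have Ey: "Eset i j \<otimes> y = y \<or> Eset i j \<otimes> y = \<zero>" if "i \<in> {1..n}" "j \<in> {1..n}" "i \<noteq> j" for i j
    proof (cases "i < j")
      case True
      then have "(i, j) \<in> set (ipairs n (\<lambda>_ _. True))" using that by (simp add: set_ipairs)
      then show ?thesis using y True by (auto simp: Y_def Eset_less)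
    next
      case False
      then have "j < i" "(j, i) \<in> set (ipairs n (\<lambda>_ _. True))" using that by (simp_all add: set_ipairs)
      then show ?thesis using y Eset_sym[of i j] by (auto simp: Y_def Eset_less)
    qed
    show "y \<in> lspan (F ` SP)"
    proof (cases "y = \<zero>")
      case True
      then show ?thesis by (simp add: lspan_zero)
    next
      case False
      \<comment> \<open>The diagonal is added by hand, as \<open>Eset i i\<close> carries no
        meaning.\<close>
      define T where "T i j \<longleftrightarrow> i \<in> {1..n} \<and> j \<in> {1..n} \<and> (i = j \<or> Eset i j \<otimes> y = y)" for i j
      have "T i k" if "T i j" "T j k" for i j k
      proof (cases "i = j \<or> j = k \<or> i = k")
        case True
        then show ?thesis using that by (auto simp: T_def)
      next
        case d: False
        have r: "i \<in> {1..n}" "j \<in> {1..n}" "k \<in> {1..n}" "i \<noteq> j" "j \<noteq> k" "i \<noteq> k"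
          using d that unfolding T_def by blast+
        have cl: "Eset i j \<in> carrier A" "Eset j k \<in> carrier A" "Eset i k \<in> carrier A"
          using r by (metis Eset_closed)+
        have Ty: "Eset i j \<otimes> y = y" "Eset j k \<otimes> y = y" using that r unfolding T_def by blast+
        \<comment> \<open>By \<open>Eset_triple\<close> this product already contains
          \<open>Eset i k\<close>; if \<open>Eset i k\<close> annihilated \<open>y\<close>, then
          \<open>y\<close> would be zero.\<close>
        have "y = (Eset i j \<otimes> Eset j k) \<otimes> y" using cl yc Ty by (simp add: m_assoc)
        also have "\<dots> = (Eset i j \<otimes> Eset j k \<otimes> Eset i k) \<otimes> y" by (simp only: Eset_triple(2)[OF r])
        also have "\<dots> = (Eset i j \<otimes> Eset j k) \<otimes> (Eset i k \<otimes> y)"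
          using cl yc by (intro m_assoc) auto
        finally have "Eset i k \<otimes> y \<noteq> \<zero>" using False cl by auto
        then show ?thesis using Ey r unfolding T_def by blast
      qed
      moreover have "T j i" if "T i j" for i j using that Eset_sym[of i j] by (auto simp: T_def)
      moreover have "i \<in> {1..n} \<and> j \<in> {1..n}" if "T i j" for i j using that unfolding T_def by blast
      moreover have "T i i" if "i \<in> {1..n}" for i using that unfolding T_def by blast
      ultimately have "\<exists>B. partition_on {1..n} B \<and> (\<forall>i j. same B i j \<longleftrightarrow> T i j)"
        by (intro ex_partition)
      then obtain B where B: "partition_on {1..n} B" "\<And>i j. same B i j \<longleftrightarrow> T i j" by blast
      have "left_type B y"
        unfolding left_type_def
      proof (intro conjI ballI impI)
        fix i j assume r: "i \<in> {1..n}" "j \<in> {1..n}" "i \<noteq> j"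
        show "Eset i j \<otimes> y = (if same B i j then y else \<zero>)"
          using Ey[OF r] r False unfolding B(2) T_def by auto
      qed (rule yc)
      then have "F B \<otimes> y = y" using F_act_l[of B y B] B by simp
      moreover have "F B \<otimes> y = F B \<or> F B \<otimes> y = \<zero>" using y B by (auto simp: Y_def)
      ultimately have "y = F B" using False by auto
      then show ?thesis using B by (auto intro: lspan_base)
    qed
  qed
  ultimately show ?thesis using lspan_mono by blast
qed

text \<open>The unit lies in the span of the \<open>F B\<close>, so an element is determined by its
  products with them. Identities between idempotents are tested in this way below.\<close>

lemma F_ext:
  assumes "x \<in> carrier A" "y \<in> carrier A" "\<And>B. B \<in> SP \<Longrightarrow> x \<otimes> F B = y \<otimes> F B"
  shows "x = y"
proof -
  have "s \<in> carrier A \<and> x \<otimes> s = y \<otimes> s" if "s \<in> lspan (F ` SP)" for s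
    using that
  proof induction
    case (lspan_add s t)
    then show ?case using assms by (simp add: r_distr)
  qed (use assms in \<open>auto simp: smult_mult_r\<close>)
  from this[OF one_in_lspan_F] show ?thesis using assms by simp
qed

lemma swp_SP: "B \<in> SP \<Longrightarrow> 1 \<le> k \<Longrightarrow> k < n \<Longrightarrow> swp k B \<in> SP"
  using partition_swp by blast

text \<open>Both sides equal the product of \<open>F (swp k B)\<close>, \<open>g k\<close> and
  \<open>F B\<close>: moving an E_{ij} through \<open>g k\<close> exchanges its indices, so
  \<open>g k\<close> takes the weight \<open>B\<close> to the weight \<open>swp k B\<close>.\<close>

lemma g_F:
  assumes k: "1 \<le> k" "k < n" and B: "B \<in> SP"
  shows "g k \<otimes> F B = F (swp k B) \<otimes> g k"
proof -
  have gc: "g k \<in> carrier A" using k by simp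
  have s: "sw k i \<in> {1..n}" if "i \<in> {1..n}" for i
    using that permutes_in_image[OF sw_permutes[OF k]] by blast
  have "left_type (swp k B) (g k \<otimes> F B)"
    unfolding left_type_def
  proof (intro conjI ballI impI)
    fix i j assume ij: "i \<in> {1..n}" "j \<in> {1..n}" "i \<noteq> j"
    have sij: "sw k i \<in> {1..n}" "sw k j \<in> {1..n}" "sw k i \<noteq> sw k j"
      using s ij permutes_neq[OF sw_permutes[OF k] ij(3)] by blast+
    have c: "Eset i j \<in> carrier A" "Eset (sw k i) (sw k j) \<in> carrier A"
      by (intro Eset_closed ij sij)+
    have "Eset i j \<otimes> (g k \<otimes> F B) = (Eset i j \<otimes> g k) \<otimes> F B" using c gc by (simp add: m_assoc)
    also have "Eset i j \<otimes> g k = g k \<otimes> Eset (sw k i) (sw k j)" using g_Eset[OF k sij] by simp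
    also have "\<dots> \<otimes> F B = g k \<otimes> (Eset (sw k i) (sw k j) \<otimes> F B)" using c gc by (simp add: m_assoc)
    also have "\<dots> = (if same (swp k B) i j then g k \<otimes> F B else \<zero>)"
      using gc by (simp add: Eset_F(1)[OF sij] same_swp)
    finally show "Eset i j \<otimes> (g k \<otimes> F B) = (if same (swp k B) i j then g k \<otimes> F B else \<zero>)" .
  qed (use gc in simp)
  then have 1: "F (swp k B) \<otimes> (g k \<otimes> F B) = g k \<otimes> F B"
    using F_act_l[of "swp k B" _ "swp k B"] swp_SP[OF B k] by simp
  have "right_type B (F (swp k B) \<otimes> g k)"
    unfolding right_type_def
  proof (intro conjI ballI impI)
    fix i j assume ij: "i \<in> {1..n}" "j \<in> {1..n}" "i \<noteq> j"
    have sij: "sw k i \<in> {1..n}" "sw k j \<in> {1..n}" "sw k i \<noteq> sw k j"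
      using s ij permutes_neq[OF sw_permutes[OF k] ij(3)] by blast+
    have c: "Eset i j \<in> carrier A" "Eset (sw k i) (sw k j) \<in> carrier A"
      by (intro Eset_closed ij sij)+
    have "(F (swp k B) \<otimes> g k) \<otimes> Eset i j = F (swp k B) \<otimes> (g k \<otimes> Eset i j)" using c gc by (simp add: m_assoc)
    also have "\<dots> = (F (swp k B) \<otimes> Eset (sw k i) (sw k j)) \<otimes> g k"
      using g_Eset[OF k ij] c gc by (simp add: m_assoc)
    also have "\<dots> = (if same B i j then F (swp k B) \<otimes> g k else \<zero>)"
      using gc by (simp add: Eset_F[OF sij] same_swp)
    finally show "(F (swp k B) \<otimes> g k) \<otimes> Eset i j = (if same B i j then F (swp k B) \<otimes> g k else \<zero>)" .
  qed (use gc in simp)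
  then have 2: "(F (swp k B) \<otimes> g k) \<otimes> F B = F (swp k B) \<otimes> g k"
    using F_act_r[of B _ B] B by simp
  show ?thesis using 1 2 gc by (simp add: m_assoc)
qed

lemma e_F:
  assumes "1 \<le> i" "i < n"
  shows "e i \<otimes> F B = (if same B i (Suc i) then F B else \<zero>)" "F B \<otimes> e i = e i \<otimes> F B"
  using Eset_F[of i "Suc i" B] assms by (simp_all add: Eset_less Eij_Suc)

text \<open>From here to \<open>idem\<close> the definitions of the theorem are repeated in the
  locale; \<open>idem_eq\<close> identifies them in the concrete algebra.\<close>

definition E_partition :: "nat set set \<Rightarrow> 'a"
  where "E_partition B = lprod (\<lambda>(i, j). Eij i j) (ipairs n (same B))"

definition idem_partition :: "nat set set \<Rightarrow> 'a"
  where "idem_partition B =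
    (\<Oplus>C\<in>{C. refines {1..n} B C}. add_pow A (moebius n B C) (E_partition C))"

definition idem :: "nat list \<Rightarrow> 'a"
  where "idem \<alpha> = finsum A idem_partition {B. partition_on {1..n} B \<and> has_type B \<alpha>}"

lemma E_partition_closed [simp]: "E_partition B \<in> carrier A"
  unfolding E_partition_def by (rule lprod_closed) (auto simp: set_ipairs)

lemma E_partition_F:
  assumes "B \<in> SP" "C \<in> SP"
  shows "E_partition B \<otimes> F C = (if refines {1..n} B C then F C else \<zero>)"
proof -
  have "E_partition B \<otimes> F C =
    (if \<forall>p\<in>set (ipairs n (same B)). same C (fst p) (snd p) then F C else \<zero>)"
    unfolding E_partition_def
  proof (rule lprod_act_l)
    fix p assume p: "p \<in> set (ipairs n (same B))"
    then show "(case p of (i, j) \<Rightarrow> Eij i j) \<in> carrier A" by (auto simp: set_ipairs)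
    show "(case p of (i, j) \<Rightarrow> Eij i j) \<otimes> F C = (if same C (fst p) (snd p) then F C else \<zero>)"
      using p Eset_F(1)[of "fst p" "snd p" C] by (auto simp: set_ipairs Eset_less)
  qed simp
  moreover have "(\<forall>p\<in>set (ipairs n (same B)). same C (fst p) (snd p)) \<longleftrightarrow> refines {1..n} B C"
    using refines_iff_same[of "{1..n}" B C] same_le_iff[of n B C] assms by (auto simp: set_ipairs)
  ultimately show ?thesis by simp
qed

text \<open>Tested against \<open>F D\<close>: by \<open>E_partition_F\<close> the elements
  \<open>E_partition C\<close> act on it by the zeta function of the refinement order, so the
  Moebius sum is 1 for \<open>D = B\<close> and 0 otherwise, just as for \<open>F B\<close>.\<close>

lemma idem_partition_F:
  assumes B: "B \<in> SP"
  shows "idem_partition B = F B"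
proof (rule F_ext)
  let ?S = "{C. refines {1..n} B C}"
  have fin: "finite ?S"
    by (rule finite_subset[OF _ finite_set_partitions[of n]]) (auto simp: refines_def)
  show cl: "idem_partition B \<in> carrier A"
    unfolding idem_partition_def by (intro finsum_closed) simp
  fix D assume D: "D \<in> SP"
  have "idem_partition B \<otimes> F D = (\<Oplus>C\<in>?S. add_pow A (moebius n B C) (E_partition C) \<otimes> F D)"
    unfolding idem_partition_def using fin by (intro finsum_ldistr) auto
  also have "\<dots> = (\<Oplus>C\<in>?S. add_pow A (if refines {1..n} C D then moebius n B C else 0) (F D))"
  proof (rule add.finprod_cong')
    fix C assume C: "C \<in> ?S"
    then have "C \<in> SP" by (simp add: refines_def)
    then show "add_pow A (moebius n B C) (E_partition C) \<otimes> F D =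
      add_pow A (if refines {1..n} C D then moebius n B C else 0) (F D)"
      using D by (simp add: add_pow_ldistr_int E_partition_F add_pow_int_ge)
  qed auto
  also have "\<dots> = add_pow A (\<Sum>C\<in>?S. if refines {1..n} C D then moebius n B C else 0) (F D)"
    by (rule finsum_add_pow_int[OF fin F_closed])
  also have "(\<Sum>C\<in>?S. if refines {1..n} C D then moebius n B C else 0) =
    (\<Sum>C\<in>{C. refines {1..n} B C \<and> refines {1..n} C D}. moebius n B C)"
    using fin by (simp add: sum.If_cases Collect_conj_eq)
  also have "\<dots> = (if B = D then 1 else 0)" using B by (intro moebius_sum) simp
  finally show "idem_partition B \<otimes> F D = F B \<otimes> F D"
    using F_mult_F[of D B] B D by (auto simp: add_pow_int_ge)
qed simp

abbreviation SPt :: "nat list \<Rightarrow> nat set set set"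
  where "SPt \<alpha> \<equiv> {B. partition_on {1..n} B \<and> has_type B \<alpha>}"

lemma idem_closed [simp]: "idem \<alpha> \<in> carrier A"
  unfolding idem_def using idem_partition_F by (intro finsum_closed) auto

lemma idem_mult_F:
  assumes D: "D \<in> SP"
  shows "idem \<alpha> \<otimes> F D = (if has_type D \<alpha> then F D else \<zero>)"
proof -
  have fin: "finite (SPt \<alpha>)"
    by (rule finite_subset[OF _ finite_set_partitions[of n]]) auto
  have "idem \<alpha> = finsum A F (SPt \<alpha>)"
    unfolding idem_def using idem_partition_F by (intro add.finprod_cong') auto
  then have "idem \<alpha> \<otimes> F D = (\<Oplus>B\<in>SPt \<alpha>. F B \<otimes> F D)"
    using fin by (simp add: finsum_ldistr)
  also have "\<dots> = (\<Oplus>B\<in>SPt \<alpha>. if D = B then F B else \<zero>)"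
    using F_mult_F D by (intro add.finprod_cong') auto
  also have "\<dots> = (if has_type D \<alpha> then F D else \<zero>)"
  proof (cases "has_type D \<alpha>")
    case True
    then show ?thesis using D fin by (simp add: add.finprod_singleton)
  next
    case False
    then show ?thesis by (intro add.finprod_one_eqI[THEN trans]) auto
  qed
  finally show ?thesis .
qed

text \<open>Conjugation by \<open>g k\<close> permutes the \<open>F B\<close> through
  \<open>swp k\<close>, which preserves the type, and \<open>e k\<close> acts on \<open>F B\<close>
  by 0 or 1. Hence both commute with the sum over a type.\<close>

lemma idem_central:
  assumes "x \<in> carrier A"
  shows "x \<otimes> idem \<alpha> = idem \<alpha> \<otimes> x"
proof -
  have g: "idem \<alpha> \<otimes> g k = g k \<otimes> idem \<alpha>" if k: "1 \<le> k" "k < n" for k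
  proof (rule F_ext)
    fix B assume B: "B \<in> SP"
    have gc: "g k \<in> carrier A" using k by simp
    have "(idem \<alpha> \<otimes> g k) \<otimes> F B = (idem \<alpha> \<otimes> F (swp k B)) \<otimes> g k"
      using g_F[OF k B] gc by (simp add: m_assoc)
    also have "\<dots> = (if has_type B \<alpha> then F (swp k B) \<otimes> g k else \<zero>)"
      using gc by (simp add: idem_mult_F[OF swp_SP[OF B k]] has_type_swp)
    also have "\<dots> = (g k \<otimes> idem \<alpha>) \<otimes> F B"
      using gc by (simp add: m_assoc idem_mult_F[OF B] g_F[OF k B])
    finally show "(idem \<alpha> \<otimes> g k) \<otimes> F B = (g k \<otimes> idem \<alpha>) \<otimes> F B" .
  qed (use k in auto)
  have e: "idem \<alpha> \<otimes> e k = e k \<otimes> idem \<alpha>" if k: "1 \<le> k" "k < n" for k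
  proof (rule F_ext)
    fix B assume B: "B \<in> SP"
    have ec: "e k \<in> carrier A" using k by simp
    then show "(idem \<alpha> \<otimes> e k) \<otimes> F B = (e k \<otimes> idem \<alpha>) \<otimes> F B"
      by (simp add: m_assoc idem_mult_F[OF B] e_F[OF k])
  qed (use k in auto)
  have "idem \<alpha> \<otimes> x = x \<otimes> idem \<alpha>"
    using assms
  proof (induction rule: bt_generation_induct)
    case (gen_g x i)
    then have c: "g i \<in> carrier A" by simp
    have "idem \<alpha> \<otimes> (g i \<otimes> x) = (idem \<alpha> \<otimes> g i) \<otimes> x" using gen_g c by (simp add: m_assoc)
    also have "\<dots> = g i \<otimes> (idem \<alpha> \<otimes> x)" using gen_g c g by (simp add: m_assoc)
    finally show ?case using gen_g c by (simp add: m_assoc)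
  next
    case (gen_e x i)
    then have c: "e i \<in> carrier A" by simp
    have "idem \<alpha> \<otimes> (e i \<otimes> x) = (idem \<alpha> \<otimes> e i) \<otimes> x" using gen_e c by (simp add: m_assoc)
    also have "\<dots> = e i \<otimes> (idem \<alpha> \<otimes> x)" using gen_e c e by (simp add: m_assoc)
    finally show ?case using gen_e c by (simp add: m_assoc)
  qed (simp_all add: l_distr r_distr smult_mult_l smult_mult_r)
  then show ?thesis by simp
qed

lemma idem_idem: "idem \<alpha> \<otimes> idem \<alpha> = idem \<alpha>"
  by (rule F_ext) (auto simp: m_assoc idem_mult_F)

sublocale idem: central_idempotent A "idem \<alpha>" for \<alpha>
  by unfold_locales (simp_all add: idem_idem idem_central)

end

section \<open>The elements attached to permutations\<close>

context bt
begin

text \<open>A relation, because a permutation has many reduced expressions; that they all give one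
  element is Matsumoto's theorem, proved in \<open>is_T_unique\<close>. The transposition composed
  last becomes the first factor, so products appear in reverse order, as suits a right
  action.\<close>

inductive is_T :: "(nat \<Rightarrow> nat) \<Rightarrow> 'a \<Rightarrow> bool"
  where
    is_T_id: "is_T id \<one>"
  | is_T_swap: "is_T w x \<Longrightarrow> 1 \<le> i \<Longrightarrow> i < n \<Longrightarrow> w i < w (Suc i) \<Longrightarrow> is_T (w \<circ> sw i) (g i \<otimes> x)"

lemma is_T_props: "is_T w x \<Longrightarrow> w permutes {1..n} \<and> x \<in> carrier A"
proof (induction rule: is_T.induct)
  case (is_T_swap w x i)
  then show ?case using comp_sw_permutes[of w n i] g_closed[of i] by blast
next
  case is_T_id
  show ?case using permutes_id one_closed by (simp only: simp_thms)
qed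

lemma ex_is_T: "w permutes {1..n} \<Longrightarrow> \<exists>x. is_T w x"
  by (induction rule: permutes_adjacent_induct) (blast intro: is_T.intros)+

lemma is_T_step:
  assumes "is_T (w \<circ> sw i) x" "1 \<le> i" "i < n" "w (Suc i) < w i"
  shows "is_T w (g i \<otimes> x)"
proof -
  have "is_T (w \<circ> sw i \<circ> sw i) (g i \<otimes> x)"
    using assms by (intro is_T_swap) auto
  then show ?thesis by simp
qed

text \<open>Two reduced expressions that start with \<open>i\<close> and \<open>j\<close> are compared with one that starts
  with the longest element of the subgroup generated by \<open>sw i\<close> and \<open>sw j\<close>.\<close>

lemma is_T_unique: "is_T w x \<Longrightarrow> is_T w y \<Longrightarrow> x = y"
proof (induction "inversions n w" arbitrary: w x y rule: less_induct)
  case less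
  have w: "w permutes {1..n}" using is_T_props[OF less.prems(1)] by blast
  have cases: "(w = id \<and> z = \<one>) \<or> (\<exists>i z'. z = g i \<otimes> z' \<and> 1 \<le> i \<and> i < n \<and> w (Suc i) < w i \<and> is_T (w \<circ> sw i) z')"
    if z: "is_T w z" for z
    using z
  proof cases
    case is_T_id
    then show ?thesis by blast
  next
    case (is_T_swap v z' i)
    have v: "v = w \<circ> sw i" using is_T_swap(1) by simp
    show ?thesis using is_T_swap unfolding v by auto
  qed
  have IH: "a = b" if "is_T (w \<circ> sw i) a" "is_T (w \<circ> sw i) b" "1 \<le> i" "i < n" "w (Suc i) < w i" for i a b
  proof -
    have "inversions n (w \<circ> sw i \<circ> sw i) = Suc (inversions n (w \<circ> sw i))"
      by (rule inversions_comp_sw) (use that in auto)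
    then have "inversions n (w \<circ> sw i) < inversions n w" by simp
    then show ?thesis using that(1,2) by (rule less.hyps)
  qed
  have adj: "g i \<otimes> x' = g (Suc i) \<otimes> y'"
    if i: "1 \<le> i" "Suc i < n" "w (Suc i) < w i" "w (Suc (Suc i)) < w (Suc i)"
      and x': "is_T (w \<circ> sw i) x'" and y': "is_T (w \<circ> sw (Suc i)) y'" for i x' y'
  proof -
    let ?j = "Suc i"
    let ?u = "w \<circ> sw i \<circ> sw ?j \<circ> sw i"
    have "?u permutes {1..n}" using w i by (intro comp_sw_permutes) auto
    then obtain z where z: "is_T ?u z" using ex_is_T by blast
    have zc: "z \<in> carrier A" "g i \<in> carrier A" "g ?j \<in> carrier A" using is_T_props[OF z] i by auto
    have "is_T (w \<circ> sw i \<circ> sw ?j) (g i \<otimes> z)"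
      by (rule is_T_step[OF z]) (use i in \<open>auto simp: transpose_def\<close>)
    then have "is_T (w \<circ> sw i) (g ?j \<otimes> (g i \<otimes> z))"
      by (rule is_T_step) (use i in \<open>auto simp: transpose_def\<close>)
    then have 1: "x' = g ?j \<otimes> (g i \<otimes> z)" using IH x' i by simp
    have z2: "is_T (w \<circ> sw ?j \<circ> sw i \<circ> sw ?j) z" using z by (simp only: sw_braid)
    have "is_T (w \<circ> sw ?j \<circ> sw i) (g ?j \<otimes> z)"
      by (rule is_T_step[OF z2]) (use i in \<open>auto simp: transpose_def\<close>)
    then have "is_T (w \<circ> sw ?j) (g i \<otimes> (g ?j \<otimes> z))"
      by (rule is_T_step) (use i in \<open>auto simp: transpose_def\<close>)
    then have 2: "y' = g i \<otimes> (g ?j \<otimes> z)" using IH y' i by simp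
    have "g i \<otimes> x' = (g i \<otimes> g ?j \<otimes> g i) \<otimes> z" unfolding 1 using zc by (simp add: m_assoc)
    also have "\<dots> = (g ?j \<otimes> g i \<otimes> g ?j) \<otimes> z" using braid[of i ?j] i by simp
    also have "\<dots> = g ?j \<otimes> y'" unfolding 2 using zc by (simp add: m_assoc)
    finally show ?thesis .
  qed
  have far: "g i \<otimes> x' = g j \<otimes> y'"
    if i: "1 \<le> i" "i < n" "w (Suc i) < w i" and j: "1 \<le> j" "j < n" "w (Suc j) < w j" and ij: "distant i j"
      and x': "is_T (w \<circ> sw i) x'" and y': "is_T (w \<circ> sw j) y'" for i j x' y'
  proof -
    let ?u = "w \<circ> sw i \<circ> sw j"
    have "?u permutes {1..n}" using w i j by (intro comp_sw_permutes) auto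
    then obtain z where z: "is_T ?u z" using ex_is_T by blast
    have zc: "z \<in> carrier A" "g i \<in> carrier A" "g j \<in> carrier A" using is_T_props[OF z] i j by auto
    have "is_T (w \<circ> sw i) (g j \<otimes> z)"
      by (rule is_T_step[OF z]) (use i j ij in \<open>auto simp: transpose_def\<close>)
    then have 1: "x' = g j \<otimes> z" using IH x' i by simp
    have z2: "is_T (w \<circ> sw j \<circ> sw i) z" using z by (simp only: sw_commute[OF ij])
    have "is_T (w \<circ> sw j) (g i \<otimes> z)"
      by (rule is_T_step[OF z2]) (use i j ij in \<open>auto simp: transpose_def\<close>)
    then have 2: "y' = g i \<otimes> z" using IH y' j by simp
    have "g i \<otimes> x' = (g i \<otimes> g j) \<otimes> z" unfolding 1 using zc by (simp add: m_assoc)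
    also have "\<dots> = (g j \<otimes> g i) \<otimes> z" using gg_distant[of i j] i j ij by simp
    also have "\<dots> = g j \<otimes> y'" unfolding 2 using zc by (simp add: m_assoc)
    finally show ?thesis .
  qed
  show ?case
  proof (cases "w = id")
    case True
    then have "\<not> w (Suc i) < w i" for i by simp
    then show ?thesis using cases[OF less.prems(1)] cases[OF less.prems(2)] by blast
  next
    case False
    obtain i x' where i: "x = g i \<otimes> x'" "1 \<le> i" "i < n" "w (Suc i) < w i" "is_T (w \<circ> sw i) x'"
      using cases[OF less.prems(1)] False by blast
    obtain j y' where j: "y = g j \<otimes> y'" "1 \<le> j" "j < n" "w (Suc j) < w j" "is_T (w \<circ> sw j) y'"
      using cases[OF less.prems(2)] False by blast
    consider "i = j" | "j = Suc i" | "i = Suc j" | "distant i j" by linarith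
    then show ?thesis
    proof cases
      case 1
      then show ?thesis using IH i j by blast
    next
      case 2
      then show ?thesis using adj[of i x' y'] i j by simp
    next
      case 3
      then show ?thesis using adj[of j y' x'] i j by simp
    next
      case 4
      then show ?thesis using far i j by simp
    qed
  qed
qed

definition T :: "(nat \<Rightarrow> nat) \<Rightarrow> 'a"
  where "T w = (THE x. is_T w x)"

lemma is_T_T: "w permutes {1..n} \<Longrightarrow> is_T w (T w)"
  unfolding T_def using ex_is_T is_T_unique by (metis theI)

lemma T_eqI: "is_T w x \<Longrightarrow> T w = x"
  using is_T_T is_T_unique is_T_props by blast

lemma T_closed [simp]: "w permutes {1..n} \<Longrightarrow> T w \<in> carrier A"
  using is_T_T is_T_props by blast

lemma T_id: "T id = \<one>"
  by (rule T_eqI[OF is_T_id])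

lemma T_ascent:
  assumes "w permutes {1..n}" "1 \<le> i" "i < n" "w i < w (Suc i)"
  shows "T (w \<circ> sw i) = g i \<otimes> T w"
  by (rule T_eqI[OF is_T_swap[OF is_T_T]]) (use assms in auto)

lemma T_descent:
  assumes w: "w permutes {1..n}" and i: "1 \<le> i" "i < n" and d: "w (Suc i) < w i"
  shows "T w = g i \<otimes> T (w \<circ> sw i)"
  using T_ascent[OF comp_sw_permutes[OF w i] i] d by simp

lemma g_T_descent:
  assumes w: "w permutes {1..n}" and i: "1 \<le> i" "i < n" and d: "w (Suc i) < w i"
  shows "g i \<otimes> T w = T (w \<circ> sw i) \<oplus> ((q_pow 1 - q_pow (-1)) \<odot> (e i \<otimes> T w))"
proof -
  let ?x = "T (w \<circ> sw i)"
  have cl: "g i \<in> carrier A" "e i \<in> carrier A" "?x \<in> carrier A" "T w \<in> carrier A"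
    using w i comp_sw_permutes[OF w i] by auto
  have "g i \<otimes> T w = (g i \<otimes> g i) \<otimes> ?x" unfolding T_descent[OF assms] using cl by (simp add: m_assoc)
  also have "\<dots> = ?x \<oplus> ((q_pow 1 - q_pow (-1)) \<odot> (e i \<otimes> (g i \<otimes> ?x)))"
    unfolding g_square[OF i] using cl by (simp add: l_distr smult_mult_l m_assoc)
  finally show ?thesis unfolding T_descent[OF assms, symmetric] .
qed

section \<open>Left multiplication by generators on the spanning elements\<close>

definition FT :: "nat set set \<Rightarrow> (nat \<Rightarrow> nat) \<Rightarrow> 'a"
  where "FT B w = F B \<otimes> T w"

lemma FT_closed [simp]: "w permutes {1..n} \<Longrightarrow> FT B w \<in> carrier A"
  by (simp add: FT_def)

lemma e_FT:
  assumes "w permutes {1..n}" "1 \<le> i" "i < n"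
  shows "e i \<otimes> FT B w = (if same B i (Suc i) then FT B w else \<zero>)"
proof -
  have cl: "e i \<in> carrier A" "T w \<in> carrier A" using assms by auto
  have "e i \<otimes> FT B w = (e i \<otimes> F B) \<otimes> T w" unfolding FT_def using cl by (simp add: m_assoc)
  then show ?thesis using e_F(1)[OF assms(2,3), of B] cl by (simp add: FT_def)
qed

text \<open>At a descent the quadratic relation produces a correction with the factor
  \<open>e i\<close>. On \<open>F (swp i B)\<close> it survives only if \<open>i\<close> and
  \<open>Suc i\<close> share a block, and then \<open>swp i B = B\<close>.\<close>

lemma g_FT:
  assumes w: "w permutes {1..n}" and i: "1 \<le> i" "i < n" and B: "B \<in> SP"
  shows "w i < w (Suc i) \<Longrightarrow> g i \<otimes> FT B w = FT (swp i B) (w \<circ> sw i)"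
    and "\<not> same B i (Suc i) \<Longrightarrow> g i \<otimes> FT B w = FT (swp i B) (w \<circ> sw i)"
    and "same B i (Suc i) \<Longrightarrow> w (Suc i) < w i
      \<Longrightarrow> g i \<otimes> FT B w = FT B (w \<circ> sw i) \<oplus> ((q_pow 1 - q_pow (-1)) \<odot> FT B w)"
proof -
  have ws: "w \<circ> sw i permutes {1..n}" by (rule comp_sw_permutes[OF w i])
  have cl: "g i \<in> carrier A" "T w \<in> carrier A" "T (w \<circ> sw i) \<in> carrier A" "e i \<in> carrier A"
    using w ws i by auto
  have gF: "g i \<otimes> FT B w = F (swp i B) \<otimes> (g i \<otimes> T w)"
    unfolding FT_def using cl g_F[OF i B] by (simp add: m_assoc[symmetric])
  show 1: "g i \<otimes> FT B w = FT (swp i B) (w \<circ> sw i)" if "w i < w (Suc i)"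
    using T_ascent[OF w i that] unfolding gF by (simp add: FT_def)
  have desc: "g i \<otimes> FT B w = FT (swp i B) (w \<circ> sw i) \<oplus>
    ((q_pow 1 - q_pow (-1)) \<odot> (if same (swp i B) i (Suc i) then FT (swp i B) w else \<zero>))"
    if d: "w (Suc i) < w i"
  proof -
    have "F (swp i B) \<otimes> (e i \<otimes> T w) = e i \<otimes> FT (swp i B) w"
      unfolding FT_def using cl e_F(2)[OF i, of "swp i B"] by (simp add: m_assoc[symmetric])
    then have Fe: "F (swp i B) \<otimes> (e i \<otimes> T w) = (if same (swp i B) i (Suc i) then FT (swp i B) w else \<zero>)"
      using e_FT[OF w i, of "swp i B"] by simp
    have "g i \<otimes> FT B w = F (swp i B) \<otimes> T (w \<circ> sw i) \<oplus>
      ((q_pow 1 - q_pow (-1)) \<odot> (F (swp i B) \<otimes> (e i \<otimes> T w)))"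
      unfolding gF g_T_descent[OF w i d] using cl by (simp add: r_distr smult_mult_r)
    then show ?thesis unfolding Fe by (simp add: FT_def)
  qed
  show "g i \<otimes> FT B w = FT (swp i B) (w \<circ> sw i)" if ns: "\<not> same B i (Suc i)"
  proof (cases "w i < w (Suc i)")
    case False
    then have "w (Suc i) < w i" using permutes_neq[OF w, of i "Suc i"] by simp
    moreover have "\<not> same (swp i B) i (Suc i)" using ns same_sym[of B i "Suc i"] by (simp add: same_swp)
    ultimately show ?thesis using desc ws by simp
  qed (rule 1)
  show "g i \<otimes> FT B w = FT B (w \<circ> sw i) \<oplus> ((q_pow 1 - q_pow (-1)) \<odot> FT B w)"
    if "same B i (Suc i)" "w (Suc i) < w i"
    using desc[OF that(2)] swp_same[of n B i] that(1) B i by simp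
qed

text \<open>The span contains the unit, because \<open>T id\<close> is the unit, and by the rules
  for \<open>e i\<close> and \<open>g i\<close> it is stable under left multiplication by the
  generators.\<close>

lemma lspan_FT:
  assumes "x \<in> carrier A"
  shows "x \<in> lspan {FT B w | B w. B \<in> SP \<and> w permutes {1..n}}" (is "_ \<in> lspan ?M")
  using assms
proof (induction rule: bt_generation_induct)
  case one
  have "FT B id = F B" for B by (simp add: FT_def T_id)
  then have "F B \<in> ?M" if "B \<in> SP" for B
    using that permutes_id[of "{1..n}"] by (metis (mono_tags, lifting) mem_Collect_eq)
  then have "F ` SP \<subseteq> lspan ?M" using lspan_base by blast
  then show ?case by (rule lspan_mono[OF one_in_lspan_F])
next
  case (gen_g x i)
  show ?case
  proof (rule lspan_mult_l[OF gen_g.IH(1)])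
    fix y assume "y \<in> ?M"
    then obtain B w where y: "y = FT B w" "B \<in> SP" "w permutes {1..n}" by blast
    note ws = comp_sw_permutes[OF y(3) gen_g.hyps(2,3)]
    have in_M: "FT C v \<in> lspan ?M" if "C \<in> SP" "v permutes {1..n}" for C v
      using that by (blast intro: lspan_base)
    consider "w i < w (Suc i)" | "\<not> same B i (Suc i)" | "same B i (Suc i)" "w (Suc i) < w i"
      using permutes_neq[OF y(3), of i "Suc i"] by linarith
    then show "g i \<otimes> y \<in> lspan ?M"
    proof cases
      case 1
      then show ?thesis using g_FT(1)[OF y(3) gen_g.hyps(2,3) y(2)] in_M swp_SP ws y gen_g.hyps by simp
    next
      case 2
      then show ?thesis using g_FT(2)[OF y(3) gen_g.hyps(2,3) y(2)] in_M swp_SP ws y gen_g.hyps by simp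
    next
      case 3
      then show ?thesis using g_FT(3)[OF y(3) gen_g.hyps(2,3) y(2) 3] in_M ws y lspan_add lspan_smult
        by simp
    qed
  qed (use gen_g.hyps in auto)
next
  case (gen_e x i)
  show ?case
  proof (rule lspan_mult_l[OF gen_e.IH(1)])
    fix y assume "y \<in> ?M"
    then obtain B w where y: "y = FT B w" "B \<in> SP" "w permutes {1..n}" by blast
    then show "e i \<otimes> y \<in> lspan ?M"
      using e_FT[OF y(3) gen_e.hyps(2,3)] by (auto intro: lspan_base lspan_zero)
  qed (use gen_e.hyps in auto)
qed (auto intro: lspan_add lspan_smult)

section \<open>Straightening modulo the Steinberg elements\<close>

text \<open>The q-antisymmetrizer of three strands: the sum over the six permutations of (-q)^{-l}
  times the product of generators along a reduced expression of length l.\<close>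

definition St :: "nat \<Rightarrow> 'a"
  where "St i =
      ((- q_pow (-3)) \<odot> (g i \<otimes> g (Suc i) \<otimes> g i))
      \<oplus> (q_pow (-2) \<odot> (g i \<otimes> g (Suc i)))
      \<oplus> (q_pow (-2) \<odot> (g (Suc i) \<otimes> g i))
      \<oplus> ((- q_pow (-1)) \<odot> g i)
      \<oplus> ((- q_pow (-1)) \<odot> g (Suc i))
      \<oplus> \<one>"

definition gen :: "nat list \<Rightarrow> nat \<Rightarrow> 'a"
  where "gen \<alpha> i = idem \<alpha> \<otimes> (e i \<otimes> e (Suc i) \<otimes> St i)"

lemma St_closed [simp]: "1 \<le> i \<Longrightarrow> Suc i < n \<Longrightarrow> St i \<in> carrier A"
  by (simp add: St_def)

lemma gen_closed [simp]: "1 \<le> i \<Longrightarrow> Suc i < n \<Longrightarrow> gen \<alpha> i \<in> carrier A"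
  by (simp add: gen_def)

lemma intertwine_add:
  assumes "u \<in> carrier A" "x \<in> carrier A" "y \<in> carrier A" "x' \<in> carrier A" "y' \<in> carrier A"
    "x' \<otimes> u = u \<otimes> x" "y' \<otimes> u = u \<otimes> y"
  shows "(x' \<oplus> y') \<otimes> u = u \<otimes> (x \<oplus> y)"
  using assms by (simp add: l_distr r_distr)

lemma gen_Suc:
  assumes i: "1 \<le> i" "Suc (Suc i) < n"
  shows "\<exists>u\<in>Units A. gen \<alpha> (Suc i) \<otimes> u = u \<otimes> gen \<alpha> i"
proof -
  let ?a = "g i" and ?b = "g (Suc i)" and ?c = "g (Suc (Suc i))"
  let ?d = "e i" and ?k = "e (Suc i)" and ?l = "e (Suc (Suc i))"
  \<comment> \<open>In braid terms one strand passes across three others, which shifts the indices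
    of the generators below it by one. The four relations \<open>b\<close>, \<open>c\<close>,
    \<open>k\<close>, \<open>l\<close> verify this for the factors of the Steinberg element.\<close>
  define u where "u = ?a \<otimes> ?b \<otimes> ?c"
  have cl [simp]: "?a \<in> carrier A" "?b \<in> carrier A" "?c \<in> carrier A" "?d \<in> carrier A" "?k \<in> carrier A"
    "?l \<in> carrier A" using i by auto
  have U: "u \<in> Units A" unfolding u_def using i by auto
  have uc [simp]: "u \<in> carrier A" unfolding u_def by simp
  have aba: "?a \<otimes> ?b \<otimes> ?a = ?b \<otimes> ?a \<otimes> ?b" using i by (intro braid) auto
  have bcb: "?b \<otimes> ?c \<otimes> ?b = ?c \<otimes> ?b \<otimes> ?c" using i by (intro braid) auto
  have ac: "?a \<otimes> ?c = ?c \<otimes> ?a" using i by (intro gg_distant) auto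
  have kba: "?k \<otimes> ?a \<otimes> ?b = ?a \<otimes> ?b \<otimes> ?d" using i by (intro egg) auto
  have lcb: "?l \<otimes> ?b \<otimes> ?c = ?b \<otimes> ?c \<otimes> ?k" using i by (intro egg) auto
  have cd: "?c \<otimes> ?d = ?d \<otimes> ?c" using i by (intro ge_distant) auto
  have al: "?a \<otimes> ?l = ?l \<otimes> ?a" using i by (intro ge_distant) auto
  have "?b \<otimes> u = (?b \<otimes> ?a \<otimes> ?b) \<otimes> ?c" by (simp add: u_def m_assoc)
  also have "\<dots> = ?a \<otimes> ?b \<otimes> (?a \<otimes> ?c)" unfolding aba[symmetric] by (simp add: m_assoc)
  also have "\<dots> = u \<otimes> ?a" unfolding ac by (simp add: u_def m_assoc)
  finally have b: "?b \<otimes> u = u \<otimes> ?a" .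
  have "?c \<otimes> u = (?c \<otimes> ?a) \<otimes> (?b \<otimes> ?c)" by (simp add: u_def m_assoc)
  also have "\<dots> = ?a \<otimes> (?c \<otimes> ?b \<otimes> ?c)" unfolding ac[symmetric] by (simp add: m_assoc)
  also have "\<dots> = u \<otimes> ?b" unfolding bcb[symmetric] by (simp add: u_def m_assoc)
  finally have c: "?c \<otimes> u = u \<otimes> ?b" .
  have "?k \<otimes> u = (?k \<otimes> ?a \<otimes> ?b) \<otimes> ?c" by (simp add: u_def m_assoc)
  also have "\<dots> = ?a \<otimes> ?b \<otimes> (?d \<otimes> ?c)" unfolding kba by (simp add: m_assoc)
  also have "\<dots> = u \<otimes> ?d" unfolding cd[symmetric] by (simp add: u_def m_assoc)
  finally have k: "?k \<otimes> u = u \<otimes> ?d" .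
  have "?l \<otimes> u = (?l \<otimes> ?a) \<otimes> (?b \<otimes> ?c)" by (simp add: u_def m_assoc)
  also have "\<dots> = ?a \<otimes> (?l \<otimes> ?b \<otimes> ?c)" unfolding al[symmetric] by (simp add: m_assoc)
  also have "\<dots> = u \<otimes> ?k" unfolding lcb by (simp add: u_def m_assoc)
  finally have l: "?l \<otimes> u = u \<otimes> ?k" .
  have m: "(x' \<otimes> y') \<otimes> u = u \<otimes> (x \<otimes> y)"
    if "x' \<otimes> u = u \<otimes> x" "y' \<otimes> u = u \<otimes> y" "x \<in> carrier A" "y \<in> carrier A" "x' \<in> carrier A" "y' \<in> carrier A"
    for x y x' y'
    using intertwine_mult[of u x y x' y'] that by simp
  have s: "(r \<odot> x') \<otimes> u = u \<otimes> (r \<odot> x)" if "x' \<otimes> u = u \<otimes> x" "x \<in> carrier A" "x' \<in> carrier A" for x x' r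
    using that by (simp add: smult_mult_l smult_mult_r)
  have o: "\<one> \<otimes> u = u \<otimes> \<one>" by simp
  have zz: "idem \<alpha> \<otimes> u = u \<otimes> idem \<alpha>" using idem_central by simp
  have St: "St (Suc i) \<otimes> u = u \<otimes> St i"
    unfolding St_def by (intro intertwine_add s m b c o) auto
  have "gen \<alpha> (Suc i) \<otimes> u = u \<otimes> gen \<alpha> i"
    unfolding gen_def using i by (intro m k l St zz) auto
  then show ?thesis using U by blast
qed

text \<open>Membership passes in both directions between neighbours, since \<open>gen_Suc\<close>
  conjugates by a unit; all positions are compared with position 1.\<close>

lemma ideal_mem_gen:
  assumes J: "ideal J A" and i: "1 \<le> i" "Suc i < n" "gen \<alpha> i \<in> J" and j: "1 \<le> j" "Suc j < n"
  shows "gen \<alpha> j \<in> J"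
proof -
  interpret J: ideal J A by fact
  have step: "gen \<alpha> (Suc k) \<in> J \<longleftrightarrow> gen \<alpha> k \<in> J" if k: "1 \<le> k" "Suc (Suc k) < n" for k
  proof -
    obtain u where u: "u \<in> Units A" "gen \<alpha> (Suc k) \<otimes> u = u \<otimes> gen \<alpha> k" using gen_Suc[OF k] by blast
    have cl: "gen \<alpha> k \<in> carrier A" "gen \<alpha> (Suc k) \<in> carrier A" "u \<in> carrier A" "inv u \<in> carrier A"
      using k u by auto
    have 1: "gen \<alpha> (Suc k) = u \<otimes> gen \<alpha> k \<otimes> inv u"
      unfolding u(2)[symmetric] using cl u(1) by (simp add: m_assoc)
    have "inv u \<otimes> (gen \<alpha> (Suc k) \<otimes> u) = gen \<alpha> k"
      unfolding u(2) using cl u(1) by (simp add: m_assoc[symmetric])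
    then have 2: "gen \<alpha> k = inv u \<otimes> (gen \<alpha> (Suc k) \<otimes> u)" by simp
    show ?thesis
    proof
      assume "gen \<alpha> (Suc k) \<in> J"
      then show "gen \<alpha> k \<in> J" by (subst 2) (intro J.I_l_closed J.I_r_closed cl)
    next
      assume "gen \<alpha> k \<in> J"
      then show "gen \<alpha> (Suc k) \<in> J" by (subst 1) (intro J.I_l_closed J.I_r_closed cl)
    qed
  qed
  have base: "gen \<alpha> k \<in> J \<longleftrightarrow> gen \<alpha> 1 \<in> J" if "1 \<le> k" "Suc k < n" for k
    using that by (induction k rule: nat_induct_at_least) (use step in auto)
  show ?thesis using base i j by blast
qed

definition bad_triple :: "nat set set \<Rightarrow> (nat \<Rightarrow> nat) \<Rightarrow> nat \<Rightarrow> nat \<Rightarrow> nat \<Rightarrow> bool"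
  where "bad_triple B w a b c \<longleftrightarrow> 1 \<le> a \<and> a < b \<and> b < c \<and> c \<le> n \<and> same B a b \<and> same B a c \<and>
    w b < w a \<and> w c < w b"

text \<open>Inside every block \<open>w\<close> avoids the pattern 321. Such permutations are the
  usual index set of a Temperley-Lieb basis.\<close>

definition good :: "nat set set \<Rightarrow> (nat \<Rightarrow> nat) \<Rightarrow> bool"
  where "good B w \<longleftrightarrow> (\<forall>a b c. \<not> bad_triple B w a b c)"

text \<open>For adjacent positions the Steinberg element expresses \<open>FT B w\<close> through permutations with
  fewer inversions inside the blocks.  In general, the outer positions of a bad triple are moved
  towards the middle one.\<close>

lemma straighten_step:
  assumes J: "ideal J A" and gens: "\<And>i. 1 \<le> i \<Longrightarrow> Suc i < n \<Longrightarrow> gen \<alpha> i \<in> J"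
    and "B \<in> SPt \<alpha>" "w permutes {1..n}" "bad_triple B w a b c"
  shows "FT B w \<in> lspan (J \<union> {FT B v | v. v permutes {1..n} \<and> blinv n B v < blinv n B w})"
  using assms(3-)
proof (induction "c - a" arbitrary: a b c w B rule: less_induct)
  case less
  note w = \<open>w permutes {1..n}\<close>
  have B: "B \<in> SP" "has_type B \<alpha>" "partition_on {1..n} B" using less.prems(1) by auto
  have t: "1 \<le> a" "a < b" "b < c" "c \<le> n" "same B a b" "same B a c" "w b < w a" "w c < w b"
    using less.prems(3) by (auto simp: bad_triple_def)
  have same_bc: "same B b c" using same_trans[OF B(3)] t same_sym by metis
  define L where "L C v = lspan (J \<union> {FT C v' | v'. v' permutes {1..n} \<and> blinv n C v' < blinv n C v})" for C v
  have sub: "J \<union> {FT C v' | v'. v' permutes {1..n} \<and> blinv n C v' < blinv n C v} \<subseteq> carrier A" for C v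
    using ideal_carrier[OF J] by auto
  have J_L: "x \<in> L C v" if "x \<in> J" for x C v unfolding L_def using that by (simp add: lspan_base)
  have FT_L: "FT C v' \<in> L C v" if "v' permutes {1..n}" "blinv n C v' < blinv n C v" for C v v'
    unfolding L_def using that by (intro lspan_base) blast
  have add_L: "x \<oplus> y \<in> L C v" if "x \<in> L C v" "y \<in> L C v" for x y C v
    using that unfolding L_def by (rule lspan_add)
  have smult_L: "r \<odot> x \<in> L C v" if "x \<in> L C v" for r x C v
    using that unfolding L_def by (rule lspan_smult)
  have gJ: "g i \<otimes> x \<in> J" if "x \<in> J" "1 \<le> i" "i < n" for i x
    using ideal.I_l_closed[OF J that(1)] that by simp
  \<comment> \<open>Across blocks \<open>g i\<close> merely exchanges indices and
    \<open>blinv\<close> is unchanged, so the claim for \<open>swp i B\<close> and the exchanged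
    permutation, whose triple is shorter, is carried back by one multiplication.\<close>
  have move: "FT B w \<in> L B w"
    if i: "1 \<le> i" "i < n" and ns: "\<not> same B i (Suc i)" and bt: "bad_triple (swp i B) (w \<circ> sw i) a' b' c'"
      and len: "c' - a' < c - a" for i a' b' c'
  proof -
    have ws: "w \<circ> sw i permutes {1..n}" by (rule comp_sw_permutes[OF w i])
    have Bs: "swp i B \<in> SPt \<alpha>" using partition_swp[OF B(3) i] has_type_swp B by simp
    have ns': "\<not> same (swp i B) i (Suc i)" using ns same_sym[of B i "Suc i"] by (simp add: same_swp)
    have IH: "FT (swp i B) (w \<circ> sw i) \<in> L (swp i B) (w \<circ> sw i)"
      unfolding L_def by (rule less.hyps[OF len Bs ws bt])
    have "g i \<otimes> FT (swp i B) (w \<circ> sw i) \<in> L B w"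
      unfolding L_def[of B w]
    proof (rule lspan_mult_l[OF IH[unfolded L_def] sub])
      show "g i \<in> carrier A" using i by simp
      fix y assume "y \<in> J \<union> {FT (swp i B) v' | v'. v' permutes {1..n} \<and>
        blinv n (swp i B) v' < blinv n (swp i B) (w \<circ> sw i)}"
      then consider "y \<in> J" | v' where "y = FT (swp i B) v'" "v' permutes {1..n}"
        "blinv n (swp i B) v' < blinv n (swp i B) (w \<circ> sw i)" by blast
      then show "g i \<otimes> y \<in> lspan (J \<union> {FT B v' | v'. v' permutes {1..n} \<and> blinv n B v' < blinv n B w})"
        unfolding L_def[symmetric]
      proof cases
        case 1
        then show "g i \<otimes> y \<in> L B w" using gJ i J_L by simp
      next
        case 2
        have "g i \<otimes> y = FT B (v' \<circ> sw i)"
          using g_FT(2)[OF 2(2) i _ ns'] Bs 2(1) by simp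
        moreover have "blinv n B (v' \<circ> sw i) < blinv n B w"
          using 2(3) blinv_swp[OF i ns', of v'] blinv_swp[OF i ns, of w] by simp
        ultimately show "g i \<otimes> y \<in> L B w" using FT_L comp_sw_permutes[OF 2(2) i] by simp
      qed
    qed
    moreover have "g i \<otimes> FT (swp i B) (w \<circ> sw i) = FT B w"
      using g_FT(2)[OF ws i _ ns'] Bs by simp
    ultimately show ?thesis by simp
  qed
  \<comment> \<open>Inside a block \<open>FT B w\<close> is \<open>g i\<close> times an element with
    one inversion fewer. Multiplication by \<open>g i\<close> adds at most one inversion, so what
    lies below that element lands below \<open>w\<close>.\<close>
  have descend: "FT B w \<in> L B w"
    if i: "1 \<le> i" "i < n" and s: "same B i (Suc i)" and d: "w (Suc i) < w i"
      and bt: "bad_triple B (w \<circ> sw i) a' b' c'" and len: "c' - a' < c - a" for i a' b' c'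
  proof -
    have ws: "w \<circ> sw i permutes {1..n}" by (rule comp_sw_permutes[OF w i])
    have sB: "swp i B = B" by (rule swp_same[OF B(3) i s])
    have len_w: "blinv n B w = Suc (blinv n B (w \<circ> sw i))"
      using blinv_comp_sw[OF B(3) i s, of "w \<circ> sw i"] d by simp
    have IH: "FT B (w \<circ> sw i) \<in> L B (w \<circ> sw i)"
      unfolding L_def by (rule less.hyps[OF len less.prems(1) ws bt])
    have "g i \<otimes> FT B (w \<circ> sw i) \<in> L B w"
      unfolding L_def[of B w]
    proof (rule lspan_mult_l[OF IH[unfolded L_def] sub])
      show "g i \<in> carrier A" using i by simp
      fix y assume "y \<in> J \<union> {FT B v' | v'. v' permutes {1..n} \<and> blinv n B v' < blinv n B (w \<circ> sw i)}"
      then consider "y \<in> J" | v' where "y = FT B v'" "v' permutes {1..n}"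
        "blinv n B v' < blinv n B (w \<circ> sw i)" by blast
      then show "g i \<otimes> y \<in> lspan (J \<union> {FT B v' | v'. v' permutes {1..n} \<and> blinv n B v' < blinv n B w})"
        unfolding L_def[symmetric]
      proof cases
        case 1
        then show "g i \<otimes> y \<in> L B w" using gJ i J_L by simp
      next
        case 2
        have vs: "v' \<circ> sw i permutes {1..n}" by (rule comp_sw_permutes[OF 2(2) i])
        have 3: "FT B (v' \<circ> sw i) \<in> L B w"
          using FT_L[OF vs] blinv_comp_sw_le[OF B(3) i s 2(2)] 2(3) len_w by simp
        have 4: "FT B v' \<in> L B w" using FT_L[OF 2(2)] 2(3) len_w by simp
        show "g i \<otimes> y \<in> L B w"
        proof (cases "v' i < v' (Suc i)")
          case True
          then show ?thesis using g_FT(1)[OF 2(2) i B(1)] 3 2(1) sB by simp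
        next
          case False
          then have "v' (Suc i) < v' i" using permutes_neq[OF 2(2), of i "Suc i"] by simp
          then show ?thesis using g_FT(3)[OF 2(2) i B(1) s] 2(1) add_L[OF 3 smult_L[OF 4]] by simp
        qed
      qed
    qed
    moreover have "g i \<otimes> FT B (w \<circ> sw i) = FT B w"
      using g_FT(1)[OF ws i B(1)] d sB by simp
    ultimately show ?thesis by simp
  qed
  have "FT B w \<in> L B w"
  proof (cases "b = Suc a \<and> c = Suc (Suc a)")
    case False
    then consider "Suc a < b" | "Suc b < c" using t by linarith
    then show ?thesis
    proof cases
      case 1
      have i: "1 \<le> a" "a < n" using t 1 by auto
      show ?thesis
      proof (cases "same B a (Suc a)")
        case ns: False
        have "bad_triple (swp a B) (w \<circ> sw a) (Suc a) b c"
          using t 1 by (simp add: bad_triple_def same_swp transpose_def)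
        then show ?thesis using move[OF i ns] t 1 by simp
      next
        case s: True
        have sab: "same B (Suc a) b" "same B (Suc a) c"
          using s t same_trans[OF B(3)] same_sym by metis+
        \<comment> \<open>Either position \<open>Suc a\<close> can itself open the triple, or
          \<open>w\<close> descends at \<open>a\<close> and the exchange moves the large value one
          step towards \<open>b\<close>.\<close>
        show ?thesis
        proof (cases "w b < w (Suc a)")
          case True
          then have bt: "bad_triple B w (Suc a) b c" using t 1 sab by (simp add: bad_triple_def)
          show ?thesis unfolding L_def by (rule less.hyps[OF _ less.prems(1,2) bt]) (use t in simp)
        next
          case False
          then have "w (Suc a) < w a" using t by linarith
          moreover have "bad_triple B (w \<circ> sw a) (Suc a) b c"
            using t 1 sab by (simp add: bad_triple_def transpose_def)
          ultimately show ?thesis using descend[OF i s] t 1 by simp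
        qed
      qed
    next
      case 2
      \<comment> \<open>The mirror image at the right end, with \<open>d\<close> the position before
        \<open>c\<close>.\<close>
      then obtain d where d: "c = Suc d" "b < d" by (metis Suc_lessE Suc_less_eq)
      have i: "1 \<le> d" "d < n" using t d by auto
      show ?thesis
      proof (cases "same B d (Suc d)")
        case ns: False
        have "bad_triple (swp d B) (w \<circ> sw d) a b d"
          using t d by (simp add: bad_triple_def same_swp transpose_def)
        then show ?thesis using move[OF i ns] t d by simp
      next
        case s: True
        have sad: "same B a d" using s t d same_trans[OF B(3)] same_sym by metis
        show ?thesis
        proof (cases "w d < w b")
          case True
          then have bt: "bad_triple B w a b d" using t d sad by (simp add: bad_triple_def)
          show ?thesis unfolding L_def by (rule less.hyps[OF _ less.prems(1,2) bt]) (use t d in simp)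
        next
          case False
          then have "w (Suc d) < w d" using t d by simp
          moreover have "bad_triple B (w \<circ> sw d) a b d"
            using t d sad by (simp add: bad_triple_def transpose_def)
          ultimately show ?thesis using descend[OF i s] t d by simp
        qed
      qed
    qed
  next
    case True
    let ?a = "Suc a"
    have bc: "b = Suc a" "c = Suc ?a" using True by auto
    have i: "1 \<le> a" "a < n" "1 \<le> ?a" "?a < n" using t bc by auto
    have s: "same B a ?a" "same B ?a (Suc ?a)" using t bc same_bc by auto
    have lt: "w (Suc ?a) < w ?a" "w ?a < w a" using t bc by auto
    \<comment> \<open>\<open>y\<close> has the three values in increasing order, so \<open>w\<close>
      is obtained from it by the longest permutation of the three positions, and all products along
      the way are reduced.\<close>
    define y where "y = w \<circ> sw a \<circ> sw ?a \<circ> sw a"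
    have y1: "y permutes {1..n}" unfolding y_def using w i by (intro comp_sw_permutes)
    note y2 = comp_sw_permutes[OF y1 i(1,2)]
    note y3 = comp_sw_permutes[OF y1 i(3,4)]
    note y4 = comp_sw_permutes[OF y2 i(3,4)]
    note y5 = comp_sw_permutes[OF y3 i(1,2)]
    have vals: "y a = w (Suc ?a)" "y ?a = w ?a" "y (Suc ?a) = w a" by (simp_all add: y_def transpose_def)
    have wy: "w = y \<circ> sw a \<circ> sw ?a \<circ> sw a" unfolding y_def by (simp add: fun_eq_iff)
    have T1: "T (y \<circ> sw a) = g a \<otimes> T y" by (rule T_ascent[OF y1 i(1,2)]) (use vals lt in simp)
    have T2: "T (y \<circ> sw ?a) = g ?a \<otimes> T y" by (rule T_ascent[OF y1 i(3,4)]) (use vals lt in simp)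
    have T3: "T (y \<circ> sw a \<circ> sw ?a) = g ?a \<otimes> T (y \<circ> sw a)"
      by (rule T_ascent[OF y2 i(3,4)]) (use vals lt in \<open>simp add: transpose_def\<close>)
    have T4: "T (y \<circ> sw ?a \<circ> sw a) = g a \<otimes> T (y \<circ> sw ?a)"
      by (rule T_ascent[OF y3 i(1,2)]) (use vals lt in \<open>simp add: transpose_def\<close>)
    have T5: "T w = g a \<otimes> T (y \<circ> sw a \<circ> sw ?a)"
      unfolding wy by (rule T_ascent[OF y4 i(1,2)]) (use vals lt in \<open>simp add: transpose_def\<close>)
    have b1: "blinv n B (y \<circ> sw a) = Suc (blinv n B y)"
      by (rule blinv_comp_sw[OF B(3) i(1,2) s(1)]) (use vals lt in simp)
    have b2: "blinv n B (y \<circ> sw ?a) = Suc (blinv n B y)"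
      by (rule blinv_comp_sw[OF B(3) i(3,4) s(2)]) (use vals lt in simp)
    have b3: "blinv n B (y \<circ> sw a \<circ> sw ?a) = Suc (blinv n B (y \<circ> sw a))"
      by (rule blinv_comp_sw[OF B(3) i(3,4) s(2)]) (use vals lt in \<open>simp add: transpose_def\<close>)
    have b4: "blinv n B (y \<circ> sw ?a \<circ> sw a) = Suc (blinv n B (y \<circ> sw ?a))"
      by (rule blinv_comp_sw[OF B(3) i(1,2) s(1)]) (use vals lt in \<open>simp add: transpose_def\<close>)
    have b5: "blinv n B w = Suc (blinv n B (y \<circ> sw a \<circ> sw ?a))"
      unfolding wy by (rule blinv_comp_sw[OF B(3) i(1,2) s(1)]) (use vals lt in \<open>simp add: transpose_def\<close>)
    have cl: "g a \<in> carrier A" "g ?a \<in> carrier A" "e a \<in> carrier A" "e ?a \<in> carrier A" "T y \<in> carrier A"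
      "T w \<in> carrier A" "T (y \<circ> sw a) \<in> carrier A" "T (y \<circ> sw ?a) \<in> carrier A"
      "T (y \<circ> sw a \<circ> sw ?a) \<in> carrier A" "T (y \<circ> sw ?a \<circ> sw a) \<in> carrier A" "St a \<in> carrier A"
      using i w y1 y2 y3 y4 y5 by auto
    have m: "F B \<otimes> (x \<otimes> T y) \<in> carrier A" if "x \<in> carrier A" for x using that cl by simp
    define x where "x = (- q_pow (-3)) \<odot> FT B w"
    define x4 where "x4 = q_pow (-2) \<odot> FT B (y \<circ> sw ?a \<circ> sw a)"
    define x3 where "x3 = q_pow (-2) \<odot> FT B (y \<circ> sw a \<circ> sw ?a)"
    define x1 where "x1 = (- q_pow (-1)) \<odot> FT B (y \<circ> sw a)"
    define x2 where "x2 = (- q_pow (-1)) \<odot> FT B (y \<circ> sw ?a)"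
    define x0 where "x0 = FT B y"
    have expand: "F B \<otimes> (St a \<otimes> T y) = x \<oplus> x4 \<oplus> x3 \<oplus> x1 \<oplus> x2 \<oplus> x0"
      unfolding x_def x0_def x1_def x2_def x3_def x4_def St_def FT_def T5 T4 T3 T2 T1 using cl
      by (simp add: l_distr r_distr smult_mult_l smult_mult_r m_assoc)
    \<comment> \<open>\<open>F B\<close> absorbs the central idempotent, having type \<alpha>, and
      both \<open>e\<close>, as the three positions share a block. Only the Steinberg element is
      left of the generator.\<close>
    have FSt: "F B \<otimes> (St a \<otimes> T y) \<in> J"
    proof -
      have "F B \<otimes> (gen \<alpha> a \<otimes> T y) = (F B \<otimes> idem \<alpha>) \<otimes> e a \<otimes> e ?a \<otimes> (St a \<otimes> T y)"
        unfolding gen_def using cl by (simp add: m_assoc)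
      also have "F B \<otimes> idem \<alpha> = F B" using idem_central[of "F B" \<alpha>] idem_mult_F[OF B(1)] B(2) by simp
      also have "F B \<otimes> e a = F B" using e_F[OF i(1,2)] s by simp
      also have "F B \<otimes> e ?a = F B" using e_F[OF i(3,4)] s by simp
      finally have "F B \<otimes> (St a \<otimes> T y) = F B \<otimes> (gen \<alpha> a \<otimes> T y)" by simp
      then show ?thesis
        using ideal.I_l_closed[OF J ideal.I_r_closed[OF J gens[of a] cl(5)], of "F B"] i by simp
    qed
    let ?r = "x4 \<oplus> x3 \<oplus> x1 \<oplus> x2 \<oplus> x0"
    have xc: "x \<in> carrier A" "x4 \<in> carrier A" "x3 \<in> carrier A" "x1 \<in> carrier A" "x2 \<in> carrier A"
      "x0 \<in> carrier A"
      unfolding x_def x0_def x1_def x2_def x3_def x4_def using w y1 y2 y3 y4 y5 by simp_all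
    have rc: "?r \<in> carrier A" using xc by simp
    have inJ: "x \<oplus> ?r \<in> J" using FSt unfolding expand using xc by (simp add: a_assoc)
    have "?r \<in> L B w"
      unfolding x0_def x1_def x2_def x3_def x4_def
      by (intro add_L smult_L FT_L y1 y2 y3 y4 y5) (simp_all add: b1 b2 b3 b4 b5)
    then have "(- 1) \<odot> ?r \<in> L B w" by (rule smult_L)
    then have "(x \<oplus> ?r) \<oplus> (- 1) \<odot> ?r \<in> L B w" by (rule add_L[OF J_L[OF inJ]])
    moreover have "(x \<oplus> ?r) \<oplus> (- 1) \<odot> ?r = x"
      using xc(1) rc by (simp add: smult_uminus a_assoc r_neg)
    \<comment> \<open>The coefficient of \<open>FT B w\<close> is -q^{-3}, a unit, so the relation
      can be solved for \<open>FT B w\<close>.\<close>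
    ultimately have "(- q_pow 3) \<odot> x \<in> L B w" by (simp add: smult_L)
    moreover have "q_pow 3 * q_pow (-3) = 1" by (simp add: q_pow_def mult_single)
    then have "(- q_pow 3) \<odot> x = FT B w"
      unfolding x_def using w by (simp add: smult_smult)
    ultimately show ?thesis by simp
  qed
  then show ?case unfolding L_def .
qed

lemma straighten:
  assumes J: "ideal J A" and gens: "\<And>i. 1 \<le> i \<Longrightarrow> Suc i < n \<Longrightarrow> gen \<alpha> i \<in> J"
    and B: "B \<in> SPt \<alpha>" and w: "w permutes {1..n}"
  shows "FT B w \<in> lspan (J \<union> {FT B v | v. v permutes {1..n} \<and> good B v})"
  using w
proof (induction "blinv n B w" arbitrary: w rule: less_induct)
  case less
  show ?case
  proof (cases "good B w")
    case True
    then show ?thesis using less.prems by (intro lspan_base) blast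
  next
    case False
    then obtain a b c where bt: "bad_triple B w a b c" by (auto simp: good_def)
    have "FT B w \<in> lspan (J \<union> {FT B v | v. v permutes {1..n} \<and> blinv n B v < blinv n B w})"
      by (rule straighten_step[OF J _ B less.prems bt]) (rule gens)
    then show ?thesis
    proof (rule lspan_mono, intro subsetI)
      fix x assume "x \<in> J \<union> {FT B v | v. v permutes {1..n} \<and> blinv n B v < blinv n B w}"
      then show "x \<in> lspan (J \<union> {FT B v | v. v permutes {1..n} \<and> good B v})"
        using less.hyps lspan_base by blast
    qed
  qed
qed

lemma spanning:
  assumes J: "ideal J A" and gens: "\<And>i. 1 \<le> i \<Longrightarrow> Suc i < n \<Longrightarrow> gen \<alpha> i \<in> J" and x: "x \<in> carrier A"
  shows "idem \<alpha> \<otimes> x \<in> lspan (J \<union> {FT B v | B v. B \<in> SPt \<alpha> \<and> v permutes {1..n} \<and> good B v})"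
    (is "_ \<in> lspan (J \<union> ?M)")
proof (rule lspan_mult_l[OF lspan_FT[OF x]])
  fix y assume "y \<in> {FT B w | B w. B \<in> SP \<and> w permutes {1..n}}"
  then obtain B w where y: "y = FT B w" "B \<in> SP" "w permutes {1..n}" by blast
  have Zy: "idem \<alpha> \<otimes> y = (if has_type B \<alpha> then FT B w else \<zero>)"
    using idem_mult_F[OF y(2), of \<alpha>] y by (simp add: FT_def m_assoc[symmetric])
  show "idem \<alpha> \<otimes> y \<in> lspan (J \<union> ?M)"
  proof (cases "has_type B \<alpha>")
    case True
    then have B: "B \<in> SPt \<alpha>" using y by simp
    have "FT B w \<in> lspan (J \<union> ?M)"
    proof (rule lspan_mono[OF straighten[OF J _ B y(3)]])
      show "J \<union> {FT B v | v. v permutes {1..n} \<and> good B v} \<subseteq> lspan (J \<union> ?M)"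
      proof
        fix x assume "x \<in> J \<union> {FT B v | v. v permutes {1..n} \<and> good B v}"
        then have "x \<in> J \<union> ?M" using B by blast
        then show "x \<in> lspan (J \<union> ?M)" by (rule lspan_base)
      qed
    qed (rule gens)
    then show ?thesis using Zy True by simp
  next
    case False
    then show ?thesis using Zy by (simp add: lspan_zero)
  qed
qed (use FT_closed in auto)

end

section \<open>The bt-algebra as an instance\<close>

abbreviation bt_free_algebra :: "nat \<Rightarrow> (laurent, bt_free) module"
  where "bt_free_algebra n \<equiv> free_algebra (bt_gens n)"

abbreviation bt_class :: "nat \<Rightarrow> bt_free \<Rightarrow> bt"
  where "bt_class n f \<equiv> bt_ideal n +>\<^bsub>bt_free_algebra n\<^esub> f"

definition bt_relators :: "nat \<Rightarrow> bt_free set"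
  where "bt_relators n = {l - r | l r. bt_rel l r \<and> l \<in> carrier (bt_free_algebra n)
    \<and> r \<in> carrier (bt_free_algebra n)}"

lemma free_algebra_minus:
  "f \<in> carrier (free_algebra X) \<Longrightarrow> \<ominus>\<^bsub>free_algebra X :: ('r::comm_ring_1, _) module\<^esub> f = - f"
  "f \<in> carrier (free_algebra X) \<Longrightarrow> h \<in> carrier (free_algebra X)
    \<Longrightarrow> f \<ominus>\<^bsub>free_algebra X :: ('r::comm_ring_1, _) module\<^esub> h = f - h"
proof -
  interpret S: salg "free_algebra X :: ('r, _) module" by (rule salg_free_algebra)
  have neg: "\<ominus>\<^bsub>free_algebra X :: ('r, _) module\<^esub> f = - f" if "f \<in> carrier (free_algebra X)" for f
  proof (rule S.minus_equality)
    show "- f \<oplus>\<^bsub>free_algebra X :: ('r, _) module\<^esub> f = \<zero>\<^bsub>free_algebra X :: ('r, _) module\<^esub>"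
      by (simp add: free_algebra_simps)
    show "- f \<in> carrier (free_algebra X)"
      using that by (auto simp: free_algebra_simps in_keys_iff subset_iff)
  qed (rule that)
  then show "f \<in> carrier (free_algebra X) \<Longrightarrow> \<ominus>\<^bsub>free_algebra X :: ('r, _) module\<^esub> f = - f" .
  show "f \<in> carrier (free_algebra X) \<Longrightarrow> h \<in> carrier (free_algebra X)
    \<Longrightarrow> f \<ominus>\<^bsub>free_algebra X :: ('r, _) module\<^esub> h = f - h"
    by (simp add: a_minus_def neg free_algebra_simps)
qed

lemma bt_relators_carrier: "bt_relators n \<subseteq> carrier (bt_free_algebra n)"
proof -
  interpret S: salg "bt_free_algebra n" by (rule salg_free_algebra)
  show ?thesis
    unfolding bt_relators_def by (auto simp: free_algebra_minus(2)[symmetric] S.minus_closed)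
qed

lemma ideal_bt_ideal: "ideal (bt_ideal n) (bt_free_algebra n)"
proof -
  interpret S: salg "bt_free_algebra n" by (rule salg_free_algebra)
  show ?thesis
    unfolding bt_ideal_def bt_relators_def[symmetric]
    by (rule S.genideal_ideal[OF bt_relators_carrier])
qed

lemma salg_bt_algebra: "salg (bt_algebra n)"
  unfolding bt_algebra_def by (rule salg_quot_algebra[OF salg_free_algebra ideal_bt_ideal])

lemmas bt_class_simps = quot_algebra_coset[OF ideal_bt_ideal, folded bt_algebra_def]
lemmas bt_class_smult = salg_quot_algebra(2)[OF salg_free_algebra ideal_bt_ideal, folded bt_algebra_def]

lemma word_carrier: "word w \<in> carrier (bt_free_algebra n) \<longleftrightarrow> set w \<subseteq> bt_gens n"
  by (auto simp: word_def free_algebra_simps)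

lemma bt_class_word_mult:
  "set v \<subseteq> bt_gens n \<Longrightarrow> set w \<subseteq> bt_gens n
    \<Longrightarrow> bt_class n (word v) \<otimes>\<^bsub>bt_algebra n\<^esub> bt_class n (word w) = bt_class n (word (v @ w))"
  by (simp add: bt_class_simps word_carrier) (simp add: word_def free_algebra_mult_single)

lemma bt_class_rel:
  assumes "bt_rel l r" "l \<in> carrier (bt_free_algebra n)" "r \<in> carrier (bt_free_algebra n)"
  shows "bt_class n l = bt_class n r"
proof -
  interpret S: salg "bt_free_algebra n" by (rule salg_free_algebra)
  have "l - r \<in> bt_ideal n"
    unfolding bt_ideal_def bt_relators_def[symmetric]
    using S.genideal_self[OF bt_relators_carrier[of n]] assms by (auto simp: bt_relators_def)
  then show ?thesis
    using ideal_coset_eq[OF ideal_bt_ideal assms(2,3)] assms(2,3) by (simp add: free_algebra_minus)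
qed

lemma bt_class_rel_words:
  "bt_rel (word v) (word w) \<Longrightarrow> set v \<subseteq> bt_gens n \<Longrightarrow> set w \<subseteq> bt_gens n
    \<Longrightarrow> bt_class n (word v) = bt_class n (word w)"
  by (rule bt_class_rel) (simp_all add: word_carrier)

lemma bt_gens_iff [simp]: "G i \<in> bt_gens n \<longleftrightarrow> 1 \<le> i \<and> i < n" "E i \<in> bt_gens n \<longleftrightarrow> 1 \<le> i \<and> i < n"
  by (auto simp: bt_gens_def)

text \<open>Relations between words pass to classes. The induction principle comes from writing an
  element as a combination of words and peeling off letters from the left.\<close>

lemma bt_bt_algebra: "bt (bt_algebra n) n (bt_g n) (bt_e n) (bt_E n)"
proof -
  interpret A: salg "bt_algebra n" by (rule salg_bt_algebra)
  have cl: "bt_class n (word w) \<in> carrier (bt_algebra n)" if "set w \<subseteq> bt_gens n" for w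
    using that word_carrier by (auto simp: bt_class_simps(1))
  have wm: "bt_class n (word v) \<otimes>\<^bsub>bt_algebra n\<^esub> bt_class n (word w) = bt_class n (word (v @ w))"
    if "set v \<subseteq> bt_gens n" "set w \<subseteq> bt_gens n" for v w
    by (rule bt_class_word_mult[OF that])
  note rel = bt_class_rel_words[OF bt_rel.intros(1)] bt_class_rel_words[OF bt_rel.intros(2)]
    bt_class_rel_words[OF bt_rel.intros(3)] bt_class_rel_words[OF bt_rel.intros(4)]
    bt_class_rel_words[OF bt_rel.intros(5)] bt_class_rel_words[OF bt_rel.intros(6)]
    bt_class_rel_words[OF bt_rel.intros(7)] bt_class_rel_words[OF bt_rel.intros(8)]
    bt_class_rel_words[OF bt_rel.intros(9)]
  show ?thesis
  proof (unfold_locales)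
    fix i assume i: "1 \<le> i" "i < n"
    show "bt_g n i \<in> carrier (bt_algebra n)" "bt_e n i \<in> carrier (bt_algebra n)"
      unfolding bt_g_def bt_e_def using i by (simp_all add: cl)
    show "bt_g n i \<otimes>\<^bsub>bt_algebra n\<^esub> bt_e n i = bt_e n i \<otimes>\<^bsub>bt_algebra n\<^esub> bt_g n i"
      unfolding bt_g_def bt_e_def using i rel(2)[of i] by (simp add: wm)
    show "bt_e n i \<otimes>\<^bsub>bt_algebra n\<^esub> bt_e n i = bt_e n i"
      unfolding bt_e_def using i rel(9)[of i] by (simp add: wm)
    have W: "word [] \<in> carrier (bt_free_algebra n)" "word [E i, G i] \<in> carrier (bt_free_algebra n)"
      "scale c (word [E i, G i]) \<in> carrier (bt_free_algebra n)" for c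
      using i keys_scale[of c "word [E i, G i]"] by (auto simp: word_def free_algebra_simps)
    have "bt_class n (word [G i, G i]) = bt_class n (word [] + scale (q_pow 1 - q_pow (-1)) (word [E i, G i]))"
    proof (rule bt_class_rel[OF bt_rel.intros(10)])
      show "word [G i, G i] \<in> carrier (bt_free_algebra n)" using i by (simp add: word_carrier)
      interpret S: salg "bt_free_algebra n" by (rule salg_free_algebra)
      show "word [] + scale (q_pow 1 - q_pow (-1)) (word [E i, G i]) \<in> carrier (bt_free_algebra n)"
        using S.a_closed[OF W(1,3)] by (simp add: free_algebra_simps(4))
    qed
    also have "\<dots> = bt_class n (word []) \<oplus>\<^bsub>bt_algebra n\<^esub>
      bt_class n (scale (q_pow 1 - q_pow (-1)) (word [E i, G i]))"
      using bt_class_simps(3)[OF W(1,3)] by (simp add: free_algebra_simps(4))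
    also have "\<dots> = \<one>\<^bsub>bt_algebra n\<^esub> \<oplus>\<^bsub>bt_algebra n\<^esub>
      ((q_pow 1 - q_pow (-1)) \<odot>\<^bsub>bt_algebra n\<^esub> bt_class n (word [E i, G i]))"
      using bt_class_smult[OF W(2)] by (simp add: free_algebra_simps bt_class_simps(4) word_def)
    finally show "bt_g n i \<otimes>\<^bsub>bt_algebra n\<^esub> bt_g n i = \<one>\<^bsub>bt_algebra n\<^esub> \<oplus>\<^bsub>bt_algebra n\<^esub>
      ((q_pow 1 - q_pow (-1)) \<odot>\<^bsub>bt_algebra n\<^esub> (bt_e n i \<otimes>\<^bsub>bt_algebra n\<^esub> bt_g n i))"
      unfolding bt_g_def bt_e_def using i by (simp add: wm)
    show "bt_E n i (Suc i) = bt_e n i" by (simp add: bt_E.simps)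
  next
    fix i j assume i: "1 \<le> i" "i < n" and j: "1 \<le> j" "j < n"
    show "bt_e n i \<otimes>\<^bsub>bt_algebra n\<^esub> bt_e n j = bt_e n j \<otimes>\<^bsub>bt_algebra n\<^esub> bt_e n i"
      unfolding bt_e_def using i j rel(7)[of i j] by (simp add: wm)
    show "bt_g n i \<otimes>\<^bsub>bt_algebra n\<^esub> bt_g n j = bt_g n j \<otimes>\<^bsub>bt_algebra n\<^esub> bt_g n i" if "distant i j"
      unfolding bt_g_def using i j rel(1)[OF that] by (simp add: wm)
    show "bt_g n i \<otimes>\<^bsub>bt_algebra n\<^esub> bt_e n j = bt_e n j \<otimes>\<^bsub>bt_algebra n\<^esub> bt_g n i" if "distant i j"
      unfolding bt_g_def bt_e_def using i j rel(8)[OF that] by (simp add: wm)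
    assume ad: "adjacent i j"
    show "bt_g n i \<otimes>\<^bsub>bt_algebra n\<^esub> bt_g n j \<otimes>\<^bsub>bt_algebra n\<^esub> bt_g n i =
      bt_g n j \<otimes>\<^bsub>bt_algebra n\<^esub> bt_g n i \<otimes>\<^bsub>bt_algebra n\<^esub> bt_g n j"
      unfolding bt_g_def using i j rel(3)[OF ad] by (simp add: wm)
    show "bt_e n i \<otimes>\<^bsub>bt_algebra n\<^esub> bt_g n j \<otimes>\<^bsub>bt_algebra n\<^esub> bt_g n i =
      bt_g n j \<otimes>\<^bsub>bt_algebra n\<^esub> bt_g n i \<otimes>\<^bsub>bt_algebra n\<^esub> bt_e n j"
      unfolding bt_g_def bt_e_def using i j rel(4)[OF ad] by (simp add: wm)
    show "bt_e n i \<otimes>\<^bsub>bt_algebra n\<^esub> bt_e n j \<otimes>\<^bsub>bt_algebra n\<^esub> bt_g n j =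
      bt_e n i \<otimes>\<^bsub>bt_algebra n\<^esub> bt_g n j \<otimes>\<^bsub>bt_algebra n\<^esub> bt_e n i"
      unfolding bt_g_def bt_e_def using i j rel(5)[OF ad] by (simp add: wm)
    show "bt_e n i \<otimes>\<^bsub>bt_algebra n\<^esub> bt_g n j \<otimes>\<^bsub>bt_algebra n\<^esub> bt_e n i =
      bt_g n j \<otimes>\<^bsub>bt_algebra n\<^esub> bt_e n i \<otimes>\<^bsub>bt_algebra n\<^esub> bt_e n j"
      unfolding bt_g_def bt_e_def using i j rel(6)[OF ad] by (simp add: wm)
  next
    fix i j assume "1 \<le> i" "Suc i < j" "j \<le> n"
    then show "bt_E n i j = bt_g n i \<otimes>\<^bsub>bt_algebra n\<^esub> bt_E n (Suc i) j
      \<otimes>\<^bsub>bt_algebra n\<^esub> inv\<^bsub>bt_algebra n\<^esub> (bt_g n i)"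
      by (subst bt_E.simps) simp
  next
    fix P :: "bt \<Rightarrow> bool" and x
    assume x: "x \<in> carrier (bt_algebra n)" and one: "P \<one>\<^bsub>bt_algebra n\<^esub>"
      and add: "\<And>x y. x \<in> carrier (bt_algebra n) \<Longrightarrow> y \<in> carrier (bt_algebra n) \<Longrightarrow> P x \<Longrightarrow> P y
        \<Longrightarrow> P (x \<oplus>\<^bsub>bt_algebra n\<^esub> y)"
      and sm: "\<And>x c. x \<in> carrier (bt_algebra n) \<Longrightarrow> P x \<Longrightarrow> P (c \<odot>\<^bsub>bt_algebra n\<^esub> x)"
      and pg: "\<And>x i. x \<in> carrier (bt_algebra n) \<Longrightarrow> 1 \<le> i \<Longrightarrow> i < n \<Longrightarrow> P x
        \<Longrightarrow> P (bt_g n i \<otimes>\<^bsub>bt_algebra n\<^esub> x)"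
      and pe: "\<And>x i. x \<in> carrier (bt_algebra n) \<Longrightarrow> 1 \<le> i \<Longrightarrow> i < n \<Longrightarrow> P x
        \<Longrightarrow> P (bt_e n i \<otimes>\<^bsub>bt_algebra n\<^esub> x)"
    have words: "P (bt_class n (word w))" if "set w \<subseteq> bt_gens n" for w
      using that
    proof (induction w)
      case Nil
      then show ?case using one by (simp add: bt_class_simps(4) free_algebra_simps word_def)
    next
      case (Cons a w)
      then have IH: "P (bt_class n (word w))" "set w \<subseteq> bt_gens n" "set [a] \<subseteq> bt_gens n" by auto
      have eq: "bt_class n (word (a # w)) = bt_class n (word [a]) \<otimes>\<^bsub>bt_algebra n\<^esub> bt_class n (word w)"
        using wm[OF IH(3,2)] by simp
      show ?case
      proof (cases a)
        case (G i)
        then show ?thesis using pg[OF cl[OF IH(2)] _ _ IH(1), of i] IH(3) eq by (simp add: bt_g_def)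
      next
        case (E i)
        then show ?thesis using pe[OF cl[OF IH(2)] _ _ IH(1), of i] IH(3) eq by (simp add: bt_e_def)
      qed
    qed
    obtain f where f: "f \<in> carrier (bt_free_algebra n)" "x = bt_class n f"
      using x by (auto simp: bt_class_simps(1))
    have single: "P (bt_class n (Poly_Mapping.single w c))" if "w \<in> lists (bt_gens n)" for w c
    proof -
      have w: "set w \<subseteq> bt_gens n" using that by auto
      have "P (c \<odot>\<^bsub>bt_algebra n\<^esub> bt_class n (word w))" by (rule sm[OF cl words]) (rule w)+
      moreover have "c \<odot>\<^bsub>bt_algebra n\<^esub> bt_class n (word w) = bt_class n (Poly_Mapping.single w c)"
        using w by (simp add: bt_class_smult word_carrier) (simp add: word_def free_algebra_simps)
      ultimately show ?thesis by simp
    qed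
    have "Poly_Mapping.keys f \<subseteq> lists (bt_gens n)" using f by (simp add: free_algebra_simps)
    then have "P (bt_class n f)"
    proof (induction f rule: poly_mapping_single_induct)
      case zero
      then show ?case using single[of "[]" 0] by simp
    next
      case (single w c)
      then show ?case using \<open>\<And>w c. w \<in> lists (bt_gens n) \<Longrightarrow> P (bt_class n (Poly_Mapping.single w c))\<close> by blast
    next
      case (add f h)
      then have fh: "f \<in> carrier (bt_free_algebra n)" "h \<in> carrier (bt_free_algebra n)"
        by (simp_all add: free_algebra_simps)
      then have "bt_class n f \<in> carrier (bt_algebra n)" "bt_class n h \<in> carrier (bt_algebra n)"
        by (auto simp: bt_class_simps(1))
      then have "P (bt_class n f \<oplus>\<^bsub>bt_algebra n\<^esub> bt_class n h)"
        using add \<open>\<And>x y. x \<in> carrier (bt_algebra n) \<Longrightarrow> y \<in> carrier (bt_algebra n) \<Longrightarrow> P x \<Longrightarrow> P y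
        \<Longrightarrow> P (x \<oplus>\<^bsub>bt_algebra n\<^esub> y)\<close> by blast
      then show ?case using bt_class_simps(3)[OF fh] by (simp add: free_algebra_simps(4))
    qed
    then show "P x" using f by simp
  qed
qed

section \<open>The action on tensor space\<close>

text \<open>Coefficients reach the module through a homomorphism, so that the Laurent polynomials
  (by the identity) and a field (by evaluation at a nonzero element) are treated together.\<close>

locale laurent_map =
  fixes \<phi> :: "laurent \<Rightarrow> 'r::comm_ring_1"
  assumes phi_add: "\<phi> (a + b) = \<phi> a + \<phi> b"
    and phi_mult: "\<phi> (a * b) = \<phi> a * \<phi> b"
    and phi_one [simp]: "\<phi> 1 = 1"
begin

lemma phi_zero [simp]: "\<phi> 0 = 0"
  using phi_add[of 0 0] by simp

lemma phi_uminus: "\<phi> (- a) = - \<phi> a"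
  using phi_add[of a "- a"] by (simp add: eq_neg_iff_add_eq_0 add.commute)

lemma phi_diff: "\<phi> (a - b) = \<phi> a - \<phi> b"
  using phi_add[of a "- b"] phi_uminus[of b] by simp

lemma phi_q: "\<phi> (q_pow 1) * \<phi> (q_pow (-1)) = 1"
proof -
  have "q_pow 1 * q_pow (-1) = 1" by (simp add: q_pow_def mult_single)
  then show ?thesis by (metis phi_mult phi_one)
qed

lemma act_gen_lin_ext: "act_gen \<phi> v x = lin_ext (\<lambda>w c. scale c (act_basis \<phi> w x)) v"
  by (simp add: act_gen_def lin_ext_def)

lemma act_gen_simps:
  "act_gen \<phi> 0 x = 0" "act_gen \<phi> (u + v) x = act_gen \<phi> u x + act_gen \<phi> v x"
  "act_gen \<phi> (Poly_Mapping.single w c) x = scale c (act_basis \<phi> w x)"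
  "act_gen \<phi> (scale c v) x = scale c (act_gen \<phi> v x)"
  unfolding act_gen_lin_ext
  by (simp_all add: lin_ext_add lin_ext_single) (simp add: lin_ext_scale)

lemma act_word_simps:
  "act_word \<phi> v [] = v" "act_word \<phi> v (x # xs) = act_word \<phi> (act_gen \<phi> v x) xs"
  "act_word \<phi> v (xs @ ys) = act_word \<phi> (act_word \<phi> v xs) ys"
  by (simp_all add: act_word_def)

lemma act_word_linear:
  "act_word \<phi> 0 xs = 0" "act_word \<phi> (u + v) xs = act_word \<phi> u xs + act_word \<phi> v xs"
  "act_word \<phi> (scale c v) xs = scale c (act_word \<phi> v xs)"
  by (induction xs arbitrary: u v; simp add: act_word_simps act_gen_simps)+

lemma act_free_lin_ext: "act_free \<phi> v f = lin_ext (\<lambda>xs c. scale (\<phi> c) (act_word \<phi> v xs)) f"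
  by (simp add: act_free_def lin_ext_def)

lemma act_free_right:
  "act_free \<phi> v 0 = 0" "act_free \<phi> v (f + h) = act_free \<phi> v f + act_free \<phi> v h"
  "act_free \<phi> v (Poly_Mapping.single xs c) = scale (\<phi> c) (act_word \<phi> v xs)"
  "act_free \<phi> v (scale c f) = scale (\<phi> c) (act_free \<phi> v f)"
  unfolding act_free_lin_ext
  by (simp_all add: lin_ext_add lin_ext_single phi_add) (simp add: lin_ext_scale phi_mult)

lemma act_free_diff: "act_free \<phi> v (f - h) = act_free \<phi> v f - act_free \<phi> v h"
  using act_free_right(2)[of v "f - h" h] by simp

lemma act_free_left:
  "act_free \<phi> 0 f = 0" "act_free \<phi> (u + v) f = act_free \<phi> u f + act_free \<phi> v f"
  "act_free \<phi> (scale c v) f = scale c (act_free \<phi> v f)"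
  by (simp_all add: act_free_def act_word_linear sum.distrib scale_sum mult.commute)

lemma act_free_mult:
  "act_free \<phi> v (f \<otimes>\<^bsub>free_algebra X\<^esub> h) = act_free \<phi> (act_free \<phi> v f) h"
proof -
  have "Poly_Mapping.keys f \<subseteq> UNIV" by simp
  then show ?thesis
  proof (induction f rule: poly_mapping_single_induct)
    case (single x c)
    have "Poly_Mapping.keys h \<subseteq> UNIV" by simp
    then show ?case
      by (induction h rule: poly_mapping_single_induct)
        (simp_all add: free_algebra_mult_single free_algebra_distr act_free_right act_word_simps
          act_word_linear phi_mult mult.commute)
  qed (simp_all add: free_algebra_distr act_free_right act_free_left)
qed

text \<open>Words are displayed around the two active factors, so that the simplifier can compute
  with them; \<open>i\<close> exceeds the length of the prefix by one because factors are counted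
  from 1. The two variants that follow are for a pair further to the right in a longer
  display.\<close>

lemma act_basis_at:
  assumes "i = Suc (length xs)"
  shows "act_basis \<phi> (xs @ (a, s) # (b, t) # ys) (E i) =
      (if s = t then Poly_Mapping.single (xs @ (a, s) # (b, t) # ys) 1 else 0)"
    and "act_basis \<phi> (xs @ (a, s) # (b, t) # ys) (G i) =
      (if s \<noteq> t then Poly_Mapping.single (xs @ (b, t) # (a, s) # ys) 1
       else if a = b then Poly_Mapping.single (xs @ (a, s) # (b, t) # ys) (\<phi> (q_pow 1))
       else if a < b then Poly_Mapping.single (xs @ (b, t) # (a, s) # ys) 1
       else Poly_Mapping.single (xs @ (a, s) # (b, t) # ys) (\<phi> (q_pow 1 - q_pow (-1))) +
         Poly_Mapping.single (xs @ (b, t) # (a, s) # ys) 1)"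
proof -
  have n: "(xs @ (a, s) # (b, t) # ys) ! length xs = (a, s)"
    "(xs @ (a, s) # (b, t) # ys) ! Suc (length xs) = (b, t)"
    by (simp_all add: nth_append)
  show "act_basis \<phi> (xs @ (a, s) # (b, t) # ys) (E i) =
      (if s = t then Poly_Mapping.single (xs @ (a, s) # (b, t) # ys) 1 else 0)"
    using assms n by simp
  show "act_basis \<phi> (xs @ (a, s) # (b, t) # ys) (G i) =
      (if s \<noteq> t then Poly_Mapping.single (xs @ (b, t) # (a, s) # ys) 1
       else if a = b then Poly_Mapping.single (xs @ (a, s) # (b, t) # ys) (\<phi> (q_pow 1))
       else if a < b then Poly_Mapping.single (xs @ (b, t) # (a, s) # ys) 1
       else Poly_Mapping.single (xs @ (a, s) # (b, t) # ys) (\<phi> (q_pow 1 - q_pow (-1))) +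
         Poly_Mapping.single (xs @ (b, t) # (a, s) # ys) 1)"
    using assms n by (simp add: list_update_append)
qed

lemma act_basis_at2:
  assumes "i = Suc (length xs)"
  shows "act_basis \<phi> (xs @ z # (a, s) # (b, t) # ys) (E (Suc i)) =
      (if s = t then Poly_Mapping.single (xs @ z # (a, s) # (b, t) # ys) 1 else 0)"
    and "act_basis \<phi> (xs @ z # (a, s) # (b, t) # ys) (G (Suc i)) =
      (if s \<noteq> t then Poly_Mapping.single (xs @ z # (b, t) # (a, s) # ys) 1
       else if a = b then Poly_Mapping.single (xs @ z # (a, s) # (b, t) # ys) (\<phi> (q_pow 1))
       else if a < b then Poly_Mapping.single (xs @ z # (b, t) # (a, s) # ys) 1
       else Poly_Mapping.single (xs @ z # (a, s) # (b, t) # ys) (\<phi> (q_pow 1 - q_pow (-1))) +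
         Poly_Mapping.single (xs @ z # (b, t) # (a, s) # ys) 1)"
  using act_basis_at[of "Suc i" "xs @ [z]" a s b t ys] assms by (simp_all del: act_basis.simps)

lemma act_basis_at3:
  assumes "i = Suc (length xs)" "j = Suc (Suc (i + length ys))"
  shows "act_basis \<phi> (xs @ y # z # ys @ (a, s) # (b, t) # zs) (E j) =
      (if s = t then Poly_Mapping.single (xs @ y # z # ys @ (a, s) # (b, t) # zs) 1 else 0)"
    and "act_basis \<phi> (xs @ y # z # ys @ (a, s) # (b, t) # zs) (G j) =
      (if s \<noteq> t then Poly_Mapping.single (xs @ y # z # ys @ (b, t) # (a, s) # zs) 1
       else if a = b then Poly_Mapping.single (xs @ y # z # ys @ (a, s) # (b, t) # zs) (\<phi> (q_pow 1))
       else if a < b then Poly_Mapping.single (xs @ y # z # ys @ (b, t) # (a, s) # zs) 1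
       else Poly_Mapping.single (xs @ y # z # ys @ (a, s) # (b, t) # zs) (\<phi> (q_pow 1 - q_pow (-1))) +
         Poly_Mapping.single (xs @ y # z # ys @ (b, t) # (a, s) # zs) 1)"
  using act_basis_at[of j "xs @ y # z # ys" a s b t zs] assms by (simp_all del: act_basis.simps)

declare act_basis.simps [simp del]

text \<open>An equation between explicit combinations of basis words holds already for formal
  coefficients of the words; these are the values \<open>h w\<close> below.\<close>

lemma combination_eqI:
  fixes u v :: "'w \<Rightarrow>\<^sub>0 'r::comm_ring_1"
  assumes "\<And>h. lin_ext (\<lambda>w c. c * h w) u = lin_ext (\<lambda>w c. c * h w) v"
  shows "u = v"
proof (rule poly_mapping_eqI)
  fix z
  have "lin_ext (\<lambda>w c. c * (if w = z then 1 else 0)) u = Poly_Mapping.lookup u z" for u :: "'w \<Rightarrow>\<^sub>0 'r"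
    unfolding lin_ext_def by (simp add: if_distrib in_keys_iff cong: if_cong)
  then show "Poly_Mapping.lookup u z = Poly_Mapping.lookup v z" using assms by metis
qed

lemma combination_simps:
  fixes h :: "'w \<Rightarrow> 'r::comm_ring_1"
  shows "lin_ext (\<lambda>w c. c * h w) (u + v) = lin_ext (\<lambda>w c. c * h w) u + lin_ext (\<lambda>w c. c * h w) v"
    "lin_ext (\<lambda>w c. c * h w) (Poly_Mapping.single x d) = d * h x"
    "lin_ext (\<lambda>w c. c * h w) (scale d u) = d * lin_ext (\<lambda>w c. c * h w) u"
  by (simp_all add: lin_ext_add lin_ext_single distrib_right)
    (simp add: lin_ext_scale mult.assoc distrib_left)

definition q1 :: 'r where "q1 = \<phi> (q_pow 1)"
definition q2 :: 'r where "q2 = \<phi> (q_pow 1 - q_pow (-1))"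

text \<open>The identity q^2 = 1 + q (q - q^{-1}) oriented as a rewrite rule; the second form
  applies inside longer products.\<close>

lemma q1_square: "q1 * q1 = 1 + q1 * q2" "q1 * (q1 * x) = x + q1 * (q2 * x)"
proof -
  show *: "q1 * q1 = 1 + q1 * q2"
    using phi_q by (simp add: q1_def q2_def phi_diff right_diff_distrib)
  have "q1 * (q1 * x) = (q1 * q1) * x" by (simp add: mult.assoc)
  also have "\<dots> = x + q1 * (q2 * x)" unfolding * by (simp add: algebra_simps)
  finally show "q1 * (q1 * x) = x + q1 * (q2 * x)" .
qed

lemma local_quadratic:
  assumes i: "i = Suc (length xs)"
  shows "act_word \<phi> (Poly_Mapping.single (xs @ (a, s) # (b, t) # ys) 1) [G i, G i] =
    Poly_Mapping.single (xs @ (a, s) # (b, t) # ys) 1 +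
      scale q2 (act_word \<phi> (Poly_Mapping.single (xs @ (a, s) # (b, t) # ys) 1) [E i, G i])"
proof (rule combination_eqI)
  fix h
  note simps = act_word_simps(1,2) act_gen_simps act_basis_at[OF i]
    q1_def[symmetric] q2_def[symmetric] combination_simps algebra_simps q1_square
  show "lin_ext (\<lambda>w c. c * h w) (act_word \<phi> (Poly_Mapping.single (xs @ (a, s) # (b, t) # ys) 1) [G i, G i]) =
    lin_ext (\<lambda>w c. c * h w) (Poly_Mapping.single (xs @ (a, s) # (b, t) # ys) 1 +
      scale q2 (act_word \<phi> (Poly_Mapping.single (xs @ (a, s) # (b, t) # ys) 1) [E i, G i]))"
    by (insert less_linear[of a b], elim disjE; cases "s = t") (simp_all add: simps)
qed

text \<open>Letters of different colours simply pass each other, so letters are compared only within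
  a colour. The split is first by coincidence of colours and then by the order of the letters
  concerned.\<close>

lemma local_braid:
  assumes i: "i = Suc (length xs)"
  shows "act_word \<phi> (Poly_Mapping.single (xs @ (a, s) # (b, t) # (c, u) # ys) 1) [G i, G (Suc i), G i] =
    act_word \<phi> (Poly_Mapping.single (xs @ (a, s) # (b, t) # (c, u) # ys) 1) [G (Suc i), G i, G (Suc i)]"
    (is "?l = ?r")
proof (rule combination_eqI)
  fix h
  note simps = act_word_simps(1,2) act_gen_simps act_basis_at[OF i] act_basis_at2[OF i]
    q1_def[symmetric] q2_def[symmetric] combination_simps algebra_simps q1_square
  consider "s = t" "t = u" | "s = t" "t \<noteq> u" "s \<noteq> u" | "s \<noteq> t" "t = u" "s \<noteq> u" | "s \<noteq> t" "t \<noteq> u" "s = u"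
    | "s \<noteq> t" "t \<noteq> u" "s \<noteq> u" by blast
  then show "lin_ext (\<lambda>w c. c * h w) ?l = lin_ext (\<lambda>w c. c * h w) ?r"
  proof cases
    case 1
    then show ?thesis
      by (insert less_linear[of a b] less_linear[of b c] less_linear[of a c], elim disjE)
        (simp_all add: simps)
  next
    case 2
    then show ?thesis by (insert less_linear[of a b], elim disjE) (simp_all add: simps)
  next
    case 3
    then show ?thesis by (insert less_linear[of b c], elim disjE) (simp_all add: simps)
  next
    case 4
    then show ?thesis by (insert less_linear[of a c], elim disjE) (simp_all add: simps)
  next
    case 5
    then show ?thesis by (simp add: simps)
  qed
qed

end

definition swl :: "nat \<Rightarrow> (nat \<times> nat) list \<Rightarrow> (nat \<times> nat) list"
  where "swl i w = w[i - 1 := w ! i, i := w ! (i - 1)]"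

context laurent_map
begin

text \<open>Each of these relations contains an \<open>E\<close>, which only tests colours, and
  \<open>G\<close> moves colours like a transposition. Hence the coincidences among the three
  colours decide all cases.\<close>

lemma local_relations:
  assumes i: "i = Suc (length xs)"
    and v: "v = Poly_Mapping.single (xs @ (a, s) # (b, t) # (c, u) # ys) 1"
  shows "act_word \<phi> v [E i, G (Suc i), G i] = act_word \<phi> v [G (Suc i), G i, E (Suc i)]"
    and "act_word \<phi> v [E (Suc i), G i, G (Suc i)] = act_word \<phi> v [G i, G (Suc i), E i]"
    and "act_word \<phi> v [E i, E (Suc i), G (Suc i)] = act_word \<phi> v [E i, G (Suc i), E i]"
    and "act_word \<phi> v [E (Suc i), E i, G i] = act_word \<phi> v [E (Suc i), G i, E (Suc i)]"
    and "act_word \<phi> v [E i, G (Suc i), E i] = act_word \<phi> v [G (Suc i), E i, E (Suc i)]"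
    and "act_word \<phi> v [E (Suc i), G i, E (Suc i)] = act_word \<phi> v [G i, E (Suc i), E i]"
proof -
  note simps = v act_word_simps(1,2) act_gen_simps act_basis_at[OF i] act_basis_at2[OF i]
  consider "s = t" "t = u" | "s = t" "t \<noteq> u" "s \<noteq> u" | "s \<noteq> t" "t = u" "s \<noteq> u" | "s \<noteq> t" "t \<noteq> u" "s = u"
    | "s \<noteq> t" "t \<noteq> u" "s \<noteq> u" by blast
  note c = this
  show "act_word \<phi> v [E i, G (Suc i), G i] = act_word \<phi> v [G (Suc i), G i, E (Suc i)]"
    using c by cases (simp_all add: simps)
  show "act_word \<phi> v [E (Suc i), G i, G (Suc i)] = act_word \<phi> v [G i, G (Suc i), E i]"
    using c by cases (simp_all add: simps)
  show "act_word \<phi> v [E i, E (Suc i), G (Suc i)] = act_word \<phi> v [E i, G (Suc i), E i]"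
    using c by cases (simp_all add: simps)
  show "act_word \<phi> v [E (Suc i), E i, G i] = act_word \<phi> v [E (Suc i), G i, E (Suc i)]"
    using c by cases (simp_all add: simps)
  show "act_word \<phi> v [E i, G (Suc i), E i] = act_word \<phi> v [G (Suc i), E i, E (Suc i)]"
    using c by cases (simp_all add: simps)
  show "act_word \<phi> v [E (Suc i), G i, E (Suc i)] = act_word \<phi> v [G i, E (Suc i), E i]"
    using c by cases (simp_all add: simps)
qed

lemma local_distant:
  assumes i: "i = Suc (length xs)" and j: "j = Suc (Suc (i + length ys))"
    and v: "v = Poly_Mapping.single (xs @ (c, t) # (d, u) # ys @ (a, s) # (b, t') # zs) 1"
  shows "act_word \<phi> v [G i, G j] = act_word \<phi> v [G j, G i]"
    and "act_word \<phi> v [G i, E j] = act_word \<phi> v [E j, G i]"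
    and "act_word \<phi> v [G j, E i] = act_word \<phi> v [E i, G j]"
proof -
  note simps = v act_word_simps(1,2) act_gen_simps act_basis_at[OF i] act_basis_at3[OF i j]
  show "act_word \<phi> v [G i, E j] = act_word \<phi> v [E j, G i]"
    by (cases "t = u"; cases "s = t'") (simp_all add: simps)
  show "act_word \<phi> v [G j, E i] = act_word \<phi> v [E i, G j]"
    by (cases "t = u"; cases "s = t'") (simp_all add: simps)
  show "act_word \<phi> v [G i, G j] = act_word \<phi> v [G j, G i]"
    by (cases "t = u"; cases "s = t'") (simp_all add: simps mult.commute add_ac)
qed

lemma local_ge:
  assumes i: "i = Suc (length xs)"
  shows "act_word \<phi> (Poly_Mapping.single (xs @ (a, s) # (b, t) # ys) 1) [G i, E i] =
    act_word \<phi> (Poly_Mapping.single (xs @ (a, s) # (b, t) # ys) 1) [E i, G i]"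
  by (cases "s = t") (simp_all add: act_word_simps(1,2) act_gen_simps act_basis_at[OF i])

lemma act_basis_E:
  "act_basis \<phi> w (E i) = (if snd (w ! (i - 1)) = snd (w ! i) then Poly_Mapping.single w 1 else 0)"
  by (simp add: act_basis.simps)

lemma act_basis_G:
  "act_basis \<phi> w (G i) =
    (if snd (w ! (i - 1)) \<noteq> snd (w ! i) then Poly_Mapping.single (swl i w) 1
     else if fst (w ! (i - 1)) = fst (w ! i) then Poly_Mapping.single w q1
     else if fst (w ! (i - 1)) < fst (w ! i) then Poly_Mapping.single (swl i w) 1
     else Poly_Mapping.single w q2 + Poly_Mapping.single (swl i w) 1)"
  by (cases "w ! (i - 1)"; cases "w ! i") (simp add: act_basis.simps swl_def q1_def q2_def)

section \<open>From displayed words to the defining relations\<close>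

lemma split_two:
  assumes "length w = n" "1 \<le> i" "i < n"
  obtains xs a s b t ys where "w = xs @ (a, s) # (b, t) # ys" "i = Suc (length xs)"
proof -
  have "w = take (i - 1) w @ w ! (i - 1) # w ! i # drop (Suc i) w"
    using assms id_take_nth_drop[of "i - 1" w] Cons_nth_drop_Suc[of i w] by simp
  moreover have "i = Suc (length (take (i - 1) w))" using assms by simp
  ultimately show thesis using that by (metis surj_pair)
qed

lemma split_three:
  assumes "length w = n" "1 \<le> i" "Suc i < n"
  obtains xs a s b t c u ys where "w = xs @ (a, s) # (b, t) # (c, u) # ys" "i = Suc (length xs)"
proof -
  have "w = take (i - 1) w @ w ! (i - 1) # w ! i # w ! Suc i # drop (Suc (Suc i)) w"
    using assms id_take_nth_drop[of "i - 1" w] Cons_nth_drop_Suc[of i w] Cons_nth_drop_Suc[of "Suc i" w]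
    by simp
  moreover have "i = Suc (length (take (i - 1) w))" using assms by simp
  ultimately show thesis using that by (metis surj_pair)
qed

lemma split_distant:
  assumes "length w = n" "1 \<le> i" "Suc i < j" "j < n"
  obtains xs c t d u ys a s b t' zs where "w = xs @ (c, t) # (d, u) # ys @ (a, s) # (b, t') # zs"
    "i = Suc (length xs)" "j = Suc (Suc (i + length ys))"
proof -
  obtain xs c t d u rs where w: "w = xs @ (c, t) # (d, u) # rs" "i = Suc (length xs)"
    using split_two[OF assms(1,2)] assms by (metis Suc_lessD less_trans)
  have "length rs = n - Suc i" "1 \<le> j - Suc i" "j - Suc i < n - Suc i" using w assms by auto
  then obtain ys a s b t' zs where "rs = ys @ (a, s) # (b, t') # zs" "j - Suc i = Suc (length ys)"
    using split_two by metis
  then show thesis using that[of xs c t d u ys a s b t' zs] w assms by simp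
qed

lemma act_free_words:
  "act_free \<phi> v (word xs) = act_word \<phi> v xs"
  by (simp add: word_def act_free_right)

lemma act_word_eqI:
  assumes "\<And>w. length w = n \<Longrightarrow> act_word \<phi> (Poly_Mapping.single w 1) xs = act_word \<phi> (Poly_Mapping.single w 1) ys"
    and "Poly_Mapping.keys v \<subseteq> {w. length w = n}"
  shows "act_word \<phi> v xs = act_word \<phi> v ys"
  using assms(2)
proof (induction v rule: poly_mapping_single_induct)
  case (single w c)
  have "Poly_Mapping.single w c = scale c (Poly_Mapping.single w 1)" by simp
  then show ?case using assms(1)[of w] single by (simp only: act_word_linear mem_Collect_eq)
qed (simp_all add: act_word_linear)

text \<open>By linearity it is enough to take basis words, and each can be displayed around the
  factors concerned. The local lemmas fix which index is smaller, hence the case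
  distinctions.\<close>

lemma act_free_rel:
  assumes rel: "bt_rel l r" and l: "l \<in> carrier (bt_free_algebra n)" "r \<in> carrier (bt_free_algebra n)"
    and v: "Poly_Mapping.keys v \<subseteq> {w. length w = n}"
  shows "act_free \<phi> v l = act_free \<phi> v r"
  using rel l
proof cases
  case (1 i j)
  then have b: "1 \<le> i" "i < n" "1 \<le> j" "j < n" using l by (auto simp: word_carrier)
  have *: "act_word \<phi> (Poly_Mapping.single w 1) [G i, G j] = act_word \<phi> (Poly_Mapping.single w 1) [G j, G i]"
    if w: "length w = n" for w
  proof (cases "Suc i < j")
    case True
    show ?thesis using split_distant[OF w b(1) True b(4)] local_distant(1)[OF _ _ refl] by metis
  next
    case False
    then have "Suc j < i" using 1 by simp
    then show ?thesis using split_distant[OF w b(3) _ b(2)] local_distant(1)[OF _ _ refl] by metis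
  qed
  show ?thesis unfolding 1 act_free_words by (rule act_word_eqI[OF * v])
next
  case (2 i)
  then have b: "1 \<le> i" "i < n" using l by (auto simp: word_carrier)
  have *: "act_word \<phi> (Poly_Mapping.single w 1) [G i, E i] = act_word \<phi> (Poly_Mapping.single w 1) [E i, G i]"
    if w: "length w = n" for w
    using split_two[OF w b] local_ge by metis
  show ?thesis unfolding 2 act_free_words by (rule act_word_eqI[OF * v])
next
  case (3 i j)
  then have b: "1 \<le> i" "i < n" "1 \<le> j" "j < n" using l by (auto simp: word_carrier)
  have *: "act_word \<phi> (Poly_Mapping.single w 1) [G i, G j, G i] =
    act_word \<phi> (Poly_Mapping.single w 1) [G j, G i, G j]" if w: "length w = n" for w
  proof (cases "j = Suc i")
    case True
    then show ?thesis using split_three[OF w b(1)] b local_braid by metis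
  next
    case False
    then have "i = Suc j" using 3 by simp
    then show ?thesis using split_three[OF w b(3)] b local_braid by metis
  qed
  show ?thesis unfolding 3 act_free_words by (rule act_word_eqI[OF * v])
next
  case (4 i j)
  then have b: "1 \<le> i" "i < n" "1 \<le> j" "j < n" using l by (auto simp: word_carrier)
  have *: "act_word \<phi> (Poly_Mapping.single w 1) [E i, G j, G i] =
    act_word \<phi> (Poly_Mapping.single w 1) [G j, G i, E j]" if w: "length w = n" for w
  proof (cases "j = Suc i")
    case True
    then show ?thesis using split_three[OF w b(1)] b local_relations(1)[OF _ refl] by metis
  next
    case False
    then have "i = Suc j" using 4 by simp
    then show ?thesis using split_three[OF w b(3)] b local_relations(2)[OF _ refl] by metis
  qed
  show ?thesis unfolding 4 act_free_words by (rule act_word_eqI[OF * v])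
next
  case (5 i j)
  then have b: "1 \<le> i" "i < n" "1 \<le> j" "j < n" using l by (auto simp: word_carrier)
  have *: "act_word \<phi> (Poly_Mapping.single w 1) [E i, E j, G j] =
    act_word \<phi> (Poly_Mapping.single w 1) [E i, G j, E i]" if w: "length w = n" for w
  proof (cases "j = Suc i")
    case True
    then show ?thesis using split_three[OF w b(1)] b local_relations(3)[OF _ refl] by metis
  next
    case False
    then have "i = Suc j" using 5 by simp
    then show ?thesis using split_three[OF w b(3)] b local_relations(4)[OF _ refl] by metis
  qed
  show ?thesis unfolding 5 act_free_words by (rule act_word_eqI[OF * v])
next
  case (6 i j)
  then have b: "1 \<le> i" "i < n" "1 \<le> j" "j < n" using l by (auto simp: word_carrier)
  have *: "act_word \<phi> (Poly_Mapping.single w 1) [E i, G j, E i] =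
    act_word \<phi> (Poly_Mapping.single w 1) [G j, E i, E j]" if w: "length w = n" for w
  proof (cases "j = Suc i")
    case True
    then show ?thesis using split_three[OF w b(1)] b local_relations(5)[OF _ refl] by metis
  next
    case False
    then have "i = Suc j" using 6 by simp
    then show ?thesis using split_three[OF w b(3)] b local_relations(6)[OF _ refl] by metis
  qed
  show ?thesis unfolding 6 act_free_words by (rule act_word_eqI[OF * v])
next
  case (7 i j)
  have *: "act_word \<phi> (Poly_Mapping.single w 1) [E i, E j] = act_word \<phi> (Poly_Mapping.single w 1) [E j, E i]" for w
    by (simp add: act_word_simps act_gen_simps act_basis_E)
  show ?thesis unfolding 7 act_free_words by (rule act_word_eqI[OF * v])
next
  case (8 i j)
  then have b: "1 \<le> i" "i < n" "1 \<le> j" "j < n" using l by (auto simp: word_carrier)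
  have *: "act_word \<phi> (Poly_Mapping.single w 1) [G i, E j] = act_word \<phi> (Poly_Mapping.single w 1) [E j, G i]"
    if w: "length w = n" for w
  proof (cases "Suc i < j")
    case True
    show ?thesis using split_distant[OF w b(1) True b(4)] local_distant(2)[OF _ _ refl] by metis
  next
    case False
    then have "Suc j < i" using 8 by simp
    then show ?thesis using split_distant[OF w b(3) _ b(2)] local_distant(3)[OF _ _ refl] by metis
  qed
  show ?thesis unfolding 8 act_free_words by (rule act_word_eqI[OF * v])
next
  case (9 i)
  have *: "act_word \<phi> (Poly_Mapping.single w 1) [E i, E i] = act_word \<phi> (Poly_Mapping.single w 1) [E i]" for w
    by (simp add: act_word_simps act_gen_simps act_basis_E)
  show ?thesis unfolding 9 act_free_words by (rule act_word_eqI[OF * v])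
next
  case (10 i)
  then have b: "1 \<le> i" "i < n" using l by (auto simp: word_carrier)
  have *: "act_word \<phi> (Poly_Mapping.single w 1) [G i, G i] = Poly_Mapping.single w 1 +
    scale q2 (act_word \<phi> (Poly_Mapping.single w 1) [E i, G i])" if w: "length w = n" for w
    using split_two[OF w b] local_quadratic by metis
  have "act_word \<phi> v [G i, G i] = v + scale q2 (act_word \<phi> v [E i, G i])"
    using v
  proof (induction v rule: poly_mapping_single_induct)
    case (single w c)
    let ?w = "Poly_Mapping.single w 1"
    have w: "Poly_Mapping.single w c = scale c ?w" by simp
    have "act_word \<phi> (scale c ?w) [G i, G i] = scale c (?w + scale q2 (act_word \<phi> ?w [E i, G i]))"
      using *[of w] single by (simp only: act_word_linear mem_Collect_eq)
    also have "\<dots> = scale c ?w + scale q2 (scale c (act_word \<phi> ?w [E i, G i]))"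
      by (simp only: scale_simps mult.commute)
    finally show ?case unfolding w act_word_linear .
  qed (simp_all add: act_word_linear)
  then show ?thesis unfolding 10 by (simp add: act_free_right act_free_words act_word_simps q2_def)
qed

end

section \<open>Tensor space as a module\<close>

definition basis_words :: "nat \<Rightarrow> nat \<Rightarrow> nat \<Rightarrow> (nat \<times> nat) list set"
  where "basis_words n N r = {w. length w = n \<and> set w \<subseteq> {1..N} \<times> {1..r}}"

lemma tensor_space_iff: "v \<in> tensor_space n N r \<longleftrightarrow> Poly_Mapping.keys v \<subseteq> basis_words n N r"
  by (auto simp: tensor_space_def basis_words_def)

text \<open>List positions start at 0 whereas permutations act on \<open>{1..n}\<close>; the shift
  is confined to this place.\<close>

definition factor :: "(nat \<times> nat) list \<Rightarrow> nat \<Rightarrow> nat \<times> nat"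
  where "factor w k = w ! (k - 1)"

lemma factor_swl:
  assumes "length w = n" "1 \<le> i" "i < n" "1 \<le> k" "k \<le> n"
  shows "factor (swl i w) k = factor w (sw i k)"
  using assms by (auto simp: factor_def swl_def nth_list_update transpose_def)

lemma swl_basis_words:
  assumes "w \<in> basis_words n N r" "1 \<le> i" "i < n"
  shows "swl i w \<in> basis_words n N r"
proof -
  have "set (swl i w) \<subseteq> insert (w ! i) (insert (w ! (i - 1)) (set w))"
    unfolding swl_def by (meson insert_mono order_trans set_update_subset_insert insert_subsetI subset_insertI2 order_refl insert_commute set_update_subsetI subset_insertI insertI1 insertI2)
  moreover have "w ! i \<in> set w" "w ! (i - 1) \<in> set w" using assms by (auto simp: basis_words_def)
  ultimately show ?thesis using assms by (auto simp: basis_words_def swl_def)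
qed

locale bt_action = laurent_map \<phi> for \<phi> :: "laurent \<Rightarrow> 'r::comm_ring_1" +
  fixes n N r :: nat

sublocale bt_action \<subseteq> bt "bt_algebra n" n "bt_g n" "bt_e n" "bt_E n"
  by (rule bt_bt_algebra)

context bt_action
begin

abbreviation "V \<equiv> tensor_space n N r :: 'r tensors set"
abbreviation "W \<equiv> basis_words n N r"
abbreviation "act \<equiv> act_bt \<phi>"
abbreviation "B \<equiv> bt_algebra n"

abbreviation bvec :: "(nat \<times> nat) list \<Rightarrow> 'r tensors"
  where "bvec w \<equiv> Poly_Mapping.single w 1"

lemma V_closed [simp]:
  "0 \<in> V" "u \<in> V \<Longrightarrow> v \<in> V \<Longrightarrow> u + v \<in> V" "v \<in> V \<Longrightarrow> scale c v \<in> V"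
  "w \<in> W \<Longrightarrow> Poly_Mapping.single w c \<in> V"
  using keys_add[of u v] keys_scale[of c v] by (auto simp: tensor_space_iff)

lemma act_basis_V:
  assumes "w \<in> W" "x \<in> bt_gens n"
  shows "act_basis \<phi> w x \<in> V"
proof (cases x)
  case (G i)
  then have "swl i w \<in> W" using assms swl_basis_words by simp
  then show ?thesis using assms G by (simp add: act_basis_G)
next
  case (E i)
  then show ?thesis using assms by (simp add: act_basis_E)
qed

lemma act_gen_V:
  assumes "v \<in> V" "x \<in> bt_gens n"
  shows "act_gen \<phi> v x \<in> V"
proof -
  have "Poly_Mapping.keys v \<subseteq> W" using assms by (simp add: tensor_space_iff)
  then show ?thesis
    by (induction v rule: poly_mapping_single_induct) (simp_all add: act_gen_simps act_basis_V assms)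
qed

lemma act_word_V: "v \<in> V \<Longrightarrow> set xs \<subseteq> bt_gens n \<Longrightarrow> act_word \<phi> v xs \<in> V"
  by (induction xs arbitrary: v) (simp_all add: act_word_simps act_gen_V)

lemma act_free_V:
  assumes "v \<in> V" "f \<in> carrier (bt_free_algebra n)"
  shows "act_free \<phi> v f \<in> V"
proof -
  have "Poly_Mapping.keys f \<subseteq> lists (bt_gens n)" using assms by (simp add: free_algebra_simps)
  then show ?thesis
  proof (induction f rule: poly_mapping_single_induct)
    case (single xs c)
    then have "act_word \<phi> v xs \<in> V" using assms by (intro act_word_V) auto
    then show ?case by (simp add: act_free_right)
  qed (simp_all add: act_free_right)
qed

text \<open>The elements acting as zero form an ideal, and by \<open>act_free_rel\<close> it
  contains the relators.\<close>

lemma act_free_bt_ideal: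
  assumes "f \<in> bt_ideal n" "v \<in> V"
  shows "act_free \<phi> v f = 0"
proof -
  interpret S: salg "bt_free_algebra n" by (rule salg_free_algebra)
  define K where "K = {f \<in> carrier (bt_free_algebra n). \<forall>v\<in>V. act_free \<phi> v f = 0}"
  have "ideal K (bt_free_algebra n)"
    unfolding K_def
    by (rule ideal_annihilator[OF S.ring_axioms])
      (simp_all add: free_algebra_simps(4) act_free_right act_free_mult act_free_V act_free_left)
  moreover have "bt_relators n \<subseteq> K"
  proof
    fix f assume f: "f \<in> bt_relators n"
    then obtain l r where lr: "f = l - r" "bt_rel l r" "l \<in> carrier (bt_free_algebra n)"
      "r \<in> carrier (bt_free_algebra n)" by (auto simp: bt_relators_def)
    have "act_free \<phi> v f = 0" if "v \<in> V" for v
    proof -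
      have "Poly_Mapping.keys v \<subseteq> {w. length w = n}"
        using that by (auto simp: tensor_space_iff basis_words_def)
      then show ?thesis using act_free_rel[OF lr(2-4)] lr(1) act_free_diff by simp
    qed
    then show "f \<in> K" using f bt_relators_carrier by (auto simp: K_def)
  qed
  ultimately have "bt_ideal n \<subseteq> K"
    unfolding bt_ideal_def bt_relators_def[symmetric] by (rule S.genideal_minimal)
  then show ?thesis using assms by (auto simp: K_def)
qed

text \<open>Representatives differ by elements that act as zero, so the image of a coset is a
  singleton and \<open>the_elem\<close> returns the common value.\<close>

lemma act_class:
  assumes v: "v \<in> V" and f: "f \<in> carrier (bt_free_algebra n)"
  shows "act v (bt_class n f) = act_free \<phi> v f"
proof -
  have eq: "act_free \<phi> v h = act_free \<phi> v f" if "h \<in> bt_class n f" for h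
  proof -
    have h: "h \<in> carrier (bt_free_algebra n)" "h \<ominus>\<^bsub>bt_free_algebra n\<^esub> f \<in> bt_ideal n"
      using that ideal_coset_mem_iff[OF ideal_bt_ideal f] by auto
    then have "h - f \<in> bt_ideal n" using f by (simp add: free_algebra_minus)
    then show ?thesis using act_free_bt_ideal[OF _ v] act_free_diff by fastforce
  qed
  have "f \<in> bt_class n f"
  proof -
    interpret I: ideal "bt_ideal n" "bt_free_algebra n" by (rule ideal_bt_ideal)
    show ?thesis using f by (rule I.a_rcos_self)
  qed
  then have "act_free \<phi> v ` bt_class n f = {act_free \<phi> v f}" using eq by blast
  then show ?thesis by (simp add: act_bt_def)
qed

lemma class_cases:
  assumes "a \<in> carrier B"
  obtains f where "f \<in> carrier (bt_free_algebra n)" "a = bt_class n f"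
  using assms by (auto simp: bt_class_simps(1))

lemma act_closed [simp]: "v \<in> V \<Longrightarrow> a \<in> carrier B \<Longrightarrow> act v a \<in> V"
  by (metis class_cases act_class act_free_V)

lemma act_add_r:
  assumes "v \<in> V" "a \<in> carrier B" "b \<in> carrier B"
  shows "act v (a \<oplus>\<^bsub>B\<^esub> b) = act v a + act v b"
proof -
  obtain f h where fh: "f \<in> carrier (bt_free_algebra n)" "a = bt_class n f"
    "h \<in> carrier (bt_free_algebra n)" "b = bt_class n h"
    using assms class_cases by metis
  interpret S: salg "bt_free_algebra n" by (rule salg_free_algebra)
  have s: "f + h \<in> carrier (bt_free_algebra n)" using S.a_closed[OF fh(1,3)] by (simp add: free_algebra_simps(4))
  show ?thesis using assms fh bt_class_simps(3)[OF fh(1,3)] s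
    by (simp add: act_class free_algebra_simps(4) act_free_right)
qed

lemma act_smult:
  assumes "v \<in> V" "a \<in> carrier B"
  shows "act v (c \<odot>\<^bsub>B\<^esub> a) = scale (\<phi> c) (act v a)"
proof -
  obtain f where f: "f \<in> carrier (bt_free_algebra n)" "a = bt_class n f"
    using assms class_cases by metis
  interpret S: salg "bt_free_algebra n" by (rule salg_free_algebra)
  have s: "scale c f \<in> carrier (bt_free_algebra n)"
    using S.smult_closed[OF f(1), of c] by (simp add: free_algebra_simps(5))
  show ?thesis using assms f bt_class_smult[OF f(1), of c] s
    by (simp add: act_class free_algebra_simps(5) act_free_right)
qed

lemma act_mult:
  assumes "v \<in> V" "a \<in> carrier B" "b \<in> carrier B"
  shows "act v (a \<otimes>\<^bsub>B\<^esub> b) = act (act v a) b"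
proof -
  obtain f h where fh: "f \<in> carrier (bt_free_algebra n)" "a = bt_class n f"
    "h \<in> carrier (bt_free_algebra n)" "b = bt_class n h"
    using assms class_cases by metis
  interpret S: salg "bt_free_algebra n" by (rule salg_free_algebra)
  show ?thesis using assms fh bt_class_simps(2)[OF fh(1,3)] S.m_closed[OF fh(1,3)]
    by (simp add: act_class act_free_mult act_free_V)
qed

lemma act_one [simp]: "v \<in> V \<Longrightarrow> act v \<one>\<^bsub>B\<^esub> = v"
  by (simp add: bt_class_simps(4) act_class free_algebra_simps act_free_right act_word_simps)

lemma act_zero [simp]: "v \<in> V \<Longrightarrow> act v \<zero>\<^bsub>B\<^esub> = 0"
  by (simp add: bt_class_simps(5) act_class free_algebra_simps act_free_right)

lemma act_left:
  "a \<in> carrier B \<Longrightarrow> act 0 a = 0"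
  "u \<in> V \<Longrightarrow> v \<in> V \<Longrightarrow> a \<in> carrier B \<Longrightarrow> act (u + v) a = act u a + act v a"
  "v \<in> V \<Longrightarrow> a \<in> carrier B \<Longrightarrow> act (scale c v) a = scale c (act v a)"
  by (metis class_cases act_class act_free_left V_closed)+

lemma act_g: "v \<in> V \<Longrightarrow> 1 \<le> i \<Longrightarrow> i < n \<Longrightarrow> act v (bt_g n i) = act_gen \<phi> v (G i)"
  by (simp add: bt_g_def act_class word_carrier act_free_words act_word_simps)

lemma act_e: "v \<in> V \<Longrightarrow> 1 \<le> i \<Longrightarrow> i < n \<Longrightarrow> act v (bt_e n i) = act_gen \<phi> v (E i)"
  by (simp add: bt_e_def act_class word_carrier act_free_words act_word_simps)

text \<open>Meant for colour tests on vectors whose basis words all have the same colours, such as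
  the image of one word under \<open>g i\<close>.\<close>

lemma act_uniform:
  assumes "v \<in> V" "a \<in> carrier B"
    "\<And>w. w \<in> Poly_Mapping.keys v \<Longrightarrow> act (bvec w) a = (if P then bvec w else 0)"
  shows "act v a = (if P then v else 0)"
proof -
  have "Poly_Mapping.keys v \<subseteq> W \<inter> {w. act (bvec w) a = (if P then bvec w else 0)}"
    using assms by (auto simp: tensor_space_iff)
  then show ?thesis
  proof (induction v rule: poly_mapping_single_induct)
    case (single w c)
    have "Poly_Mapping.single w c = scale c (bvec w)" by simp
    then show ?case using single act_left(3)[of "bvec w" a c] assms(2) by auto
  next
    case (add f g)
    then have "f \<in> V" "g \<in> V" by (auto simp: tensor_space_iff)
    then show ?case using add assms(2) act_left(2) by simp
  qed (simp add: act_left assms(2))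
qed

lemma act_eqI:
  assumes "v \<in> V" "a \<in> carrier B" "\<And>w. w \<in> W \<Longrightarrow> act (bvec w) a = 0"
  shows "act v a = 0"
  using act_uniform[OF assms(1,2), of False] assms(1,3) by (auto simp: tensor_space_iff)

end

section \<open>The standard elements on basis words\<close>

text \<open>Both maps enumerate the same set in increasing order: at the first disagreement the
  smaller value would have no preimage under the other map.\<close>

lemma strict_mono_images_eq:
  fixes f h :: "nat \<Rightarrow> nat"
  assumes f: "strict_mono_on K f" and h: "strict_mono_on K h" and img: "f ` K = h ` K" and k: "k \<in> K"
  shows "f k = h k"
  using k
proof (induction k rule: less_induct)
  case (less k)
  have aux: "\<not> f' k < h' k" if m: "strict_mono_on K f'" "strict_mono_on K h'" "f' ` K = h' ` K"
    "\<forall>l\<in>K. l < k \<longrightarrow> f' l = h' l" for f' h' :: "nat \<Rightarrow> nat"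
  proof
    assume lt: "f' k < h' k"
    obtain l where l: "l \<in> K" "f' k = h' l" using m(3) less.prems by blast
    have "\<not> k \<le> l" using strict_mono_on_leD[OF m(2) less.prems l(1)] lt l(2) by linarith
    then have "l < k" by simp
    then show False using m(4) l strict_mono_onD[OF m(1) l(1) less.prems] by fastforce
  qed
  have "\<not> f k < h k" using aux[OF f h img] less.IH by blast
  moreover have "\<not> h k < f k" using aux[OF h f img[symmetric]] less.IH by force
  ultimately show ?case by linarith
qed

context bt_action
begin

lemma idem_eq: "idem \<alpha> = bt_idem n \<alpha>"
proof -
  have "E_partition P = bt_E_partition n P" for P
  proof -
    have f: "(\<lambda>p x. (case p of (i, j) \<Rightarrow> bt_E n i j) \<otimes>\<^bsub>B\<^esub> x) = (\<lambda>(i, j) x. bt_E n i j \<otimes>\<^bsub>B\<^esub> x)"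
      by (simp add: fun_eq_iff split: prod.splits)
    show ?thesis
      unfolding E_partition_def bt_E_partition_def lprod_def ipairs_def same_def f ..
  qed
  then show ?thesis
    unfolding idem_def bt_idem_def idem_partition_def bt_idem_partition_def by simp
qed

lemma gen_eq: "gen \<alpha> i = ptl_gen n \<alpha> i"
  unfolding gen_def ptl_gen_def St_def steinberg_def idem_eq Let_def ..

lemma act_g_basis:
  assumes "w \<in> W" "1 \<le> i" "i < n"
  shows "act (bvec w) (bt_g n i) =
    (if snd (factor w i) \<noteq> snd (factor w (Suc i)) then bvec (swl i w)
     else if fst (factor w i) = fst (factor w (Suc i)) then Poly_Mapping.single w q1
     else if fst (factor w i) < fst (factor w (Suc i)) then bvec (swl i w)
     else Poly_Mapping.single w q2 + bvec (swl i w))"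
  using assms by (simp add: act_g act_gen_simps act_basis_G factor_def)

text \<open>The word that stays in place occurs only when the two colours coincide, so the colours
  are exchanged in every term.\<close>

lemma act_g_keys:
  assumes w: "w \<in> W" and i: "1 \<le> i" "i < n"
    and z: "z \<in> Poly_Mapping.keys (act (bvec w) (bt_g n i))" and k: "1 \<le> k" "k \<le> n"
  shows "snd (factor z k) = snd (factor w (sw i k))"
proof -
  have len: "length w = n" using w by (simp add: basis_words_def)
  have "z = swl i w \<or> (z = w \<and> snd (factor w i) = snd (factor w (Suc i)))"
    using z act_g_basis[OF w i] keys_add[of "Poly_Mapping.single w q2" "bvec (swl i w)"]
    by (auto split: if_splits)
  then show ?thesis
    using factor_swl[OF len i k] by (auto simp: transpose_def)
qed

text \<open>The recursion conjugates by \<open>g i\<close>. All words in the image of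
  \<open>w\<close> under \<open>g i\<close> have the same colours, so the shorter idempotent acts
  there as 0 or 1, and the inverse of \<open>g i\<close> restores \<open>w\<close>.\<close>

lemma act_Eij:
  "w \<in> W \<Longrightarrow> 1 \<le> i \<Longrightarrow> i < j \<Longrightarrow> j \<le> n \<Longrightarrow>
    act (bvec w) (bt_E n i j) =
      (if snd (factor w i) = snd (factor w j) then bvec w else 0)"
proof (induction "j - i" arbitrary: i w rule: less_induct)
  case less
  show ?case
  proof (cases "j = Suc i")
    case True
    then have "bt_E n i j = bt_e n i" using less.prems Eij_Suc by simp
    then show ?thesis using True less.prems by (simp add: act_e act_gen_simps act_basis_E factor_def)
  next
    case False
    then have j: "Suc i < j" using less.prems by simp
    have i: "1 \<le> i" "i < n" using less.prems by auto
    let ?X = "bt_E n (Suc i) j" and ?u = "bt_g n i" and ?w = "bvec w :: 'r tensors"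
    define c where "c \<longleftrightarrow> snd (factor w i) = snd (factor w j)"
    define v where "v = act ?w ?u"
    have cl: "?X \<in> carrier B" "?u \<in> carrier B" "?u \<in> Units B" "inv\<^bsub>B\<^esub> ?u \<in> carrier B" using less.prems j i by auto
    have wV: "?w \<in> V" using less.prems by simp
    have vV: "v \<in> V" using wV cl by (simp add: v_def)
    have "act v ?X = (if c then v else 0)"
    proof (rule act_uniform[OF vV cl(1)])
      fix z assume z: "z \<in> Poly_Mapping.keys v"
      then have zW: "z \<in> W" using vV by (auto simp: tensor_space_iff)
      have "snd (factor z (Suc i)) = snd (factor w i)" "snd (factor z j) = snd (factor w j)"
        using act_g_keys[OF less.prems(1) i z[unfolded v_def], of "Suc i"]
          act_g_keys[OF less.prems(1) i z[unfolded v_def], of j] less.prems j by simp_all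
      then show "act (bvec z) ?X = (if c then bvec z else 0)"
        using less.hyps[OF _ zW _ j] less.prems by (simp add: c_def)
    qed
    moreover have "act v (inv\<^bsub>B\<^esub> ?u) = ?w"
      unfolding v_def using act_mult[OF wV cl(2,4)] cl(3) wV by simp
    ultimately have "act (act v ?X) (inv\<^bsub>B\<^esub> ?u) = (if c then ?w else 0)"
      using cl act_left(1) by simp
    moreover have "act ?w (bt_E n i j) = act (act v ?X) (inv\<^bsub>B\<^esub> ?u)"
      using cl wV vV Eij_rec[OF less.prems(2) j less.prems(4)] by (simp add: act_mult v_def)
    ultimately show ?thesis by (simp add: c_def)
  qed
qed

lemma act_lprod:
  assumes w: "w \<in> W" and f: "\<And>p. p \<in> set xs \<Longrightarrow> f p \<in> carrier B"
    "\<And>p. p \<in> set xs \<Longrightarrow> act (bvec w) (f p) = (if Q p then bvec w else 0)"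
  shows "act (bvec w) (lprod f xs) =
    (if \<forall>p\<in>set xs. Q p then bvec w else 0)"
  using f
proof (induction xs)
  case (Cons p xs)
  have cl: "f p \<in> carrier B" "lprod f xs \<in> carrier B" using Cons.prems(1) by auto
  have "act (bvec w) (f p \<otimes>\<^bsub>B\<^esub> lprod f xs) =
    act (if Q p then bvec w else 0) (lprod f xs)"
    using w cl Cons.prems(2)[of p] by (simp add: act_mult)
  then show ?case using Cons cl act_left(1) by auto
qed (use w in simp)

text \<open>Every factor tests one pair of colours; together they select the words whose colouring
  has exactly the blocks of \<open>P\<close>.\<close>

lemma act_F:
  assumes w: "w \<in> W"
  shows "act (bvec w) (F P) =
    (if \<forall>i j. 1 \<le> i \<longrightarrow> i < j \<longrightarrow> j \<le> n \<longrightarrow> same P i j = (snd (factor w i) = snd (factor w j))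
     then bvec w else 0)"
proof -
  have "act (bvec w) (F P) =
    (if \<forall>p\<in>set (ipairs n (\<lambda>_ _. True)). same P (fst p) (snd p) = (snd (factor w (fst p)) = snd (factor w (snd p)))
     then bvec w else 0)"
    unfolding F_def
  proof (rule act_lprod[OF w F_factor_closed])
    fix p assume p: "p \<in> set (ipairs n (\<lambda>_ _. True))"
    obtain i j where [simp]: "p = (i, j)" by (cases p)
    have ij: "1 \<le> i" "i < j" "j \<le> n" using p by (auto simp: set_ipairs)
    have E: "bt_E n i j \<in> carrier B" using ij by simp
    have wV: "bvec w \<in> V" using w by simp
    note AE = act_Eij[OF w ij]
    have "act (bvec w) (\<one>\<^bsub>B\<^esub> \<ominus>\<^bsub>B\<^esub> bt_E n i j) +
      act (bvec w) (bt_E n i j) = bvec w"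
      using E act_add_r[OF wV, of "\<one>\<^bsub>B\<^esub> \<ominus>\<^bsub>B\<^esub> bt_E n i j" "bt_E n i j"] w
      by (simp add: minus_eq a_assoc l_neg)
    then have "act (bvec w) (\<one>\<^bsub>B\<^esub> \<ominus>\<^bsub>B\<^esub> bt_E n i j) =
      (if snd (factor w i) = snd (factor w j) then 0 else bvec w)"
      unfolding AE by (auto split: if_splits)
    then show "act (bvec w)
      (case p of (i, j) \<Rightarrow> if same P i j then bt_E n i j else \<one>\<^bsub>B\<^esub> \<ominus>\<^bsub>B\<^esub> bt_E n i j) =
      (if same P (fst p) (snd p) = (snd (factor w (fst p)) = snd (factor w (snd p)))
       then bvec w else 0)"
      using AE by simp
  qed
  also have "(\<forall>p\<in>set (ipairs n (\<lambda>_ _. True)). same P (fst p) (snd p) = (snd (factor w (fst p)) = snd (factor w (snd p))))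
    \<longleftrightarrow> (\<forall>i j. 1 \<le> i \<longrightarrow> i < j \<longrightarrow> j \<le> n \<longrightarrow> same P i j = (snd (factor w i) = snd (factor w j)))"
    by (auto simp: set_ipairs)
  finally show ?thesis .
qed

text \<open>A basis word consists of coloured letters.  Multiplication by \<open>g i\<close> raises the number of
  inversions between letters of the same colour by at most one, and only if it interchanges
  two letters of the same colour that are in increasing order.\<close>

definition word_inv :: "(nat \<times> nat) list \<Rightarrow> nat"
  where "word_inv w = ninv n (\<lambda>k l. snd (factor w k) = snd (factor w l) \<and> fst (factor w l) < fst (factor w k))"

text \<open>For a word coloured by the blocks of \<open>P\<close> this is \<open>blinv n P\<close>.
  In terms of colours it can be followed along a reduced expression, where the colouring
  moves.\<close>

definition colour_inv :: "(nat \<times> nat) list \<Rightarrow> (nat \<Rightarrow> nat) \<Rightarrow> nat"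
  where "colour_inv w \<sigma> = ninv n (\<lambda>k l. snd (factor w k) = snd (factor w l) \<and> \<sigma> l < \<sigma> k)"

text \<open>The condition under which \<open>T\<close> merely permutes the letters: whenever two
  letters of one colour are exchanged, they are in strictly increasing order, so no scalar terms
  appear.\<close>

definition adapted :: "(nat \<times> nat) list \<Rightarrow> (nat \<Rightarrow> nat) \<Rightarrow> bool"
  where "adapted w \<sigma> \<longleftrightarrow> (\<forall>k l. 1 \<le> k \<longrightarrow> k < l \<longrightarrow> l \<le> n \<longrightarrow> snd (factor w k) = snd (factor w l)
    \<longrightarrow> \<sigma> l < \<sigma> k \<longrightarrow> fst (factor w k) < fst (factor w l))"

lemma sw_range: "1 \<le> i \<Longrightarrow> i < n \<Longrightarrow> 1 \<le> k \<Longrightarrow> k \<le> n \<Longrightarrow> 1 \<le> sw i k \<and> sw i k \<le> n"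
  by (auto simp: transpose_def)

lemma sw_less: "k < l \<Longrightarrow> \<not> (k = i \<and> l = Suc i) \<Longrightarrow> sw i k < sw i l"
  by (auto simp: transpose_def)

lemma word_inv_swl:
  assumes w: "length w = n" and i: "1 \<le> i" "i < n"
  shows "word_inv (swl i w) +
      of_bool (snd (factor w i) = snd (factor w (Suc i)) \<and> fst (factor w (Suc i)) < fst (factor w i)) =
    word_inv w +
      of_bool (snd (factor w i) = snd (factor w (Suc i)) \<and> fst (factor w i) < fst (factor w (Suc i)))"
proof -
  let ?Q = "\<lambda>k l. snd (factor w k) = snd (factor w l) \<and> fst (factor w l) < fst (factor w k)"
  have "word_inv (swl i w) = ninv n (\<lambda>k l. ?Q (sw i k) (sw i l))"
    unfolding word_inv_def by (rule ninv_cong) (use factor_swl[OF w i] in simp)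
  then show ?thesis using ninv_swap[OF i, of ?Q] by (simp add: word_inv_def eq_commute)
qed

lemma colour_inv_swl:
  assumes w: "length w = n" and i: "1 \<le> i" "i < n" and asc: "\<sigma> i < \<sigma> (Suc i)"
  shows "colour_inv w (\<sigma> \<circ> sw i) = colour_inv (swl i w) \<sigma> + of_bool (snd (factor w i) = snd (factor w (Suc i)))"
    and "snd (factor w i) = snd (factor w (Suc i)) \<Longrightarrow> colour_inv (swl i w) \<sigma> = colour_inv w \<sigma>"
proof -
  let ?w = "swl i w"
  let ?P = "\<lambda>k l. snd (factor ?w k) = snd (factor ?w l) \<and> \<sigma> l < \<sigma> k"
  have "colour_inv w (\<sigma> \<circ> sw i) = ninv n (\<lambda>k l. ?P (sw i k) (sw i l))"
    unfolding colour_inv_def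
  proof (rule ninv_cong)
    fix a b assume ab: "1 \<le> a" "a < b" "b \<le> n"
    have "factor ?w (sw i a) = factor w a" "factor ?w (sw i b) = factor w b"
      using factor_swl[OF w i, of "sw i a"] factor_swl[OF w i, of "sw i b"] sw_range[OF i, of a]
        sw_range[OF i, of b] ab by simp_all
    then show "(snd (factor w a) = snd (factor w b) \<and> (\<sigma> \<circ> sw i) b < (\<sigma> \<circ> sw i) a) =
      (snd (factor ?w (sw i a)) = snd (factor ?w (sw i b)) \<and> \<sigma> (sw i b) < \<sigma> (sw i a))" by simp
  qed
  moreover have "factor ?w i = factor w (Suc i)" "factor ?w (Suc i) = factor w i"
    using factor_swl[OF w i, of i] factor_swl[OF w i, of "Suc i"] i by simp_all
  ultimately show "colour_inv w (\<sigma> \<circ> sw i) = colour_inv ?w \<sigma> + of_bool (snd (factor w i) = snd (factor w (Suc i)))"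
    using ninv_swap[OF i, of ?P] asc by (simp add: colour_inv_def)
  assume same: "snd (factor w i) = snd (factor w (Suc i))"
  have "snd (factor ?w k) = snd (factor w k)" if "1 \<le> k" "k \<le> n" for k
    using factor_swl[OF w i that] same by (simp add: transpose_def)
  then show "colour_inv ?w \<sigma> = colour_inv w \<sigma>"
    unfolding colour_inv_def by (intro ninv_cong) simp
qed

text \<open>Composing with \<open>sw i\<close> renames the other pairs and creates an inversion at
  \<open>(i, Suc i)\<close>. This pair contributes the condition on the first exchange.\<close>

lemma adapted_swl:
  assumes w: "length w = n" and i: "1 \<le> i" "i < n" and asc: "\<sigma> i < \<sigma> (Suc i)"
  shows "adapted w (\<sigma> \<circ> sw i) \<longleftrightarrow> adapted (swl i w) \<sigma> \<and>
    (snd (factor w i) = snd (factor w (Suc i)) \<longrightarrow> fst (factor w i) < fst (factor w (Suc i)))"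
proof -
  have fs: "factor (swl i w) (sw i k) = factor w k" "factor (swl i w) k = factor w (sw i k)"
    if "1 \<le> k" "k \<le> n" for k
    using factor_swl[OF w i, of "sw i k"] factor_swl[OF w i that] sw_range[OF i that] by simp_all
  show ?thesis
  proof (intro iffI conjI)
    assume ad: "adapted w (\<sigma> \<circ> sw i)"
    show "snd (factor w i) = snd (factor w (Suc i)) \<longrightarrow> fst (factor w i) < fst (factor w (Suc i))"
      using ad[unfolded adapted_def, rule_format, of i "Suc i"] i asc by simp
    show "adapted (swl i w) \<sigma>"
      unfolding adapted_def
    proof (intro allI impI)
      fix k l assume kl: "1 \<le> k" "k < l" "l \<le> n" "snd (factor (swl i w) k) = snd (factor (swl i w) l)" "\<sigma> l < \<sigma> k"
      have "\<not> (k = i \<and> l = Suc i)" using kl(5) asc by auto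
      then have "sw i k < sw i l" using kl sw_less by blast
      then show "fst (factor (swl i w) k) < fst (factor (swl i w) l)"
        using ad[unfolded adapted_def, rule_format, of "sw i k" "sw i l"] kl fs[of k] fs[of l]
          sw_range[OF i, of k] sw_range[OF i, of l] by simp
    qed
  next
    assume h: "adapted (swl i w) \<sigma> \<and>
      (snd (factor w i) = snd (factor w (Suc i)) \<longrightarrow> fst (factor w i) < fst (factor w (Suc i)))"
    show "adapted w (\<sigma> \<circ> sw i)"
      unfolding adapted_def
    proof (intro allI impI)
      fix k l assume kl: "1 \<le> k" "k < l" "l \<le> n" "snd (factor w k) = snd (factor w l)"
        "(\<sigma> \<circ> sw i) l < (\<sigma> \<circ> sw i) k"
      show "fst (factor w k) < fst (factor w l)"
      proof (cases "k = i \<and> l = Suc i")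
        case True
        then show ?thesis using h kl by simp
      next
        case False
        then have "sw i k < sw i l" using kl sw_less by blast
        then show ?thesis
          using conjunct1[OF h, unfolded adapted_def, rule_format, of "sw i k" "sw i l"] kl fs[of k] fs[of l]
            sw_range[OF i, of k] sw_range[OF i, of l] by simp
      qed
    qed
  qed
qed

text \<open>Along a reduced expression the bound grows by one at every step that meets equal
  colours, the inversions of the word by at most one. Equality forces an actual increase at each of
  these steps, which is adaptedness.\<close>

lemma act_T_keys:
  assumes "is_T \<sigma> x" "w \<in> W" "z \<in> Poly_Mapping.keys (act (bvec w) x)"
  shows "word_inv z \<le> word_inv w + colour_inv w \<sigma> \<and>
    (word_inv z = word_inv w + colour_inv w \<sigma> \<longrightarrow> adapted w \<sigma>)"
  using assms
proof (induction arbitrary: w rule: is_T.induct)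
  case is_T_id
  then have "z = w" by simp
  moreover have "adapted w id" by (simp add: adapted_def)
  ultimately show ?case by (simp only: le_add1 simp_thms)
next
  case (is_T_swap \<sigma> x i)
  note i = \<open>1 \<le> i\<close> \<open>i < n\<close> and asc = \<open>\<sigma> i < \<sigma> (Suc i)\<close> and w = \<open>w \<in> W\<close>
  have len: "length w = n" using w by (simp add: basis_words_def)
  have w': "swl i w \<in> W" by (rule swl_basis_words[OF w i])
  have cl: "x \<in> carrier B" "bt_g n i \<in> carrier B" using is_T_props[OF is_T_swap.hyps(1)] i by auto
  have scal: "act (Poly_Mapping.single u c) x = scale c (act (bvec u) x)" if "u \<in> W" for u c
    using act_left(3)[of "bvec u" x c] cl that by simp
  have keys_scal: "Poly_Mapping.keys (act (Poly_Mapping.single u c) x) \<subseteq>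
    Poly_Mapping.keys (act (bvec u) x)" if "u \<in> W" for u c
    unfolding scal[OF that, of c] by (rule keys_scale)
  have z: "z \<in> Poly_Mapping.keys (act (act (bvec w) (bt_g n i)) x)"
    using is_T_swap.prems cl by (simp add: act_mult)
  note ci = colour_inv_swl[OF len i asc] and ad = adapted_swl[OF len i asc] and wi = word_inv_swl[OF len i]
  let ?same = "snd (factor w i) = snd (factor w (Suc i))"
  let ?lt = "fst (factor w i) < fst (factor w (Suc i))" and ?gt = "fst (factor w (Suc i)) < fst (factor w i)"
  have "(z \<in> Poly_Mapping.keys (act (bvec (swl i w)) x)) \<or>
    (?same \<and> z \<in> Poly_Mapping.keys (act (bvec w) x))"
  proof -
    consider "\<not> ?same \<or> ?lt" | "?same" "fst (factor w i) = fst (factor w (Suc i))" | "?same" ?gt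
      by linarith
    then show ?thesis
    proof cases
      case 1
      then have "act (bvec w) (bt_g n i) = bvec (swl i w)"
        unfolding act_g_basis[OF w i] by (simp split: if_splits) linarith
      then show ?thesis using z by simp
    next
      case 2
      then have "act (bvec w) (bt_g n i) = Poly_Mapping.single w q1"
        unfolding act_g_basis[OF w i] by simp
      then have "z \<in> Poly_Mapping.keys (act (Poly_Mapping.single w q1) x)" using z by simp
      then show ?thesis using keys_scal[OF w] 2(1) by blast
    next
      case 3
      then have "act (bvec w) (bt_g n i) =
        Poly_Mapping.single w q2 + bvec (swl i w)"
        unfolding act_g_basis[OF w i] by simp
      then have "act (act (bvec w) (bt_g n i)) x =
        act (Poly_Mapping.single w q2) x + act (bvec (swl i w)) x"
        using act_left(2)[of "Poly_Mapping.single w q2" "bvec (swl i w)" x] w w' cl by simp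
      then have "z \<in> Poly_Mapping.keys (act (Poly_Mapping.single w q2) x) \<union>
        Poly_Mapping.keys (act (bvec (swl i w)) x)"
        using z keys_add by fastforce
      then show ?thesis using keys_scal[OF w] 3(1) by blast
    qed
  qed
  then show ?case
  proof
    assume zk: "z \<in> Poly_Mapping.keys (act (bvec (swl i w)) x)"
    have IH: "word_inv z \<le> word_inv (swl i w) + colour_inv (swl i w) \<sigma>"
      "word_inv z = word_inv (swl i w) + colour_inv (swl i w) \<sigma> \<Longrightarrow> adapted (swl i w) \<sigma>"
      using is_T_swap.IH[OF w' zk] by blast+
    show ?thesis
    proof (cases "?same \<longrightarrow> ?lt")
      case True
      then have eq: "word_inv (swl i w) + colour_inv (swl i w) \<sigma> = word_inv w + colour_inv w (\<sigma> \<circ> sw i)"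
        unfolding ci(1) using wi by (cases ?same) simp_all
      show ?thesis using IH True unfolding eq ad by blast
    next
      case False
      then have "word_inv (swl i w) + colour_inv (swl i w) \<sigma> < word_inv w + colour_inv w (\<sigma> \<circ> sw i)"
        unfolding ci(1) using wi by simp
      then show ?thesis using IH(1) by linarith
    qed
  next
    assume sz: "?same \<and> z \<in> Poly_Mapping.keys (act (bvec w) x)"
    have "word_inv z \<le> word_inv w + colour_inv w \<sigma>"
      using is_T_swap.IH[OF w] sz by blast
    \<comment> \<open>The term that leaves the word in place gains no inversion although the bound
      grows, so it stays strictly below.\<close>
    also have "\<dots> < word_inv w + colour_inv w (\<sigma> \<circ> sw i)" unfolding ci(1) using ci(2) sz by simp
    finally show ?thesis by linarith
  qed
qed

text \<open>Each step exchanges letters of different colours or increasing letters of one colour.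
  The image therefore stays a single word, and the bound of \<open>act_T_keys\<close> is
  attained.\<close>

lemma act_T_adapted:
  assumes "is_T \<sigma> x" "w \<in> W" "adapted w \<sigma>"
  shows "\<exists>z. act (bvec w) x = bvec z \<and>
    (\<forall>k. 1 \<le> k \<longrightarrow> k \<le> n \<longrightarrow> factor z (\<sigma> k) = factor w k) \<and> word_inv z = word_inv w + colour_inv w \<sigma>"
  using assms
proof (induction arbitrary: w rule: is_T.induct)
  case is_T_id
  have "colour_inv w id = 0"
    by (auto simp: colour_inv_def ninv_def intro: card_eq_0_iff[THEN iffD2])
  then have "word_inv w = word_inv w + colour_inv w id" by (simp only: add_0_right)
  moreover have "act (bvec w) \<one>\<^bsub>B\<^esub> = bvec w" using is_T_id by simp
  moreover have "\<forall>k. 1 \<le> k \<longrightarrow> k \<le> n \<longrightarrow> factor w (id k) = factor w k" by simp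
  ultimately show ?case by blast
next
  case (is_T_swap \<sigma> x i)
  note i = \<open>1 \<le> i\<close> \<open>i < n\<close> and asc = \<open>\<sigma> i < \<sigma> (Suc i)\<close> and w = \<open>w \<in> W\<close>
  have len: "length w = n" using w by (simp add: basis_words_def)
  have w': "swl i w \<in> W" by (rule swl_basis_words[OF w i])
  have cl: "x \<in> carrier B" "bt_g n i \<in> carrier B" using is_T_props[OF is_T_swap.hyps(1)] i by auto
  note ci = colour_inv_swl[OF len i asc] and wi = word_inv_swl[OF len i]
  have ad: "adapted (swl i w) \<sigma>"
    "snd (factor w i) = snd (factor w (Suc i)) \<longrightarrow> fst (factor w i) < fst (factor w (Suc i))"
    using adapted_swl[OF len i asc] is_T_swap.prems(2) by blast+
  obtain z where z: "act (bvec (swl i w)) x = bvec z"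
    "\<forall>k. 1 \<le> k \<longrightarrow> k \<le> n \<longrightarrow> factor z (\<sigma> k) = factor (swl i w) k"
    "word_inv z = word_inv (swl i w) + colour_inv (swl i w) \<sigma>"
    using is_T_swap.IH[OF w' ad(1)] by blast
  have "act (bvec w) (bt_g n i) = bvec (swl i w)"
    using act_g_basis[OF w i] ad(2) by auto
  then have "act (bvec w) (bt_g n i \<otimes>\<^bsub>B\<^esub> x) = bvec z"
    using z(1) cl w by (simp add: act_mult)
  moreover have "factor z ((\<sigma> \<circ> sw i) k) = factor w k" if "1 \<le> k" "k \<le> n" for k
    using z(2)[rule_format, of "sw i k"] sw_range[OF i that] factor_swl[OF len i, of "sw i k"] by simp
  moreover have "word_inv z = word_inv w + colour_inv w (\<sigma> \<circ> sw i)"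
    using z(3) ci wi ad(2) by auto
  ultimately show ?case by blast
qed

text \<open>On the positions of one coloured letter an adapted permutation is increasing, since an
  inversion would require a strict inequality between equal letters. Its image there is the set of
  positions of that letter in \<open>z\<close>, so \<open>w\<close> and \<open>z\<close> determine
  it.\<close>

lemma adapted_unique:
  assumes s: "\<sigma> permutes {1..n}" "adapted w \<sigma>" "\<forall>k. 1 \<le> k \<longrightarrow> k \<le> n \<longrightarrow> factor z (\<sigma> k) = factor w k"
    and t: "\<tau> permutes {1..n}" "adapted w \<tau>" "\<forall>k. 1 \<le> k \<longrightarrow> k \<le> n \<longrightarrow> factor z (\<tau> k) = factor w k"
  shows "\<sigma> = \<tau>"
proof
  fix k
  show "\<sigma> k = \<tau> k"
  proof (cases "k \<in> {1..n}")
    case False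
    then show ?thesis using s(1) t(1) by (simp add: permutes_not_in)
  next
    case True
    define K where "K = {l \<in> {1..n}. factor w l = factor w k}"
    have mono: "\<rho> a < \<rho> b"
      if "\<rho> permutes {1..n}" "adapted w \<rho>" "a \<in> K" "b \<in> K" "a < b" for \<rho> a b
    proof (rule ccontr)
      assume "\<not> \<rho> a < \<rho> b"
      then have "\<rho> b < \<rho> a" using permutes_neq[OF that(1), of a b] that(5) by simp
      then have "fst (factor w a) < fst (factor w b)"
        using that(2)[unfolded adapted_def, rule_format, of a b] that(3-5) by (simp add: K_def)
      then show False using that(3,4) by (simp add: K_def)
    qed
    have img: "\<rho> ` K = {m \<in> {1..n}. factor z m = factor w k}"
      if r: "\<rho> permutes {1..n}" "\<forall>k. 1 \<le> k \<longrightarrow> k \<le> n \<longrightarrow> factor z (\<rho> k) = factor w k" for \<rho>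
    proof (intro subset_antisym subsetI)
      fix m assume "m \<in> \<rho> ` K"
      then obtain l where "m = \<rho> l" "l \<in> {1..n}" "factor w l = factor w k" by (auto simp: K_def)
      then show "m \<in> {m \<in> {1..n}. factor z m = factor w k}"
        using r(2) permutes_in_image[OF r(1), of l] by simp
    next
      fix m assume m: "m \<in> {m \<in> {1..n}. factor z m = factor w k}"
      then have "m \<in> \<rho> ` {1..n}" using permutes_image[OF r(1)] by blast
      then obtain l where "l \<in> {1..n}" "m = \<rho> l" by blast
      then show "m \<in> \<rho> ` K" using m r(2) by (auto simp: K_def)
    qed
    have "k \<in> K" using True by (simp add: K_def)
    moreover have "\<sigma> ` K = \<tau> ` K" using img s t by simp
    moreover have "strict_mono_on K \<sigma>" "strict_mono_on K \<tau>"
      using mono[OF s(1,2)] mono[OF t(1,2)] by (intro strict_mono_onI; blast)+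
    ultimately show ?thesis using strict_mono_images_eq by blast
  qed
qed

lemma act_FT:
  assumes w: "w \<in> W" and \<sigma>: "\<sigma> permutes {1..n}"
  shows "act (bvec w) (FT P \<sigma>) =
    (if \<forall>i j. 1 \<le> i \<longrightarrow> i < j \<longrightarrow> j \<le> n \<longrightarrow> same P i j = (snd (factor w i) = snd (factor w j))
     then act (bvec w) (T \<sigma>) else 0)"
proof -
  have "act (bvec w) (FT P \<sigma>) = act (act (bvec w) (F P)) (T \<sigma>)"
    unfolding FT_def using w \<sigma> by (intro act_mult) simp_all
  then show ?thesis
    unfolding act_F[OF w] if_distrib[where f = "\<lambda>v. act v (T \<sigma>)"] act_left(1)[OF T_closed[OF \<sigma>]] .
qed

end

text \<open>If there are two letters of each colour and as many colours as blocks, then the position of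
  the smaller letters can be chosen such that the word is adapted to a given permutation
  without bad triples.\<close>

theorem (in bt_action) independence:
  fixes c :: "nat set set \<times> (nat \<Rightarrow> nat) \<Rightarrow> 'r"
  assumes N: "N = 2" and r: "r = length \<alpha>"
    and S: "S = {(P, \<sigma>). P \<in> SPt \<alpha> \<and> \<sigma> permutes {1..n} \<and> good P \<sigma>}"
    and zero: "\<And>v. v \<in> V \<Longrightarrow> (\<Sum>(P, \<sigma>)\<in>S. scale (c (P, \<sigma>)) (act v (FT P \<sigma>))) = 0"
    and p: "p \<in> S"
  shows "c p = 0"
proof (rule ccontr)
  assume cp: "c p \<noteq> 0"
  obtain P where P: "fst p = P" by blast
  have finS: "finite S"
  proof (rule finite_subset)
    show "S \<subseteq> SP \<times> {\<sigma>. \<sigma> permutes {1..n}}" unfolding S by blast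
    show "finite (SP \<times> {\<sigma>. \<sigma> permutes {1..n}})" using finite_set_partitions finite_permutations by blast
  qed
  define S0 where "S0 = {\<sigma>. (P, \<sigma>) \<in> S \<and> c (P, \<sigma>) \<noteq> 0}"
  have "S0 \<subseteq> snd ` S" unfolding S0_def by force
  then have fin0: "finite S0" using finS finite_surj by blast
  have ne0: "snd p \<in> S0" using p cp P by (cases p) (simp add: S0_def)
  \<comment> \<open>The leading permutation: having the most inversions inside the blocks, it will
    be the only one that contributes to its image word.\<close>
  define \<sigma> where "\<sigma> = arg_max_on (blinv n P) S0"
  have "\<sigma> \<in> S0 \<and> (\<forall>\<tau>\<in>S0. blinv n P \<tau> \<le> blinv n P \<sigma>)"
  proof -
    have "finite (blinv n P ` S0)" using fin0 by simp
    then have "Max (blinv n P ` S0) \<in> blinv n P ` S0" using ne0 by (intro Max_in) auto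
    then obtain \<sigma>' where s': "\<sigma>' \<in> S0" "blinv n P \<sigma>' = Max (blinv n P ` S0)" by auto
    have "blinv n P \<tau> \<le> blinv n P \<sigma>'" if "\<tau> \<in> S0" for \<tau> using fin0 that s'(2) by simp
    then have "is_arg_max (blinv n P) (\<lambda>x. x \<in> S0) \<sigma>'" using s'(1) by (auto simp: is_arg_max_def not_less)
    then have "is_arg_max (blinv n P) (\<lambda>x. x \<in> S0) \<sigma>"
      unfolding \<sigma>_def arg_max_on_def arg_max_def
      by (rule someI[of "is_arg_max (blinv n P) (\<lambda>x. x \<in> S0)"])
    then show ?thesis by (auto simp: is_arg_max_def not_less)
  qed
  then have s: "\<sigma> \<in> S0" "\<And>\<tau>. \<tau> \<in> S0 \<Longrightarrow> blinv n P \<tau> \<le> blinv n P \<sigma>" by blast+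
  have ps: "P \<in> SP" "has_type P \<alpha>" "partition_on {1..n} P" "\<sigma> permutes {1..n}" "good P \<sigma>"
    using s(1) unfolding S0_def S by auto
  have "finite P" using finite_elements[OF _ ps(3)] by simp
  moreover have "card P = r"
  proof -
    have "size (mset \<alpha>) = size (image_mset card (mset_set P))" using ps(2) by (simp add: has_type_def)
    then show ?thesis using r by simp
  qed
  \<comment> \<open>One colour for each block, which is possible because the length of \<alpha> is
    the number of blocks.\<close>
  ultimately obtain h where h: "bij_betw h P {1..r}"
    using ex_bij_betw_nat_finite_1 by (metis bij_betw_inv)
  define blk where "blk k = {j. same P k j}" for k
  have blk: "blk k \<in> P" if "k \<in> {1..n}" for k
    using partition_eq_blocks[OF ps(3)] that unfolding blk_def by blast
  have blk_eq: "blk k = blk l \<longleftrightarrow> same P k l" if "k \<in> {1..n}" "l \<in> {1..n}" for k l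
  proof
    assume "blk k = blk l"
    then show "same P k l" using same_refl[OF ps(3) that(2)] unfolding blk_def by blast
  next
    assume "same P k l"
    then show "blk k = blk l"
      unfolding blk_def using same_trans[OF ps(3)] same_sym by blast
  qed
  define w where "w = map (\<lambda>k. (if \<exists>l>k. l \<le> n \<and> same P k l \<and> \<sigma> l < \<sigma> k then 1 else 2 :: nat, h (blk k))) [1..<Suc n]"
  have fw: "factor w k = (if \<exists>l>k. l \<le> n \<and> same P k l \<and> \<sigma> l < \<sigma> k then 1 else 2, h (blk k))"
    if "1 \<le> k" "k \<le> n" for k
  proof -
    have "[1..<Suc n] ! (k - 1) = k" using that by (subst nth_upt) auto
    moreover have "k - 1 < length [1..<Suc n]" using that by simp
    ultimately show ?thesis unfolding factor_def w_def by (simp only: nth_map)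
  qed
  have hblk: "h (blk k) \<in> {1..r}" if "k \<in> {1..n}" for k
    using blk[OF that] h by (auto simp: bij_betw_def)
  have wW: "w \<in> W"
    unfolding basis_words_def w_def using hblk N by (auto simp del: upt_Suc)
  have col: "snd (factor w k) = snd (factor w l) \<longleftrightarrow> same P k l" if "1 \<le> k" "k \<le> n" "1 \<le> l" "l \<le> n" for k l
    using fw[of k] fw[of l] that blk[of k] blk[of l] blk_eq[of k l] h
    by (auto simp: bij_betw_def inj_on_def)
  have ad: "adapted w \<sigma>"
    unfolding adapted_def
  proof (intro allI impI)
    fix k l assume kl: "1 \<le> k" "k < l" "l \<le> n" "snd (factor w k) = snd (factor w l)" "\<sigma> l < \<sigma> k"
    then have skl: "same P k l" using col[of k l] by simp
    \<comment> \<open>An end of an inversion cannot start another one, or a bad triple would arise;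
      so the end carries the larger letter.\<close>
    have "\<not> (\<exists>m>l. m \<le> n \<and> same P l m \<and> \<sigma> m < \<sigma> l)"
    proof
      assume "\<exists>m>l. m \<le> n \<and> same P l m \<and> \<sigma> m < \<sigma> l"
      then obtain m where "l < m" "m \<le> n" "same P l m" "\<sigma> m < \<sigma> l" by blast
      then have "bad_triple P \<sigma> k l m"
        using kl skl same_trans[OF ps(3) skl] by (simp add: bad_triple_def)
      then show False using ps(5) by (auto simp: good_def)
    qed
    moreover have "\<exists>m>k. m \<le> n \<and> same P k m \<and> \<sigma> m < \<sigma> k" using kl skl by blast
    ultimately show "fst (factor w k) < fst (factor w l)"
      using fw[of k] fw[of l] kl by simp
  qed
  have ci: "colour_inv w \<tau> = blinv n P \<tau>" for \<tau>
    unfolding colour_inv_def blinv_def by (rule ninv_cong) (use col in auto)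
  obtain z where z: "act (bvec w) (T \<sigma>) = bvec z"
    "\<forall>k. 1 \<le> k \<longrightarrow> k \<le> n \<longrightarrow> factor z (\<sigma> k) = factor w k" "word_inv z = word_inv w + colour_inv w \<sigma>"
    using act_T_adapted[OF is_T_T[OF ps(4)] wW ad] by blast
  have term0: "Poly_Mapping.lookup (scale (c (Q, \<tau>)) (act (bvec w) (FT Q \<tau>))) z =
    (if (Q, \<tau>) = (P, \<sigma>) then c (P, \<sigma>) else 0)" if Qt: "(Q, \<tau>) \<in> S" for Q \<tau>
  proof -
    have Q: "partition_on {1..n} Q" "\<tau> permutes {1..n}" using Qt unfolding S by auto
    \<comment> \<open>The colours of \<open>w\<close> reproduce exactly the blocks of
      \<open>P\<close>, so the terms of other partitions vanish on \<open>w\<close>.\<close>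
    have iff: "(\<forall>i j. 1 \<le> i \<longrightarrow> i < j \<longrightarrow> j \<le> n \<longrightarrow> same Q i j = (snd (factor w i) = snd (factor w j))) \<longleftrightarrow> Q = P"
      using partition_eqI[OF Q(1) ps(3)] col by auto
    have FTQ: "act (bvec w) (FT Q \<tau>) = (if Q = P then act (bvec w) (T \<tau>) else 0)"
      using act_FT[OF wW Q(2), of Q] unfolding iff .
    show ?thesis
    proof (cases "Q = P")
      case False
      then show ?thesis using FTQ by simp
    next
      case QP: True
      then have FT: "act (bvec w) (FT Q \<tau>) = act (bvec w) (T \<tau>)"
        using FTQ by simp
      show ?thesis
      proof (cases "\<tau> = \<sigma>")
        case True
        then show ?thesis using FT z(1) QP by simp
      next
        case False
        \<comment> \<open>If \<open>z\<close> occurred here, the maximality of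
          \<open>\<sigma>\<close> would make the bound on inversions sharp for
          \<open>\<tau>\<close>. Then \<open>\<tau>\<close> is adapted with the same image word and
          equals \<open>\<sigma>\<close>.\<close>
        have "c (Q, \<tau>) * Poly_Mapping.lookup (act (bvec w) (T \<tau>)) z = 0"
        proof (rule ccontr)
          assume ne: "c (Q, \<tau>) * Poly_Mapping.lookup (act (bvec w) (T \<tau>)) z \<noteq> 0"
          then have "c (P, \<tau>) \<noteq> 0" using QP by auto
          then have "\<tau> \<in> S0" using Qt QP by (simp add: S0_def)
          then have le: "colour_inv w \<tau> \<le> colour_inv w \<sigma>" using s(2) ci by simp
          have zk: "z \<in> Poly_Mapping.keys (act (bvec w) (T \<tau>))"
            using ne by (auto simp: in_keys_iff)
          have "adapted w \<tau>" using act_T_keys[OF is_T_T[OF Q(2)] wW zk] z(3) le by simp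
          then obtain z' where z': "act (bvec w) (T \<tau>) = Poly_Mapping.single z' 1"
            "\<forall>k. 1 \<le> k \<longrightarrow> k \<le> n \<longrightarrow> factor z' (\<tau> k) = factor w k"
            using act_T_adapted[OF is_T_T[OF Q(2)] wW] by blast
          have "z' = z" using zk z'(1) by (simp split: if_splits)
          then have "\<tau> = \<sigma>"
            using adapted_unique[OF Q(2) \<open>adapted w \<tau>\<close> _ ps(4) ad z(2)] z'(2) by simp
          then show False using False by simp
        qed
        then show ?thesis using FT False by simp
      qed
    qed
  qed
  have "0 = Poly_Mapping.lookup (\<Sum>(Q, \<tau>)\<in>S. scale (c (Q, \<tau>)) (act (bvec w) (FT Q \<tau>))) z"
    using zero[of "bvec w"] wW by simp
  also have "\<dots> = (\<Sum>q\<in>S. if q = (P, \<sigma>) then c (P, \<sigma>) else 0)"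
    unfolding lookup_sum
  proof (rule sum.cong[OF refl])
    fix q assume "q \<in> S"
    then show "Poly_Mapping.lookup (case q of (Q, \<tau>) \<Rightarrow> scale (c (Q, \<tau>)) (act (bvec w) (FT Q \<tau>))) z =
      (if q = (P, \<sigma>) then c (P, \<sigma>) else 0)"
      using term0 by (cases q) (simp only: prod.case)
  qed
  also have "\<dots> = c (P, \<sigma>)" using finS s(1) by (simp add: S0_def)
  finally show False using s(1) by (simp add: S0_def)
qed

section \<open>The Steinberg element on tensor space\<close>

context laurent_map
begin

definition q3 :: 'r where "q3 = \<phi> (q_pow (-1))"

lemma q13: "q1 * q3 = 1" "q1 * (q3 * x) = x"
  using phi_q by (simp_all add: q1_def q3_def mult.assoc[symmetric])

lemma q2_eq: "q2 = q1 - q3"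
  by (simp add: q1_def q2_def q3_def phi_diff)

lemma phi_q_pow_neg: "\<phi> (q_pow (-2)) = q3 * q3" "\<phi> (q_pow (-3)) = q3 * (q3 * q3)"
proof -
  have "q_pow (-2) = q_pow (-1) * q_pow (-1)" "q_pow (-3) = q_pow (-1) * (q_pow (-1) * q_pow (-1))"
    by (simp_all add: q_pow_def mult_single)
  then show "\<phi> (q_pow (-2)) = q3 * q3" "\<phi> (q_pow (-3)) = q3 * (q3 * q3)"
    by (simp_all add: phi_mult q3_def)
qed

text \<open>There are no antisymmetric tensors of degree three in two letters. The eight words are
  checked one by one, with q^{-1} eliminated against q by \<open>q13\<close>.\<close>

lemma local_steinberg:
  assumes i: "i = Suc (length xs)" and v: "v = Poly_Mapping.single (xs @ (a, s) # (b, s) # (c, s) # ys) 1"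
    and abc: "a \<in> {1, 2}" "b \<in> {1, 2}" "c \<in> {1, 2}"
  shows "scale (- (q3 * (q3 * q3))) (act_word \<phi> v [G i, G (Suc i), G i]) +
    scale (q3 * q3) (act_word \<phi> v [G i, G (Suc i)]) + scale (q3 * q3) (act_word \<phi> v [G (Suc i), G i]) +
    scale (- q3) (act_word \<phi> v [G i]) + scale (- q3) (act_word \<phi> v [G (Suc i)]) + v = 0" (is "?l = 0")
proof (rule combination_eqI)
  fix h
  note simps = v act_word_simps(1,2) act_gen_simps act_basis_at[OF i] act_basis_at2[OF i]
    q1_def[symmetric] q2_def[symmetric] q2_eq combination_simps algebra_simps q13
  show "lin_ext (\<lambda>w c. c * h w) ?l = lin_ext (\<lambda>w c. c * h w) 0"
    by (insert abc, elim insertE emptyE) (simp_all add: simps)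
qed

end

text \<open>\<open>e i\<close> and \<open>e (Suc i)\<close> keep only the words with three equal
  colours at the positions concerned, and there \<open>local_steinberg\<close> applies.\<close>

lemma (in bt_action) act_gen_eq_0:
  assumes N: "N = 2" and i: "1 \<le> i" "Suc i < n" and v: "v \<in> V"
  shows "act v (gen \<alpha> i) = 0"
proof -
  let ?e = "bt_e n i" and ?e' = "bt_e n (Suc i)"
  have cl: "?e \<in> carrier B" "?e' \<in> carrier B" "St i \<in> carrier B" "bt_g n i \<in> carrier B"
    "bt_g n (Suc i) \<in> carrier B" "?e \<otimes>\<^bsub>B\<^esub> ?e' \<otimes>\<^bsub>B\<^esub> St i \<in> carrier B"
    using i by simp_all
  have St: "act v (St i) =
    scale (- (q3 * (q3 * q3))) (act_word \<phi> v [G i, G (Suc i), G i]) +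
    scale (q3 * q3) (act_word \<phi> v [G i, G (Suc i)]) + scale (q3 * q3) (act_word \<phi> v [G (Suc i), G i]) +
    scale (- q3) (act_word \<phi> v [G i]) + scale (- q3) (act_word \<phi> v [G (Suc i)]) + v" if "v \<in> V" for v
    unfolding St_def using that cl i act_gen_V
    by (simp add: act_add_r act_smult act_mult act_g phi_uminus phi_q_pow_neg q3_def[symmetric] act_word_simps)
  have "act u (?e \<otimes>\<^bsub>B\<^esub> ?e' \<otimes>\<^bsub>B\<^esub> St i) = 0" if "u \<in> V" for u
  proof (rule act_eqI[OF that cl(6)])
    fix w assume w: "w \<in> W"
    then have wV: "bvec w \<in> V" by simp
    have len: "length w = n" using w by (simp add: basis_words_def)
    obtain xs a s b t c u ys where sp: "w = xs @ (a, s) # (b, t) # (c, u) # ys" "i = Suc (length xs)"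
      using split_three[OF len i] by metis
    have abc: "a \<in> {1, 2}" "b \<in> {1, 2}" "c \<in> {1, 2}" using w N sp by (auto simp: basis_words_def)
    have ee: "act (bvec w) (?e \<otimes>\<^bsub>B\<^esub> ?e') =
      (if s = t \<and> t = u then bvec w else 0)"
      using wV cl i unfolding sp(1)
      by (cases "s = t"; cases "t = u") (simp_all add: act_mult act_e act_gen_simps act_basis_at[OF sp(2)] act_basis_at2[OF sp(2)] act_left(1))
    have "act (bvec w) (?e \<otimes>\<^bsub>B\<^esub> ?e' \<otimes>\<^bsub>B\<^esub> St i) =
      act (act (bvec w) (?e \<otimes>\<^bsub>B\<^esub> ?e')) (St i)"
      using wV cl by (intro act_mult) simp_all
    also have "\<dots> = 0"
    proof (cases "s = t \<and> t = u")
      case True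
      then show ?thesis
        unfolding ee using St[OF wV] local_steinberg[OF sp(2) _ abc, of "bvec w" s ys] sp(1) by simp
    next
      case False
      then have "act (bvec w) (?e \<otimes>\<^bsub>B\<^esub> ?e') = 0" using ee by auto
      then show ?thesis using cl act_left(1) by simp
    qed
    finally show "act (bvec w) (?e \<otimes>\<^bsub>B\<^esub> ?e' \<otimes>\<^bsub>B\<^esub> St i) = 0" .
  qed
  then show ?thesis unfolding gen_def using v cl by (simp add: act_mult[OF v idem_closed cl(6)])
qed

section \<open>Base change\<close>

text \<open>\<open>pre_tensor\<close> takes its ring operations from an integral monoid algebra but
  has another type of scalars. The ring axioms pass over because they speak of the ring operations
  alone.\<close>

lemma ring_transfer:
  assumes "ring R" "carrier S = carrier R" "mult S = mult R" "one S = one R" "zero S = zero R" "add S = add R"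
  shows "ring S"
proof -
  interpret R: ring R by fact
  show ?thesis
  proof (rule ringI)
    show "abelian_group S"
    proof (rule abelian_groupI)
      fix x assume "x \<in> carrier S"
      then show "\<exists>y\<in>carrier S. y \<oplus>\<^bsub>S\<^esub> x = \<zero>\<^bsub>S\<^esub>"
        using R.l_neg[of x] R.a_inv_closed[of x] assms(2,5,6) by auto
    qed (simp_all add: assms R.a_ac)
    show "monoid S" by (rule monoidI) (simp_all add: assms R.m_assoc)
  qed (simp_all add: assms R.l_distr R.r_distr)
qed

abbreviation mult_monoid :: "'k::comm_ring_1 monoid"
  where "mult_monoid \<equiv> \<lparr>carrier = UNIV, mult = (*), one = 1\<rparr>"

lemma pre_tensor_simps:
  fixes A :: "('s, 'a) module"
  shows "carrier (pre_tensor A :: ('k::comm_ring_1, _) module) = {f. Poly_Mapping.keys f \<subseteq> carrier A \<times> UNIV}"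
    "mult (pre_tensor A :: ('k, _) module) =
      mult (monoid_algebra (A \<times>\<times> (mult_monoid :: 'k monoid)) :: (int, _) module)"
    "one (pre_tensor A :: ('k, _) module) = pair_gen \<one>\<^bsub>A\<^esub> 1"
    "zero (pre_tensor A :: ('k, _) module) = 0"
    "add (pre_tensor A :: ('k, _) module) = (+)"
  by (simp_all add: pre_tensor_def Let_def ring.defs module.defs monoid_algebra_simps fun_eq_iff DirProd_def)

lemma pre_tensor_mult_single:
  fixes A :: "('s, 'a) module" and x y :: "'k::comm_ring_1"
  shows "Poly_Mapping.single (a, x) c \<otimes>\<^bsub>pre_tensor A :: ('k, _) module\<^esub> Poly_Mapping.single (b, y) d =
    Poly_Mapping.single (a \<otimes>\<^bsub>A\<^esub> b, x * y) (c * d)"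
  by (simp add: pre_tensor_simps monoid_algebra_mult_single)

lemma pre_tensor_distr:
  fixes A :: "('s, 'a) module"
  defines "P \<equiv> pre_tensor A :: ('k::comm_ring_1, _) module"
  shows "(f + g) \<otimes>\<^bsub>P\<^esub> h = f \<otimes>\<^bsub>P\<^esub> h + g \<otimes>\<^bsub>P\<^esub> h" "h \<otimes>\<^bsub>P\<^esub> (f + g) = h \<otimes>\<^bsub>P\<^esub> f + h \<otimes>\<^bsub>P\<^esub> g"
    "0 \<otimes>\<^bsub>P\<^esub> h = 0" "h \<otimes>\<^bsub>P\<^esub> 0 = 0"
  by (simp_all add: P_def pre_tensor_simps monoid_algebra_distr)

lemma ring_pre_tensor:
  fixes A :: "('s, 'a) module"
  assumes "ring A"
  shows "ring (pre_tensor A :: ('k::comm_ring_1, _) module)"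
proof -
  interpret A: ring A by fact
  have "monoid (mult_monoid :: 'k monoid)" by (rule monoidI) (simp_all add: mult.assoc)
  then have "monoid (A \<times>\<times> (mult_monoid :: 'k monoid))"
    by (rule DirProd_monoid[OF A.monoid_axioms])
  from salg_monoid_algebra[OF this]
  interpret Z: salg "monoid_algebra (A \<times>\<times> (mult_monoid :: 'k monoid)) :: (int, _) module" .
  show ?thesis
    by (rule ring_transfer[OF Z.ring_axioms])
      (simp_all add: pre_tensor_simps monoid_algebra_simps fun_eq_iff DirProd_def)
qed

text \<open>The tensor product is handled as a ring: scaling by x is multiplication by the pure
  tensor of the unit with x, so two-sided ideals absorb it.\<close>

locale base_extension = salg A for A :: "('s::comm_ring_1, 'a) module" (structure) +
  fixes \<phi> :: "'s \<Rightarrow> 'k::comm_ring_1"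
begin

abbreviation P :: "('k, ('a \<times> 'k) \<Rightarrow>\<^sub>0 int) module" where "P \<equiv> pre_tensor A"
abbreviation I :: "(('a \<times> 'k) \<Rightarrow>\<^sub>0 int) set" where "I \<equiv> tensor_ideal A \<phi>"
abbreviation R :: "('k, (('a \<times> 'k) \<Rightarrow>\<^sub>0 int) set) module" where "R \<equiv> base_change A \<phi>"
abbreviation pt :: "'a \<Rightarrow> 'k \<Rightarrow> (('a \<times> 'k) \<Rightarrow>\<^sub>0 int) set" where "pt \<equiv> pure_tensor A \<phi>"

sublocale P: ring P
  by (rule ring_pre_tensor[OF ring_axioms])

lemma P_minus:
  "f \<in> carrier P \<Longrightarrow> \<ominus>\<^bsub>P\<^esub> f = - f" "f \<in> carrier P \<Longrightarrow> h \<in> carrier P \<Longrightarrow> f \<ominus>\<^bsub>P\<^esub> h = f - h"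
proof -
  have neg: "\<ominus>\<^bsub>P\<^esub> f = - f" if "f \<in> carrier P" for f
  proof (rule P.minus_equality)
    show "- f \<in> carrier P" using that by (auto simp: pre_tensor_simps in_keys_iff subset_iff)
  qed (use that in \<open>simp_all add: pre_tensor_simps\<close>)
  then show "f \<in> carrier P \<Longrightarrow> \<ominus>\<^bsub>P\<^esub> f = - f" .
  show "f \<in> carrier P \<Longrightarrow> h \<in> carrier P \<Longrightarrow> f \<ominus>\<^bsub>P\<^esub> h = f - h"
    by (simp add: a_minus_def neg pre_tensor_simps)
qed

lemma P_diff_closed: "f \<in> carrier P \<Longrightarrow> h \<in> carrier P \<Longrightarrow> f - h \<in> carrier P"
  using P.minus_closed[of f h] by (simp add: P_minus)

lemma single_P: "a \<in> carrier A \<Longrightarrow> Poly_Mapping.single (a, x) m \<in> carrier P"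
  by (simp add: pre_tensor_simps)

lemma relators_P: "tensor_relators A \<phi> \<subseteq> carrier P"
  unfolding tensor_relators_def by (auto intro!: P_diff_closed single_P)

lemma ideal_I: "ideal I P"
  unfolding tensor_ideal_def by (rule P.genideal_ideal[OF relators_P])

sublocale R: ring R
  unfolding base_change_def by (rule quot_algebra_ring[OF ideal_I])

lemmas R_simps = quot_algebra_coset[OF ideal_I, folded base_change_def]

lemma class_eqI: "f \<in> carrier P \<Longrightarrow> h \<in> carrier P \<Longrightarrow> f - h \<in> I \<Longrightarrow> I +>\<^bsub>P\<^esub> f = I +>\<^bsub>P\<^esub> h"
  using ideal_coset_eq[OF ideal_I] by (simp add: P_minus)

lemma relator_I: "f \<in> tensor_relators A \<phi> \<Longrightarrow> f \<in> I"
  unfolding tensor_ideal_def using P.genideal_self[OF relators_P] by blast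

lemma pt_closed [simp]: "a \<in> carrier A \<Longrightarrow> pt a x \<in> carrier R"
  unfolding pure_tensor_def using single_P by (auto simp: R_simps(1))

lemma pt_mult:
  "a \<in> carrier A \<Longrightarrow> b \<in> carrier A \<Longrightarrow> pt a x \<otimes>\<^bsub>R\<^esub> pt b y = pt (a \<otimes> b) (x * y)"
  unfolding pure_tensor_def by (simp add: R_simps(2) single_P pre_tensor_mult_single)

lemma pt_one: "\<one>\<^bsub>R\<^esub> = pt \<one> 1"
  by (simp add: pure_tensor_def R_simps(4) pre_tensor_simps)

lemma class_add: "f \<in> carrier P \<Longrightarrow> h \<in> carrier P \<Longrightarrow> (I +>\<^bsub>P\<^esub> f) \<oplus>\<^bsub>R\<^esub> (I +>\<^bsub>P\<^esub> h) = I +>\<^bsub>P\<^esub> (f + h)"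
  by (simp add: R_simps(3) pre_tensor_simps(5))

lemma P_add_closed: "f \<in> carrier P \<Longrightarrow> h \<in> carrier P \<Longrightarrow> f + h \<in> carrier P"
  using P.a_closed[of f h] by (simp add: pre_tensor_simps(5))

lemma pt_add_l:
  assumes "a \<in> carrier A" "b \<in> carrier A"
  shows "pt (a \<oplus> b) x = pt a x \<oplus>\<^bsub>R\<^esub> pt b x"
proof -
  have "pair_gen (a \<oplus> b) x - pair_gen a x - pair_gen b x \<in> tensor_relators A \<phi>"
    unfolding tensor_relators_def using assms by blast
  then have "pair_gen (a \<oplus> b) x - (pair_gen a x + pair_gen b x) \<in> I"
    unfolding diff_diff_eq by (rule relator_I)
  then show ?thesis
    unfolding pure_tensor_def using assms
    by (simp add: class_add single_P) (intro class_eqI P_add_closed single_P; simp)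
qed

lemma pt_add_r:
  assumes "a \<in> carrier A"
  shows "pt a (x + y) = pt a x \<oplus>\<^bsub>R\<^esub> pt a y"
proof -
  have "pair_gen a (x + y) - pair_gen a x - pair_gen a y \<in> tensor_relators A \<phi>"
    unfolding tensor_relators_def using assms by blast
  then have "pair_gen a (x + y) - (pair_gen a x + pair_gen a y) \<in> I"
    unfolding diff_diff_eq by (rule relator_I)
  then show ?thesis
    unfolding pure_tensor_def using assms
    by (simp add: class_add single_P) (intro class_eqI P_add_closed single_P; simp)
qed

lemma pt_smult:
  assumes "a \<in> carrier A"
  shows "pt (s \<odot> a) x = pt a (\<phi> s * x)"
proof -
  have "pair_gen (s \<odot> a) x - pair_gen a (\<phi> s * x) \<in> I"
    unfolding tensor_relators_def using assms by (intro relator_I[unfolded tensor_relators_def]) blast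
  then show ?thesis
    unfolding pure_tensor_def using assms by (intro class_eqI single_P) simp_all
qed

lemma pt_zero [simp]: "a \<in> carrier A \<Longrightarrow> pt a 0 = \<zero>\<^bsub>R\<^esub>" "pt \<zero> x = \<zero>\<^bsub>R\<^esub>"
  using pt_add_r[of a 0 0] pt_add_l[of \<zero> \<zero> x] R.add.l_cancel_one by fastforce+

text \<open>An integral multiple of a pure tensor is again pure, as the integer can be absorbed in
  the second factor. Hence the pure tensors generate additively.\<close>

lemma base_change_induct [consumes 1, case_names pure add]:
  assumes "t \<in> carrier R"
    and pure: "\<And>a x. a \<in> carrier A \<Longrightarrow> Q (pt a x)"
    and add: "\<And>t u. t \<in> carrier R \<Longrightarrow> u \<in> carrier R \<Longrightarrow> Q t \<Longrightarrow> Q u \<Longrightarrow> Q (t \<oplus>\<^bsub>R\<^esub> u)"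
  shows "Q t"
proof -
  have single: "I +>\<^bsub>P\<^esub> Poly_Mapping.single (a, x) m = pt a (of_int m * x)" if a: "a \<in> carrier A" for a x m
  proof -
    have nat: "I +>\<^bsub>P\<^esub> Poly_Mapping.single (a, x) (int k) = pt a (of_nat k * x)" for k
    proof (induction k)
      case 0
      have "pt a 0 = I +>\<^bsub>P\<^esub> 0" using a R_simps(5) by (simp add: pre_tensor_simps(4))
      then show ?case by simp
    next
      case (Suc k)
      have "I +>\<^bsub>P\<^esub> Poly_Mapping.single (a, x) (int (Suc k)) =
        (I +>\<^bsub>P\<^esub> Poly_Mapping.single (a, x) (int k)) \<oplus>\<^bsub>R\<^esub> (I +>\<^bsub>P\<^esub> pair_gen a x)"
        using a by (subst class_add) (simp_all add: single_P single_add[symmetric] add.commute)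
      also have "\<dots> = pt a (of_nat k * x) \<oplus>\<^bsub>R\<^esub> pt a x" unfolding Suc pure_tensor_def ..
      also have "\<dots> = pt a (of_nat (Suc k) * x)"
        unfolding pt_add_r[OF a, symmetric] by (simp add: algebra_simps)
      finally show ?case .
    qed
    show ?thesis
    proof (cases m rule: int_cases2)
      case (nonneg k)
      then show ?thesis using nat by simp
    next
      case (nonpos k)
      let ?s = "I +>\<^bsub>P\<^esub> Poly_Mapping.single (a, x) m"
      \<comment> \<open>For a negative multiple both sides are additive inverses of the same pure
        tensor.\<close>
      have "?s \<oplus>\<^bsub>R\<^esub> pt a (of_nat k * x) = \<zero>\<^bsub>R\<^esub>"
        unfolding nat[symmetric] using a nonpos
        by (simp add: class_add single_P single_add[symmetric] R_simps(5) pre_tensor_simps(4))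
      moreover have "pt a (of_int m * x) \<oplus>\<^bsub>R\<^esub> pt a (of_nat k * x) = \<zero>\<^bsub>R\<^esub>"
        unfolding pt_add_r[OF a, symmetric] using a nonpos by simp
      moreover have "?s \<in> carrier R" using single_P[OF a] by (auto simp: R_simps(1))
      ultimately show ?thesis using a pt_closed[OF a] by (metis R.add.right_cancel)
    qed
  qed
  obtain f where f: "f \<in> carrier P" "t = I +>\<^bsub>P\<^esub> f" using assms(1) by (auto simp: R_simps(1))
  have "Poly_Mapping.keys f \<subseteq> carrier A \<times> UNIV" using f by (simp add: pre_tensor_simps)
  then have "Q (I +>\<^bsub>P\<^esub> f)"
  proof (induction f rule: poly_mapping_single_induct)
    case zero
    have "I +>\<^bsub>P\<^esub> 0 = pt \<zero> 0" by (simp add: R_simps(5) pre_tensor_simps(4))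
    then show ?case using pure[of \<zero> 0] by simp
  next
    case (single k m)
    then obtain a x where "k = (a, x)" "a \<in> carrier A" by auto
    then show ?case using \<open>\<And>a x m. a \<in> carrier A \<Longrightarrow> I +>\<^bsub>P\<^esub> Poly_Mapping.single (a, x) m = pt a (of_int m * x)\<close> pure
      by simp
  next
    case (add f h)
    then have fh: "f \<in> carrier P" "h \<in> carrier P" by (simp_all add: pre_tensor_simps)
    then have "I +>\<^bsub>P\<^esub> f \<in> carrier R" "I +>\<^bsub>P\<^esub> h \<in> carrier R" by (auto simp: R_simps(1))
    then show ?case using assms(3) add.IH class_add[OF fh] by metis
  qed
  then show ?thesis using f by simp
qed

end

section \<open>The annihilator of tensor space\<close>

locale etl_action = bt_action \<phi> n N r for \<phi> :: "laurent \<Rightarrow> 'r::comm_ring_1" and n N r +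
  fixes \<alpha> :: "nat list"
  assumes N: "N = 2" and r: "r = length \<alpha>"
begin

abbreviation "C \<equiv> bt_alpha n \<alpha>"

definition S :: "(nat set set \<times> (nat \<Rightarrow> nat)) set"
  where "S = {(Q, \<sigma>). Q \<in> SPt \<alpha> \<and> \<sigma> permutes {1..n} \<and> good Q \<sigma>}"

definition bas :: "nat set set \<times> (nat \<Rightarrow> nat) \<Rightarrow> bt"
  where "bas = (\<lambda>(Q, \<sigma>). FT Q \<sigma>)"

lemma C_eq: "C = corner_algebra B (idem \<alpha>)"
  by (simp add: bt_alpha_def idem_eq)

lemma C_iff: "a \<in> carrier C \<longleftrightarrow> a \<in> carrier B \<and> idem \<alpha> \<otimes>\<^bsub>B\<^esub> a = a"
  unfolding C_eq by (rule idem.corner_iff)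

lemma C_simps:
  "mult C = mult B" "one C = idem \<alpha>" "zero C = zero B" "add C = add B" "smult C = smult B"
  unfolding C_eq by (simp_all add: corner_algebra_simps)

lemma salg_C: "salg C"
  unfolding C_eq by (rule idem.salg_corner)

lemma finite_S: "finite S"
proof (rule finite_subset)
  show "S \<subseteq> SP \<times> {\<sigma>. \<sigma> permutes {1..n}}" unfolding S_def by blast
  show "finite (SP \<times> {\<sigma>. \<sigma> permutes {1..n}})" using finite_set_partitions finite_permutations by blast
qed

lemma bas_C: "j \<in> S \<Longrightarrow> bas j \<in> carrier C"
  unfolding C_iff by (auto simp: S_def bas_def FT_def m_assoc[symmetric] idem_mult_F)

lemma gen_C: "1 \<le> i \<Longrightarrow> Suc i < n \<Longrightarrow> gen \<alpha> i \<in> carrier C"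
  unfolding C_iff using idem_idem by (simp add: gen_def m_assoc[symmetric])

text \<open>One generator is enough, since \<open>ideal_mem_gen\<close> supplies the Steinberg
  elements at all other positions; \<open>ideal_corner\<close> makes \<open>J\<close> an ideal of
  the whole algebra, where straightening was proved.\<close>

lemma spanning_C:
  assumes J: "ideal J C" and i: "1 \<le> i" "Suc i < n" "gen \<alpha> i \<in> J" and a: "a \<in> carrier C"
  shows "a \<in> lspan (J \<union> bas ` S)"
proof -
  have JB: "ideal J B" using J unfolding C_eq by (rule idem.ideal_corner(1))
  have "idem \<alpha> \<otimes>\<^bsub>B\<^esub> a \<in> lspan (J \<union> {FT Q v | Q v. Q \<in> SPt \<alpha> \<and> v permutes {1..n} \<and> good Q v})"
    by (rule spanning[OF JB ideal_mem_gen[OF JB i]]) (use a C_iff in auto)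
  moreover have "{FT Q v | Q v. Q \<in> SPt \<alpha> \<and> v permutes {1..n} \<and> good Q v} = bas ` S"
    unfolding S_def bas_def by force
  ultimately show ?thesis using a C_iff by simp
qed

lemma independence_bas:
  assumes "\<And>v. v \<in> V \<Longrightarrow> (\<Sum>j\<in>S. scale (c j) (act v (bas j))) = 0" "j \<in> S"
  shows "c j = 0"
  by (rule independence[OF N r S_def _ assms(2)])
    (use assms(1) in \<open>simp add: bas_def case_prod_unfold\<close>)

lemma act_finsum:
  assumes "v \<in> V" "finite K" "b ` K \<subseteq> carrier B"
  shows "act v (\<Oplus>\<^bsub>B\<^esub>j\<in>K. c j \<odot>\<^bsub>B\<^esub> b j) = (\<Sum>j\<in>K. scale (\<phi> (c j)) (act v (b j)))"
  using assms(2,3)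
proof (induction K rule: finite_induct)
  case (insert k K)
  then have "b k \<in> carrier B" "(\<lambda>j. c j \<odot>\<^bsub>B\<^esub> b j) \<in> K \<rightarrow> carrier B" by auto
  then show ?case using insert assms(1) by (simp add: act_add_r act_smult)
qed (use assms(1) in simp)

lemma alpha_space_eq: "alpha_space \<phi> n N \<alpha> = {act v (idem \<alpha>) | v. v \<in> V}"
  by (simp add: alpha_space_def r idem_eq)

text \<open>The action is from the right and \<open>a\<close> equals \<open>idem \<alpha>\<close>
  times \<open>a\<close>, so acting by \<open>a\<close> already includes the projection to the image
  of the idempotent.\<close>

lemma annihilates_alpha_space:
  assumes "a \<in> carrier C"
  shows "(\<forall>v\<in>alpha_space \<phi> n N \<alpha>. act v a = 0) \<longleftrightarrow> (\<forall>v\<in>V. act v a = 0)"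
proof -
  have a: "a \<in> carrier B" "idem \<alpha> \<otimes>\<^bsub>B\<^esub> a = a" using assms C_iff by auto
  have "act (act v (idem \<alpha>)) a = act v a" if "v \<in> V" for v
    using act_mult[OF that idem_closed a(1), of \<alpha>] a(2) by simp
  then show ?thesis unfolding alpha_space_eq by auto
qed

lemma ideal_annihilator_C: "ideal {a \<in> carrier C. \<forall>v\<in>V. act v a = 0} C"
proof -
  interpret C: salg C by (rule salg_C)
  show ?thesis
    by (rule ideal_annihilator[OF C.ring_axioms])
      (simp_all add: C_simps C_iff act_add_r act_mult act_left(1))
qed

text \<open>Spanning delivers coefficients in the Laurent polynomials while independence shows that
  their images under \<open>\<phi>\<close> vanish, hence the hypothesis \<open>inj\<close>.\<close>

lemma genideal_annihilator:
  assumes i: "1 \<le> i" "Suc i < n" and inj: "\<And>c. \<phi> c = 0 \<Longrightarrow> c = 0"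
  shows "genideal C {ptl_gen n \<alpha> i} = {a \<in> carrier C. \<forall>v\<in>alpha_space \<phi> n N \<alpha>. act v a = 0}"
    (is "?J = ?I")
proof
  interpret C: salg C by (rule salg_C)
  have I: "?I = {a \<in> carrier C. \<forall>v\<in>V. act v a = 0}" using annihilates_alpha_space by blast
  have g: "gen \<alpha> i \<in> carrier C" by (rule gen_C[OF i])
  have J: "ideal ?J C" using C.genideal_ideal g gen_eq by auto
  have gJ: "gen \<alpha> i \<in> ?J" using C.genideal_self' g gen_eq by auto
  show JI: "?J \<subseteq> ?I"
    unfolding I by (rule C.genideal_minimal[OF ideal_annihilator_C])
      (use g gen_eq act_gen_eq_0[OF N i] in auto)
  show "?I \<subseteq> ?J"
  proof
    fix a assume a: "a \<in> ?I"
    have JB: "ideal ?J B" using J unfolding C_eq by (rule idem.ideal_corner(1))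
    have bB: "bas ` S \<subseteq> carrier B" using bas_C C_iff by auto
    obtain c y where y: "y \<in> ?J" "a = y \<oplus>\<^bsub>B\<^esub> (\<Oplus>\<^bsub>B\<^esub>j\<in>S. c j \<odot>\<^bsub>B\<^esub> bas j)"
      using lspan_finite[OF finite_S bB spanning_C[OF J i gJ] JB] a by blast
    have yc: "y \<in> carrier B" using JB y(1) ideal_carrier by blast
    have sc: "(\<Oplus>\<^bsub>B\<^esub>j\<in>S. c j \<odot>\<^bsub>B\<^esub> bas j) \<in> carrier B" using bB by (intro finsum_closed) auto
    have "\<phi> (c j) = 0" if "j \<in> S" for j
    proof (rule independence_bas[OF _ that])
      fix v assume v: "v \<in> V"
      have "act v a = 0" "act v y = 0" using a y(1) JI v unfolding I by auto
      then show "(\<Sum>j\<in>S. scale (\<phi> (c j)) (act v (bas j))) = 0"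
        unfolding act_finsum[OF v finite_S bB, symmetric] using y(2) act_add_r[OF v yc sc] by simp
    qed
    then have c0: "c j = 0" "bas j \<in> carrier B" if "j \<in> S" for j using that inj bB by blast+
    have "(\<Oplus>\<^bsub>B\<^esub>j\<in>S. c j \<odot>\<^bsub>B\<^esub> bas j) = \<zero>\<^bsub>B\<^esub>"
      by (rule add.finprod_one_eqI) (simp add: c0)
    then show "a \<in> ?J" using y yc by simp
  qed
qed

end

section \<open>The annihilator after base change\<close>

sublocale etl_action \<subseteq> X: base_extension "bt_alpha n \<alpha>" \<phi>
  by (rule base_extension.intro[OF salg_C])

context etl_action
begin

abbreviation "actP \<equiv> act_pre_tensor \<phi>"
abbreviation "actX \<equiv> act_base_change \<phi>"

lemma actP_lin_ext: "actP v f = lin_ext (\<lambda>(a, y) m. scale (of_int m * y) (act v a)) f"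
  by (simp add: act_pre_tensor_def lin_ext_def case_prod_unfold)

lemma actP_simps:
  "actP v 0 = 0" "actP v (f + h) = actP v f + actP v h"
  "actP v (Poly_Mapping.single (a, y) m) = scale (of_int m * y) (act v a)"
  unfolding actP_lin_ext
  by (simp_all add: lin_ext_add lin_ext_single case_prod_unfold distrib_right)

lemma actP_diff: "actP v (f - h) = actP v f - actP v h"
  using actP_simps(2)[of v "f - h" h] by simp

lemma actP_left:
  assumes f: "f \<in> carrier X.P"
  shows "actP 0 f = 0" "u \<in> V \<Longrightarrow> v \<in> V \<Longrightarrow> actP (u + v) f = actP u f + actP v f"
    "v \<in> V \<Longrightarrow> actP v f \<in> V"
proof -
  have k: "Poly_Mapping.keys f \<subseteq> carrier C \<times> UNIV" using f by (simp add: pre_tensor_simps)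
  then show "actP 0 f = 0"
    by (induction f rule: poly_mapping_single_induct) (auto simp: actP_simps C_iff act_left(1))
  show "actP (u + v) f = actP u f + actP v f" if "u \<in> V" "v \<in> V"
    using k by (induction f rule: poly_mapping_single_induct)
      (use that in \<open>auto simp: actP_simps C_iff act_left(2)\<close>)
  show "actP v f \<in> V" if "v \<in> V"
    using k by (induction f rule: poly_mapping_single_induct) (use that in \<open>auto simp: actP_simps C_iff\<close>)
qed

lemma actP_mult:
  assumes "f \<in> carrier X.P" "h \<in> carrier X.P" "v \<in> V"
  shows "actP v (f \<otimes>\<^bsub>X.P\<^esub> h) = actP (actP v f) h"
proof -
  have "Poly_Mapping.keys f \<subseteq> carrier C \<times> UNIV" using assms by (simp add: pre_tensor_simps)
  then show ?thesis
  proof (induction f rule: poly_mapping_single_induct)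
    case zero
    then show ?case using actP_left(1)[OF assms(2)] by (simp add: pre_tensor_distr actP_simps)
  next
    case (single k m)
    then obtain a x where k: "k = (a, x)" "a \<in> carrier C" by auto
    then have a: "a \<in> carrier B" using C_iff by simp
    have "Poly_Mapping.keys h \<subseteq> carrier C \<times> UNIV" using assms by (simp add: pre_tensor_simps)
    then show ?case
    proof (induction h rule: poly_mapping_single_induct)
      case (single k' m')
      then obtain b y where "k' = (b, y)" "b \<in> carrier C" by auto
      then show ?case
        using k a assms(3) C_iff
        by (simp add: pre_tensor_mult_single actP_simps C_simps act_mult act_left(3) mult_ac)
    qed (simp_all add: pre_tensor_distr actP_simps)
  next
    case (add f g)
    then have "f \<in> carrier X.P" "g \<in> carrier X.P" by (simp_all add: pre_tensor_simps)
    then show ?case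
      using add assms actP_left(2)[OF assms(2)] actP_left(3) by (simp add: pre_tensor_distr actP_simps)
  qed
qed

text \<open>The relators act as zero because the action is additive in both factors and scalars of
  the algebra act through \<open>\<phi>\<close>; the elements acting as zero form an ideal.\<close>

lemma actP_tensor_ideal:
  assumes "f \<in> X.I" "v \<in> V"
  shows "actP v f = 0"
proof -
  define K where "K = {f \<in> carrier X.P. \<forall>v\<in>V. actP v f = 0}"
  have "ideal K X.P"
    unfolding K_def
    by (rule ideal_annihilator[OF X.P.ring_axioms])
      (simp_all add: actP_mult actP_left pre_tensor_simps(5) actP_simps)
  moreover have "tensor_relators C \<phi> \<subseteq> K"
  proof
    fix f assume f: "f \<in> tensor_relators C \<phi>"
    have "actP v f = 0" if v: "v \<in> V" for v
      using f unfolding tensor_relators_def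
      by (auto simp: actP_diff actP_simps C_simps C_iff act_add_r[OF v] act_smult[OF v] mult.commute)
    then show "f \<in> K" using f X.relators_P by (auto simp: K_def)
  qed
  ultimately have "X.I \<subseteq> K"
    unfolding tensor_ideal_def by (rule X.P.genideal_minimal)
  then show ?thesis using assms by (auto simp: K_def)
qed

lemma actX_class:
  assumes v: "v \<in> V" and f: "f \<in> carrier X.P"
  shows "actX v (X.I +>\<^bsub>X.P\<^esub> f) = actP v f"
proof -
  have eq: "actP v h = actP v f" if "h \<in> X.I +>\<^bsub>X.P\<^esub> f" for h
  proof -
    have h: "h \<in> carrier X.P" "h \<ominus>\<^bsub>X.P\<^esub> f \<in> X.I"
      using that ideal_coset_mem_iff[OF X.ideal_I f] by auto
    then have "h - f \<in> X.I" using f by (simp add: X.P_minus)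
    then show ?thesis using actP_tensor_ideal[OF _ v] actP_diff by fastforce
  qed
  have "f \<in> X.I +>\<^bsub>X.P\<^esub> f"
  proof -
    interpret I: ideal X.I X.P by (rule X.ideal_I)
    show ?thesis using f by (rule I.a_rcos_self)
  qed
  then have "actP v ` (X.I +>\<^bsub>X.P\<^esub> f) = {actP v f}" using eq by blast
  then show ?thesis by (simp add: act_base_change_def)
qed

lemma R_cases:
  assumes "t \<in> carrier X.R"
  obtains f where "f \<in> carrier X.P" "t = X.I +>\<^bsub>X.P\<^esub> f"
  using assms by (auto simp: X.R_simps(1))

lemma actX_simps:
  "v \<in> V \<Longrightarrow> t \<in> carrier X.R \<Longrightarrow> actX v t \<in> V"
  "t \<in> carrier X.R \<Longrightarrow> actX 0 t = 0"
  "v \<in> V \<Longrightarrow> a \<in> carrier C \<Longrightarrow> actX v (X.pt a y) = scale y (act v a)"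
  by (metis R_cases actX_class actP_left(3), metis R_cases actX_class actP_left(1) V_closed(1))
    (simp add: pure_tensor_def actX_class X.single_P actP_simps)

lemma actX_add:
  assumes "v \<in> V" "t \<in> carrier X.R" "u \<in> carrier X.R"
  shows "actX v (t \<oplus>\<^bsub>X.R\<^esub> u) = actX v t + actX v u"
proof -
  obtain f h where fh: "f \<in> carrier X.P" "t = X.I +>\<^bsub>X.P\<^esub> f" "h \<in> carrier X.P" "u = X.I +>\<^bsub>X.P\<^esub> h"
    using assms R_cases by metis
  show ?thesis
    unfolding fh(2,4) X.class_add[OF fh(1,3)] using fh assms X.P_add_closed[OF fh(1,3)]
    by (simp add: actX_class actP_simps)
qed

lemma actX_mult:
  assumes "v \<in> V" "t \<in> carrier X.R" "u \<in> carrier X.R"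
  shows "actX v (t \<otimes>\<^bsub>X.R\<^esub> u) = actX (actX v t) u"
proof -
  obtain f h where fh: "f \<in> carrier X.P" "t = X.I +>\<^bsub>X.P\<^esub> f" "h \<in> carrier X.P" "u = X.I +>\<^bsub>X.P\<^esub> h"
    using assms R_cases by metis
  show ?thesis
    unfolding fh(2,4) X.R_simps(2)[OF fh(1,3)] using fh assms X.P.m_closed[OF fh(1,3)] actP_left(3)
    by (simp add: actX_class actP_mult)
qed

lemma actX_finsum:
  assumes "v \<in> V" "finite K" "K \<subseteq> S"
  shows "actX v (\<Oplus>\<^bsub>X.R\<^esub>j\<in>K. X.pt (bas j) (c j)) = (\<Sum>j\<in>K. scale (c j) (act v (bas j)))"
  using assms(2,3)
proof (induction K rule: finite_induct)
  case empty
  have "actX v \<zero>\<^bsub>X.R\<^esub> + actX v \<zero>\<^bsub>X.R\<^esub> = actX v \<zero>\<^bsub>X.R\<^esub>"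
    using actX_add[OF assms(1) X.R.zero_closed X.R.zero_closed] by simp
  then show ?case by simp
next
  case (insert k K)
  then have "bas k \<in> carrier C" "(\<lambda>j. X.pt (bas j) (c j)) \<in> K \<rightarrow> carrier X.R" using bas_C by auto
  then show ?case using insert assms(1) X.R.finsum_closed by (simp add: actX_add actX_simps)
qed

text \<open>Straightening is available in the algebra before base change. It is applied there modulo
  the pullback of \<open>J\<close>, and the Laurent coefficients are then absorbed in the second
  factor of the tensors.\<close>

lemma spanning_R:
  assumes J: "ideal J X.R" and i: "1 \<le> i" "Suc i < n" "X.pt (gen \<alpha> i) 1 \<in> J" and t: "t \<in> carrier X.R"
  shows "\<exists>c. \<exists>y\<in>J. t = y \<oplus>\<^bsub>X.R\<^esub> (\<Oplus>\<^bsub>X.R\<^esub>j\<in>S. X.pt (bas j) (c j))"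
proof -
  interpret J: ideal J X.R by fact
  define s where "s c = (\<Oplus>\<^bsub>X.R\<^esub>j\<in>S. X.pt (bas j) (c j))" for c
  have s_closed: "s c \<in> carrier X.R" for c
    unfolding s_def using bas_C by (intro X.R.finsum_closed) auto
  have s_add: "s c \<oplus>\<^bsub>X.R\<^esub> s d = s (\<lambda>j. c j + d j)" for c d
  proof -
    have "s (\<lambda>j. c j + d j) = (\<Oplus>\<^bsub>X.R\<^esub>j\<in>S. X.pt (bas j) (c j) \<oplus>\<^bsub>X.R\<^esub> X.pt (bas j) (d j))"
      unfolding s_def using bas_C by (intro X.R.add.finprod_cong') (auto simp: X.pt_add_r)
    also have "\<dots> = s c \<oplus>\<^bsub>X.R\<^esub> s d"
      unfolding s_def using bas_C by (intro X.R.finsum_addf) auto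
    finally show ?thesis by simp
  qed
  have s_zero: "s (\<lambda>_. 0) = \<zero>\<^bsub>X.R\<^esub>"
    unfolding s_def using bas_C by (intro X.R.add.finprod_one_eqI) auto
  have s_single: "s (\<lambda>k. if k = j then x else 0) = X.pt (bas j) x" if j: "j \<in> S" for j x
  proof -
    have "s (\<lambda>k. if k = j then x else 0) = (\<Oplus>\<^bsub>X.R\<^esub>k\<in>S. if j = k then X.pt (bas k) x else \<zero>\<^bsub>X.R\<^esub>)"
      unfolding s_def using bas_C by (intro X.R.add.finprod_cong') auto
    also have "\<dots> = X.pt (bas j) x" using finite_S j bas_C by (intro X.R.add.finprod_singleton) auto
    finally show ?thesis .
  qed
  define M where "M = {y \<oplus>\<^bsub>X.R\<^esub> s c | y c. y \<in> J}"
  have M_add: "t \<oplus>\<^bsub>X.R\<^esub> u \<in> M" if "t \<in> M" "u \<in> M" for t u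
  proof -
    obtain y c z d where tu: "t = y \<oplus>\<^bsub>X.R\<^esub> s c" "y \<in> J" "u = z \<oplus>\<^bsub>X.R\<^esub> s d" "z \<in> J"
      using \<open>t \<in> M\<close> \<open>u \<in> M\<close> unfolding M_def by blast
    have "t \<oplus>\<^bsub>X.R\<^esub> u = (y \<oplus>\<^bsub>X.R\<^esub> z) \<oplus>\<^bsub>X.R\<^esub> s (\<lambda>j. c j + d j)"
      using tu J.a_Hcarr s_closed by (simp add: s_add[symmetric] X.R.a_ac)
    then show ?thesis using J.a_closed[OF tu(2,4)] unfolding M_def by blast
  qed
  have M_J: "y \<in> M" if "y \<in> J" for y
  proof -
    have "y = y \<oplus>\<^bsub>X.R\<^esub> s (\<lambda>_. 0)" using that J.a_Hcarr by (simp add: s_zero)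
    then show ?thesis using that unfolding M_def by blast
  qed
  have M_bas: "X.pt (bas j) x \<in> M" if "j \<in> S" for j x
  proof -
    have "X.pt (bas j) x = \<zero>\<^bsub>X.R\<^esub> \<oplus>\<^bsub>X.R\<^esub> s (\<lambda>k. if k = j then x else 0)"
      using that bas_C by (simp add: s_single)
    then show ?thesis using J.zero_closed unfolding M_def by blast
  qed
  \<comment> \<open>The preimage of \<open>J\<close> under tensoring with 1; since \<open>J\<close>
    absorbs the tensors of the unit with x, it controls the tensors with every x.\<close>
  define J0 where "J0 = {a \<in> carrier C. X.pt a 1 \<in> J}"
  have J0: "ideal J0 C"
  proof (rule idealI)
    show "ring C" by (rule X.ring_axioms)
    show "subgroup J0 (add_monoid C)"
    proof (rule group.subgroupI)
      show "group (add_monoid C)" by (rule X.a_group)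
      have "\<zero>\<^bsub>C\<^esub> \<in> J0" using J.zero_closed by (simp add: J0_def)
      then show "J0 \<noteq> {}" by blast
      fix a assume a: "a \<in> J0"
      \<comment> \<open>The negative is a scalar multiple, hence becomes a product in the base
        change, where \<open>J\<close> absorbs it.\<close>
      have "X.pt ((- 1) \<odot>\<^bsub>C\<^esub> a) 1 = X.pt a 1 \<otimes>\<^bsub>X.R\<^esub> X.pt \<one>\<^bsub>C\<^esub> (\<phi> (- 1))"
        using a by (simp add: J0_def X.pt_smult X.pt_mult)
      also have "\<dots> \<in> J" using a by (intro J.I_r_closed) (simp_all add: J0_def)
      finally show "inv\<^bsub>add_monoid C\<^esub> a \<in> J0"
        using a by (simp add: J0_def a_inv_def[symmetric] X.smult_uminus)
    next
      fix a b assume "a \<in> J0" "b \<in> J0"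
      then show "a \<otimes>\<^bsub>add_monoid C\<^esub> b \<in> J0" by (simp add: J0_def X.pt_add_l J.a_closed)
    qed (auto simp: J0_def)
  next
    fix a x assume a: "a \<in> J0" and x: "x \<in> carrier C"
    have "X.pt (x \<otimes>\<^bsub>C\<^esub> a) 1 = X.pt x 1 \<otimes>\<^bsub>X.R\<^esub> X.pt a 1" "X.pt (a \<otimes>\<^bsub>C\<^esub> x) 1 = X.pt a 1 \<otimes>\<^bsub>X.R\<^esub> X.pt x 1"
      using a x by (simp_all add: J0_def X.pt_mult)
    then show "x \<otimes>\<^bsub>C\<^esub> a \<in> J0" "a \<otimes>\<^bsub>C\<^esub> x \<in> J0"
      using a x J.I_l_closed J.I_r_closed by (simp_all add: J0_def)
  qed
  have g0: "gen \<alpha> i \<in> J0" using i gen_C by (simp add: J0_def)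
  have pure: "X.pt a x \<in> M" if a: "a \<in> carrier C" for a x
  proof -
    have "a \<in> carrier C \<and> (\<forall>x. X.pt a x \<in> M)" if "a \<in> lspan (J0 \<union> bas ` S)" for a
      using that
    proof induction
      case lspan_zero
      have "X.pt \<zero>\<^bsub>B\<^esub> x = \<zero>\<^bsub>X.R\<^esub>" for x using X.pt_zero(2) by (simp add: C_simps)
      then show ?case using M_J[OF J.zero_closed] X.zero_closed by (simp add: C_simps)
    next
      case (lspan_base a)
      then consider "a \<in> J0" | j where "j \<in> S" "a = bas j" by blast
      then show ?case
      proof cases
        case 1
        then have ac: "a \<in> carrier C" "X.pt a 1 \<in> J" by (auto simp: J0_def)
        have "X.pt a x \<in> J" for x
          using J.I_r_closed[OF ac(2), of "X.pt \<one>\<^bsub>C\<^esub> x"] ac(1) by (simp add: X.pt_mult)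
        then show ?thesis using ac(1) M_J by simp
      next
        case 2
        then show ?thesis using bas_C M_bas by simp
      qed
    next
      case (lspan_add a b)
      then have "X.pt (a \<oplus>\<^bsub>C\<^esub> b) x \<in> M" for x using X.pt_add_l M_add by simp
      then show ?case using lspan_add X.a_closed[of a b] by (simp add: C_simps)
    next
      case (lspan_smult a c)
      then have "X.pt (c \<odot>\<^bsub>C\<^esub> a) x \<in> M" for x using X.pt_smult by simp
      then show ?case using lspan_smult X.smult_closed[of a c] by (simp add: C_simps)
    qed
    then show ?thesis using spanning_C[OF J0 i(1,2) g0 a] by blast
  qed
  have "t \<in> M"
    using t by (induction rule: X.base_change_induct) (use pure M_add in auto)
  then show ?thesis unfolding M_def s_def by blast
qed

text \<open>Here the coefficients \<open>c j\<close> lie in the target ring itself, so independence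
  applies to them directly. This is where independence over every commutative ring is used.\<close>

lemma genideal_annihilator_over:
  assumes i: "1 \<le> i" "Suc i < n"
  shows "genideal X.R {X.pt (ptl_gen n \<alpha> i) 1} =
    {t \<in> carrier X.R. \<forall>v\<in>alpha_space \<phi> n N \<alpha>. actX v t = 0}" (is "?J = ?I")
proof
  have one: "X.pt (idem \<alpha>) 1 = \<one>\<^bsub>X.R\<^esub>" using X.pt_one by (simp add: C_simps)
  have idC: "idem \<alpha> \<in> carrier C" using C_iff idem_idem by simp
  have I: "?I = {t \<in> carrier X.R. \<forall>v\<in>V. actX v t = 0}"
  proof -
    \<comment> \<open>The tensor of \<open>idem \<alpha>\<close> with 1 is the unit of the base
      change, so acting by the idempotent first changes nothing.\<close>
    have "actX (act v (idem \<alpha>)) t = actX v t" if "v \<in> V" "t \<in> carrier X.R" for v t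
      using actX_mult[of v "X.pt (idem \<alpha>) 1" t] that idC
      by (simp add: actX_simps one) (simp add: one[symmetric] actX_simps idC)
    then show ?thesis unfolding alpha_space_eq by auto
  qed
  have gC: "gen \<alpha> i \<in> carrier C" by (rule gen_C[OF i])
  have g: "X.pt (gen \<alpha> i) 1 \<in> carrier X.R" using gC by simp
  have J: "ideal ?J X.R" using X.R.genideal_ideal g gen_eq by auto
  have gJ: "X.pt (gen \<alpha> i) 1 \<in> ?J" using X.R.genideal_self' g gen_eq by auto
  have ann: "ideal {t \<in> carrier X.R. \<forall>v\<in>V. actX v t = 0} X.R"
    by (rule ideal_annihilator[OF X.R.ring_axioms]) (simp_all add: actX_add actX_mult actX_simps)
  show JI: "?J \<subseteq> ?I"
    unfolding I
  proof (rule X.R.genideal_minimal[OF ann])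
    have "actX v (X.pt (gen \<alpha> i) 1) = 0" if "v \<in> V" for v
      using actX_simps(3)[OF that gC] act_gen_eq_0[OF N i that] by simp
    then show "{X.pt (ptl_gen n \<alpha> i) 1} \<subseteq> {t \<in> carrier X.R. \<forall>v\<in>V. actX v t = 0}"
      using g gen_eq by simp
  qed
  show "?I \<subseteq> ?J"
  proof
    fix t assume t: "t \<in> ?I"
    obtain c y where y: "y \<in> ?J" "t = y \<oplus>\<^bsub>X.R\<^esub> (\<Oplus>\<^bsub>X.R\<^esub>j\<in>S. X.pt (bas j) (c j))"
      using spanning_R[OF J i gJ] t by blast
    have yc: "y \<in> carrier X.R" using y(1) JI by blast
    have sc: "(\<Oplus>\<^bsub>X.R\<^esub>j\<in>S. X.pt (bas j) (c j)) \<in> carrier X.R"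
      using bas_C by (intro X.R.finsum_closed) auto
    have "c j = 0" if "j \<in> S" for j
    proof (rule independence_bas[OF _ that])
      fix v assume v: "v \<in> V"
      have "actX v t = 0" "actX v y = 0" using t y(1) JI v unfolding I by auto
      then show "(\<Sum>j\<in>S. scale (c j) (act v (bas j))) = 0"
        unfolding actX_finsum[OF v finite_S subset_refl, symmetric]
        using y(2) actX_add[OF v yc sc] by simp
    qed
    then have "(\<Oplus>\<^bsub>X.R\<^esub>j\<in>S. X.pt (bas j) (c j)) = \<zero>\<^bsub>X.R\<^esub>"
      by (intro X.R.add.finprod_one_eqI) (simp add: bas_C)
    then show "t \<in> ?J" using y yc by simp
  qed
qed

end

text \<open>For nonzero \<open>x\<close> integer powers are additive in the exponent, which is
  multiplicativity on monomials; additivity extends it to all Laurent polynomials.\<close>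

lemma laurent_map_eval:
  fixes x :: "'k::field"
  assumes "x \<noteq> 0"
  shows "laurent_map (laurent_eval x)"
proof
  have le: "laurent_eval x c = lin_ext (\<lambda>k m. of_int m * x powi k) c" for c
    by (simp add: laurent_eval_def lin_ext_def)
  have add: "laurent_eval x (a + b) = laurent_eval x a + laurent_eval x b" for a b
    unfolding le by (rule lin_ext_add) (simp_all add: distrib_right)
  have single: "laurent_eval x (Poly_Mapping.single k m) = of_int m * x powi k" for k m
    unfolding le by (rule lin_ext_single) simp
  have zero: "laurent_eval x 0 = 0" unfolding le by simp
  show "laurent_eval x (a + b) = laurent_eval x a + laurent_eval x b" for a b by (rule add)
  show "laurent_eval x 1 = 1" using single[of 0 1] by simp
  fix a b :: laurent
  have "Poly_Mapping.keys a \<subseteq> UNIV" by simp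
  then show "laurent_eval x (a * b) = laurent_eval x a * laurent_eval x b"
  proof (induction a rule: poly_mapping_single_induct)
    case (single k m)
    have "Poly_Mapping.keys b \<subseteq> UNIV" by simp
    then show ?case
    proof (induction b rule: poly_mapping_single_induct)
      case (single l p)
      show ?case
        by (simp add: mult_single \<open>\<And>k m. laurent_eval x (Poly_Mapping.single k m) = of_int m * x powi k\<close>
            power_int_add assms)
    qed (simp_all add: add distrib_left zero)
  qed (simp_all add: add distrib_right zero)
qed

theorem corollary20:
  fixes n :: nat and \<alpha> :: "nat list"
  assumes "3 \<le> n" and "integer_partition n \<alpha>"
  shows "(\<forall>i\<in>{1..n - 2}. \<forall>j\<in>{1..n - 2}. PTL n \<alpha> i = PTL n \<alpha> j) \<and>
    (\<forall>i\<in>{1..n - 2}. PTL n \<alpha> i = ETL n 2 \<alpha>) \<and>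
    (\<forall>x :: 'k :: field. x \<noteq> 0 \<longrightarrow>
      (\<forall>i\<in>{1..n - 2}. \<forall>j\<in>{1..n - 2}. PTL_over x n \<alpha> i = PTL_over x n \<alpha> j) \<and>
      (\<forall>i\<in>{1..n - 2}. PTL_over x n \<alpha> i = ETL_over x n 2 \<alpha>))"
proof -
  \<comment> \<open>The right-hand side does not mention \<open>i\<close>, so this equality also
    yields that the quotient does not depend on the choice of \<open>i\<close>.\<close>
  have integral: "PTL n \<alpha> i = ETL n 2 \<alpha>" if i: "i \<in> {1..n - 2}" for i
  proof -
    have i': "1 \<le> i" "Suc i < n" using i by auto
    have "etl_action (\<lambda>c :: laurent. c) 2 (length \<alpha>) \<alpha>" by unfold_locales simp_all
    then have "genideal (bt_alpha n \<alpha>) {ptl_gen n \<alpha> i} = etl_ideal n 2 \<alpha>"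
      unfolding etl_ideal_def by (rule etl_action.genideal_annihilator[OF _ i'])
    then show ?thesis by (simp only: PTL_def ETL_def)
  qed
  have field: "PTL_over x n \<alpha> i = ETL_over x n 2 \<alpha>" if x: "x \<noteq> 0" and i: "i \<in> {1..n - 2}" for x :: 'k and i
  proof -
    have i': "1 \<le> i" "Suc i < n" using i by auto
    have "etl_action (laurent_eval x) 2 (length \<alpha>) \<alpha>"
      by (intro etl_action.intro etl_action_axioms.intro bt_action.intro laurent_map_eval x refl)
    from etl_action.genideal_annihilator_over[OF this i']
    have "genideal (bt_alpha_over x n \<alpha>) {pure_tensor (bt_alpha n \<alpha>) (laurent_eval x) (ptl_gen n \<alpha> i) 1} =
      etl_ideal_over x n 2 \<alpha>"
      by (simp only: etl_ideal_over_def bt_alpha_over_def)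
    then show ?thesis by (simp only: PTL_over_def ETL_over_def)
  qed
  show ?thesis
  proof (intro conjI ballI allI impI)
    fix i j assume ij: "i \<in> {1..n - 2}" "j \<in> {1..n - 2}"
    show "PTL n \<alpha> i = PTL n \<alpha> j" by (rule trans[OF integral[OF ij(1)] integral[OF ij(2), symmetric]])
    fix x :: 'k assume x: "x \<noteq> 0"
    show "PTL_over x n \<alpha> i = PTL_over x n \<alpha> j"
      by (rule trans[OF field[OF x ij(1)] field[OF x ij(2), symmetric]])
  qed (rule integral field, assumption+)+
qed

end
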